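(* Let $n \in \mathbb{Z}$ be an integer. The solvable Baumslag--Solitar group $\Gamma = \operatorname{BS}(1,n) \cong \langle a,t \mid t^{-1}at = a^n \rangle$ is profinitely rigid in the absolute sense; that is, for every finitely generated residually finite group $\Delta$, there is an isomorphism of profinite completions $\widehat{\Gamma} \cong \widehat{\Delta}$ if and only if $\Gamma \cong \Delta$.
   Context: The profinite completion $\widehat{\Gamma}$ of a group $\Gamma$ is the topological group given by the inverse limit of the finite quotients of $\Gamma$ (each finite quotient being discrete); isomorphisms of profinite completions are isomorphisms of topological groups. A finitely generated residually finite group $\Gamma$ is profinitely rigid in the absolute sense if the isomorphism type of $\widehat{\Gamma}$ determines the isomorphism type of $\Gamma$ uniquely among all finitely generated residually finite groups. *)

theory Defs
  imports "HOL-Algebra.Algebra" "HOL-Analysis.Analysis"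
begin

section \<open>Groups given by generators and relations\<close>

text \<open>
  Every element of the type \<open>'g\<close> is a generator. The letter \<open>(x, True)\<close> stands for \<open>x\<close> and
  \<open>(x, False)\<close> for its inverse; a relation \<open>u = v\<close> between words is the pair \<open>(u, v)\<close>.
\<close>

type_synonym 'g word = "('g \<times> bool) list"

inductive word_cong :: "('g word \<times> 'g word) set \<Rightarrow> 'g word \<Rightarrow> 'g word \<Rightarrow> bool"
  for R :: "('g word \<times> 'g word) set"
where
  rel: "(u, v) \<in> R \<Longrightarrow> word_cong R u v"
| cancel: "word_cong R [(x, b), (x, \<not> b)] []"
| refl: "word_cong R u u"
| sym: "word_cong R u v \<Longrightarrow> word_cong R v u"
| trans: "word_cong R u v \<Longrightarrow> word_cong R v w \<Longrightarrow> word_cong R u w"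
| append: "word_cong R u u' \<Longrightarrow> word_cong R v v' \<Longrightarrow> word_cong R (u @ v) (u' @ v')"

definition word_class :: "('g word \<times> 'g word) set \<Rightarrow> 'g word \<Rightarrow> 'g word set" where
  "word_class R u = {v. word_cong R u v}"

definition presented_group :: "('g word \<times> 'g word) set \<Rightarrow> 'g word set monoid" where
  "presented_group R =
     \<lparr>carrier = range (word_class R),
      monoid.mult = (\<lambda>C D. \<Union>u\<in>C. \<Union>v\<in>D. word_class R (u @ v)),
      one = word_class R []\<rparr>"

fun gen_power :: "'g \<Rightarrow> int \<Rightarrow> 'g word" where
  "gen_power x k = replicate (nat \<bar>k\<bar>) (x, k \<ge> 0)"

datatype bs_gen = gen_a | gen_t

definition BS1 :: "int \<Rightarrow> bs_gen word set monoid" where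
  "BS1 n = presented_group
     {([(gen_t, False), (gen_a, True), (gen_t, True)], gen_power gen_a n)}"

lemma word_class_eq_iff: "word_class R u = word_class R v \<longleftrightarrow> word_cong R u v"
  unfolding word_class_def by (metis (no_types, lifting) Collect_cong mem_Collect_eq word_cong.refl word_cong.sym word_cong.trans)

lemma presented_group_mult:
  "word_class R u \<otimes>\<^bsub>presented_group R\<^esub> word_class R v = word_class R (u @ v)"
proof -
  have *: "word_class R (u' @ v') = word_class R (u @ v)"
    if "u' \<in> word_class R u" "v' \<in> word_class R v" for u' v'
  proof -
    have "word_cong R (u @ v) (u' @ v')"
      using that unfolding word_class_def by (simp add: word_cong.append)
    then show ?thesis
      by (metis word_class_eq_iff)
  qed
  have mem: "u \<in> word_class R u" "v \<in> word_class R v"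
    by (simp_all add: word_class_def word_cong.refl)
  have "(\<Union>u'\<in>word_class R u. \<Union>v'\<in>word_class R v. word_class R (u' @ v'))
      = (\<Union>u'\<in>word_class R u. \<Union>v'\<in>word_class R v. word_class R (u @ v))"
    by (intro SUP_cong HOL.refl *)
  also have "\<dots> = word_class R (u @ v)"
    using mem by blast
  finally show ?thesis
    by (simp add: presented_group_def)
qed

definition inv_word :: "'g word \<Rightarrow> 'g word" where
  "inv_word u = rev (map (\<lambda>(x, b). (x, \<not> b)) u)"

lemma word_cong_inv_word: "word_cong R (inv_word u @ u) []"
proof (induction u)
  case Nil
  then show ?case by (simp add: inv_word_def word_cong.refl)
next
  case (Cons l u)
  obtain x b where l: "l = (x, b)" by force
  have "word_cong R [(x, \<not> b), (x, b)] []"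
    using word_cong.cancel[of R x "\<not> b"] by simp
  then have "word_cong R ([(x, \<not> b), (x, b)] @ u) ([] @ u)"
    by (rule word_cong.append[OF _ word_cong.refl])
  then have "word_cong R (inv_word u @ ([(x, \<not> b), (x, b)] @ u)) (inv_word u @ ([] @ u))"
    by (rule word_cong.append[OF word_cong.refl])
  then have "word_cong R (inv_word (l # u) @ l # u) (inv_word u @ u)"
    by (simp add: inv_word_def l)
  from word_cong.trans[OF this Cons] show ?case .
qed

lemma group_presented_group: "group (presented_group R)"
proof (rule groupI)
  fix C assume "C \<in> carrier (presented_group R)"
  then obtain u where u: "C = word_class R u"
    by (auto simp: presented_group_def)
  have "word_class R (inv_word u) \<otimes>\<^bsub>presented_group R\<^esub> C = \<one>\<^bsub>presented_group R\<^esub>"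
    unfolding u presented_group_mult
    by (simp add: presented_group_def word_class_eq_iff word_cong_inv_word)
  then show "\<exists>D\<in>carrier (presented_group R). D \<otimes>\<^bsub>presented_group R\<^esub> C = \<one>\<^bsub>presented_group R\<^esub>"
    by (auto simp: presented_group_def)
next
  have one: "\<one>\<^bsub>presented_group R\<^esub> = word_class R []"
    and carr: "carrier (presented_group R) = range (word_class R)"
    by (simp_all add: presented_group_def)
  show "\<one>\<^bsub>presented_group R\<^esub> \<in> carrier (presented_group R)"
    by (simp add: one carr)
  show "C \<otimes>\<^bsub>presented_group R\<^esub> D \<in> carrier (presented_group R)"
    if "C \<in> carrier (presented_group R)" "D \<in> carrier (presented_group R)" for C D
    using that by (auto simp: carr presented_group_mult)
  show "C \<otimes>\<^bsub>presented_group R\<^esub> D \<otimes>\<^bsub>presented_group R\<^esub> E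
      = C \<otimes>\<^bsub>presented_group R\<^esub> (D \<otimes>\<^bsub>presented_group R\<^esub> E)"
    if "C \<in> carrier (presented_group R)" "D \<in> carrier (presented_group R)"
      "E \<in> carrier (presented_group R)" for C D E
    using that by (auto simp: carr presented_group_mult)
  show "\<one>\<^bsub>presented_group R\<^esub> \<otimes>\<^bsub>presented_group R\<^esub> C = C"
    if "C \<in> carrier (presented_group R)" for C
    using that by (auto simp: carr one presented_group_mult)
qed

section \<open>Profinite completion\<close>

definition finite_index_normal :: "('a, 'm) monoid_scheme \<Rightarrow> 'a set set" where
  "finite_index_normal G = {N. N \<lhd> G \<and> finite (carrier (G Mod N))}"

text \<open>
  The inverse limit consists of the families of cosets that are compatible with all projections
  \<open>N #> g \<mapsto> M #> g\<close> for \<open>N \<subseteq> M\<close>. It is taken inside the product of the finite quotients,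
  from which it inherits its multiplication and its topology.
\<close>

definition profinite_carrier :: "('a, 'm) monoid_scheme \<Rightarrow> ('a set \<Rightarrow> 'a set) set" where
  "profinite_carrier G =
     {x \<in> (\<Pi>\<^sub>E N\<in>finite_index_normal G. carrier (G Mod N)).
        \<forall>N\<in>finite_index_normal G. \<forall>M\<in>finite_index_normal G. N \<subseteq> M \<longrightarrow>
          (\<forall>g\<in>carrier G. x N = N #>\<^bsub>G\<^esub> g \<longrightarrow> x M = M #>\<^bsub>G\<^esub> g)}"

definition profinite_completion :: "('a, 'm) monoid_scheme \<Rightarrow> ('a set \<Rightarrow> 'a set) monoid" where
  "profinite_completion G =
     (product_group (finite_index_normal G) (\<lambda>N. G Mod N))\<lparr>carrier := profinite_carrier G\<rparr>"

definition profinite_topology :: "('a, 'm) monoid_scheme \<Rightarrow> ('a set \<Rightarrow> 'a set) topology" where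
  "profinite_topology G =
     subtopology
       (product_topology (\<lambda>N. discrete_topology (carrier (G Mod N))) (finite_index_normal G))
       (profinite_carrier G)"

definition profinitely_isomorphic ::
    "('a, 'm) monoid_scheme \<Rightarrow> ('b, 'k) monoid_scheme \<Rightarrow> bool" where
  "profinitely_isomorphic G H \<longleftrightarrow>
     (\<exists>h. h \<in> iso (profinite_completion G) (profinite_completion H) \<and>
          homeomorphic_map (profinite_topology G) (profinite_topology H) h)"

section \<open>Profinite rigidity\<close>

definition finitely_generated_group :: "('a, 'm) monoid_scheme \<Rightarrow> bool" where
  "finitely_generated_group G \<longleftrightarrow>
     group G \<and> (\<exists>S. finite S \<and> S \<subseteq> carrier G \<and> generate G S = carrier G)"

definition residually_finite :: "('a, 'm) monoid_scheme \<Rightarrow> bool" where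
  "residually_finite G \<longleftrightarrow>
     group G \<and> (\<forall>g\<in>carrier G. g \<noteq> \<one>\<^bsub>G\<^esub> \<longrightarrow> (\<exists>N\<in>finite_index_normal G. g \<notin> N))"

text \<open>
  HOL cannot quantify over types inside a formula, so the groups \<open>\<Delta>\<close> compared with \<open>\<Gamma>\<close> have
  elements in a type \<open>'b\<close> passed as an argument. Absolute rigidity is this property for every
  type \<open>'b\<close>; the type \<open>nat\<close> already accommodates a copy of every finitely generated group.
\<close>

definition profinitely_rigid :: "'b itself \<Rightarrow> ('a, 'm) monoid_scheme \<Rightarrow> bool" where
  "profinitely_rigid _ \<Gamma> \<longleftrightarrow>
     finitely_generated_group \<Gamma> \<and> residually_finite \<Gamma> \<and>
     (\<forall>\<Delta> :: 'b monoid. finitely_generated_group \<Delta> \<and> residually_finite \<Delta> \<longrightarrow>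
        (profinitely_isomorphic \<Gamma> \<Delta> \<longleftrightarrow> \<Gamma> \<cong> \<Delta>))"

end

theory Submission
  imports Defs "HOL-Library.Z2" "HOL-Computational_Algebra.Polynomial" "HOL-Number_Theory.Residues"
begin

text \<open>Let \<open>\<Gamma> = BS(1,n)\<close> be generated by \<open>A\<close> and \<open>T\<close> with \<open>T\<close> conjugating \<open>A\<close> to \<open>A^n\<close>, and let \<open>\<Delta>\<close> be a
finitely generated residually finite group with an isomorphic profinite completion. For a normal
subgroup \<open>N\<close> of finite index in \<open>\<Delta>\<close>, the composite of \<open>\<Gamma>\<close>, its completion, the completion of \<open>\<Delta>\<close> and
\<open>\<Delta>/N\<close> is a surjective homomorphism. These homomorphisms are compatible for varying \<open>N\<close>, and every
subgroup of finite index in \<open>\<Gamma>\<close> contains the kernel of one of them. The proof that \<open>\<Gamma>\<close> and \<open>\<Delta>\<close> are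
isomorphic uses nothing else about the completions; the locale \<open>quotient_matching\<close> records this data
as a relation between elements. (The converse is the functoriality of the completion.)

Since \<open>\<Gamma>\<close> has arbitrarily large finite cyclic quotients, so has \<open>\<Delta>\<close>, and there is a surjection of \<open>\<Delta>\<close>
onto the integers (\<open>integer_hom_transfer\<close>). Let \<open>K\<close> be its kernel and \<open>t\<close> an element of \<open>\<Delta>\<close> of degree
one. Suppose \<open>n \<noteq> 1\<close>. The class of \<open>A\<close> is torsion in the abelianisation of \<open>\<Gamma>\<close>, so the image of \<open>A\<close>
in any finite quotient of \<open>\<Delta>\<close> comes from \<open>K\<close>, and conversely the image of \<open>K\<close> there is generated by
the image of \<open>A\<close>. By residual finiteness \<open>K\<close> is abelian, and it is torsion-free; each quotient of \<open>K\<close>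
by a \<open>t\<close>-invariant subgroup of finite index is cyclic (\<open>stable_quotient_cyclic\<close>).

The group \<open>K\<close> is a finitely generated module over the Laurent polynomials in \<open>t\<close>. Two applications
of Nakayama's argument show that such a module, if all its finite quotients are cyclic groups, has
rank at most one. The first (\<open>annihilator_modulo\<close>) uses the quotients by \<open>(t^N - 1) K + 2 K\<close> for large
\<open>N\<close> and gives a nonzero integer polynomial that annihilates \<open>K\<close>; the second (\<open>nakayama_rank\<close>), for a
modulus \<open>q\<close> coprime to the outer coefficients of that polynomial, gives one element of \<open>K\<close> such that
every element of \<open>K\<close> has a nonzero multiple among its multiples. Hence \<open>t\<close> acts on \<open>K\<close>, unless \<open>K\<close> is
trivial, as multiplication by a reduced fraction \<open>a/b\<close>, and \<open>K\<close> is a copy of the ring of integers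
with \<open>ab\<close> inverted (\<open>torsion_free_structure\<close>).

It remains to see that \<open>a/b\<close> is \<open>n\<close> or \<open>1/n\<close> when \<open>n \<noteq> 0\<close>. Modulo any \<open>m\<close> coprime to \<open>n\<close>, the element
\<open>t\<close> acts like a power \<open>T^v\<close>, where \<open>v\<close> is invertible modulo any prescribed number
(\<open>slope_congruence\<close>), so \<open>a/b = n^v\<close> modulo \<open>m\<close>. Moreover every divisor \<open>r > 1\<close> of \<open>n\<close> has a factor in
common with \<open>ab\<close> (\<open>denominators\<close>). Together these say that \<open>a^k - b^k\<close> and \<open>n^k - 1\<close> have the same
divisors, and the cases \<open>k = 1\<close> and \<open>k = 2\<close> leave only \<open>a/b = n\<close> and \<open>a/b = 1/n\<close>
(\<open>slope_determined\<close>). Up to replacing \<open>t\<close> by its inverse, \<open>\<Delta>\<close> satisfies the defining relation of \<open>\<Gamma>\<close>,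
and the resulting map is an isomorphism. For \<open>n = 0\<close> the group \<open>K\<close> is trivial.

For \<open>n = 1\<close> the group \<open>\<Gamma>\<close> is free abelian of rank two and the image of \<open>A\<close> need not come from \<open>K\<close>.
Here \<open>\<Delta>\<close> is abelian and torsion-free, and the quotient of \<open>\<Delta>\<close> by the squares, which is generated by
two elements, shows that \<open>K\<close> is infinite cyclic.\<close>

section \<open>Normal subgroups of finite index\<close>

lemma finite_index_normalD:
  assumes "N \<in> finite_index_normal G"
  shows "N \<lhd> G" "subgroup N G" "finite (carrier (G Mod N))"
  using assms by (auto simp: finite_index_normal_def normal_imp_subgroup)

lemma (in group) div_eq_one_iff:
  assumes "x \<in> carrier G" "y \<in> carrier G"
  shows "x \<otimes> inv y = \<one> \<longleftrightarrow> x = y"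
proof
  assume "x \<otimes> inv y = \<one>"
  from inv_equality[OF this inv_closed[OF assms(2)] assms(1)] show "x = y"
    by (simp only: inv_inv[OF assms(2)])
qed (use assms in simp)

lemma (in group) coset_eq_iff:
  assumes "subgroup N G" "g \<in> carrier G" "d \<in> carrier G"
  shows "N #> g = N #> d \<longleftrightarrow> g \<otimes> inv d \<in> N"
proof
  assume "N #> g = N #> d"
  then have "g \<in> N #> d" using rcos_self[OF assms(2,1)] by simp
  then show "g \<otimes> inv d \<in> N"
    by (rule iffD1[OF subgroup.rcos_module[OF assms(1) is_group assms(3,2)]])
next
  assume "g \<otimes> inv d \<in> N"
  then have "g \<in> N #> d"
    by (rule iffD2[OF subgroup.rcos_module[OF assms(1) is_group assms(3,2)]])
  from repr_independence[OF this assms(3,1)] show "N #> g = N #> d" by simp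
qed

lemma (in group) coset_mono_eq:
  assumes "subgroup N G" "subgroup M G" "N \<subseteq> M" "g \<in> carrier G" "d \<in> carrier G"
    and "N #> g = N #> d"
  shows "M #> g = M #> d"
  using assms coset_eq_iff by blast

text \<open>The cosets of the kernel are the fibres of the homomorphism.\<close>

lemma (in group_hom) kernel_finite_index:
  assumes "finite (h ` carrier G)"
  shows "kernel G H h \<in> finite_index_normal G"
proof -
  have "kernel G H h #> x = carrier G \<inter> h -` {h x}" if x: "x \<in> carrier G" for x
  proof -
    have "y \<in> kernel G H h #> x \<longleftrightarrow> h y = h x" if y: "y \<in> carrier G" for y
    proof -
      have "y \<in> kernel G H h #> x \<longleftrightarrow> y \<otimes> inv x \<in> kernel G H h"
        by (rule subgroup.rcos_module[OF subgroup_kernel G.is_group x y])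
      also have "\<dots> \<longleftrightarrow> h y = h x"
        using x y H.div_eq_one_iff by (simp add: kernel_def)
      finally show ?thesis .
    qed
    then show ?thesis
      using x subgroup.subset[OF subgroup_kernel] G.r_coset_subset_G by blast
  qed
  then have "carrier (G Mod kernel G H h) \<subseteq> (\<lambda>y. carrier G \<inter> h -` {y}) ` (h ` carrier G)"
    by (auto simp: carrier_FactGroup)
  then have "finite (carrier (G Mod kernel G H h))"
    using assms finite_subset by blast
  then show ?thesis
    by (simp add: finite_index_normal_def normal_kernel)
qed

lemma (in group) finite_index_normal_Int:
  assumes "N \<in> finite_index_normal G" "M \<in> finite_index_normal G"
  shows "N \<inter> M \<in> finite_index_normal G"
proof -
  have sg: "subgroup N G" "subgroup M G" using assms finite_index_normalD(2) by blast+
  have cos: "(N \<inter> M) #> g = (N #> g) \<inter> (M #> g)" if g: "g \<in> carrier G" for g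
  proof (rule Set.set_eqI)
    fix y
    have *: "y \<in> K #> g \<longleftrightarrow> y \<in> carrier G \<and> y \<otimes> inv g \<in> K" if "subgroup K G" for K
      using subgroup.rcos_module[OF that is_group g, of y] g subgroup.elemrcos_carrier[OF that is_group g]
      by blast
    show "y \<in> (N \<inter> M) #> g \<longleftrightarrow> y \<in> (N #> g) \<inter> (M #> g)"
      using *[OF sg(1)] *[OF sg(2)] *[OF subgroups_Inter_pair[OF sg]] by auto
  qed
  have "carrier (G Mod (N \<inter> M)) \<subseteq> (\<lambda>(C, D). C \<inter> D) ` (carrier (G Mod N) \<times> carrier (G Mod M))"
    using cos by (force simp: carrier_FactGroup)
  then have "finite (carrier (G Mod (N \<inter> M)))"
    using finite_subset[OF _ finite_imageI[OF finite_cartesian_product[OF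
            finite_index_normalD(3)[OF assms(1)] finite_index_normalD(3)[OF assms(2)]]]] by blast
  moreover have "N \<inter> M \<lhd> G"
    using assms normal_subgroup_intersect by (auto simp: finite_index_normal_def)
  ultimately show ?thesis by (simp add: finite_index_normal_def)
qed

lemma (in group) carrier_finite_index_normal: "carrier G \<in> finite_index_normal G"
proof -
  have "carrier G #> g = carrier G" if "g \<in> carrier G" for g
    using that subgroup_self coset_join2 by blast
  then have "carrier (G Mod carrier G) \<subseteq> {carrier G}"
    by (auto simp: carrier_FactGroup)
  then show ?thesis
    by (auto simp: finite_index_normal_def normal_self intro: finite_subset)
qed

lemma (in group) finite_index_normal_Inter:
  assumes "finite I" "I \<subseteq> finite_index_normal G"
  shows "\<exists>N\<in>finite_index_normal G. \<forall>M\<in>I. N \<subseteq> M"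
  using assms
proof (induction I)
  case empty then show ?case using carrier_finite_index_normal by blast
next
  case (insert M I)
  then obtain N where "N \<in> finite_index_normal G" "\<forall>M\<in>I. N \<subseteq> M" by auto
  then show ?case
    using insert.prems by (intro bexI[of _ "N \<inter> M"]) (auto intro: finite_index_normal_Int)
qed

lemma finite_carrier_BijGroup:
  assumes "finite S" shows "finite (carrier (BijGroup S))"
proof -
  have "Bij S \<subseteq> S \<rightarrow>\<^sub>E S" by (auto simp: Bij_def bij_betw_def PiE_def)
  moreover have "finite (S \<rightarrow>\<^sub>E S)" using assms by (intro finite_PiE) simp_all
  ultimately show ?thesis unfolding BijGroup_def by (simp add: finite_subset)
qed

text \<open>The core of \<open>S\<close> is the kernel of the permutation action on the cosets of \<open>S\<close>. The inverse is there
because \<open>G\<close> acts on right cosets from the right.\<close>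

lemma (in group) normal_core_finite_index:
  assumes S: "subgroup S G" and R: "finite R" "R \<subseteq> carrier G"
    and cover: "\<And>g. g \<in> carrier G \<Longrightarrow> \<exists>s\<in>S. \<exists>r\<in>R. g = s \<otimes> r"
  shows "\<exists>N\<in>finite_index_normal G. N \<subseteq> S"
proof -
  let ?C = "rcosets S"
  interpret B: group "BijGroup ?C" by (rule group_BijGroup)
  have sub: "S \<subseteq> carrier G" by (rule subgroup.subset[OF S])
  have C_sub: "Y \<subseteq> carrier G" if "Y \<in> ?C" for Y
    using that subgroup.rcosets_carrier[OF S is_group] by blast
  have C_mult: "Y #> g \<in> ?C" if Y: "Y \<in> ?C" and g: "g \<in> carrier G" for Y g
  proof -
    obtain a where "a \<in> carrier G" "Y = S #> a" using Y by (auto simp: RCOSETS_def)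
    then show ?thesis using g sub by (simp add: coset_mult_assoc rcosetsI)
  qed
  define \<rho> where "\<rho> = (\<lambda>g. \<lambda>Y\<in>?C. Y #> inv g)"
  have \<rho>_compose: "compose ?C (\<rho> g) (\<rho> h) = \<rho> (g \<otimes> h)" if gh: "g \<in> carrier G" "h \<in> carrier G" for g h
  proof
    fix Y
    show "compose ?C (\<rho> g) (\<rho> h) Y = \<rho> (g \<otimes> h) Y"
      using gh C_mult C_sub by (simp add: compose_def \<rho>_def inv_mult_group coset_mult_assoc)
  qed
  have \<rho>_one: "\<rho> g Y = Y" if "g = \<one>" "Y \<in> ?C" for g Y using that C_sub by (simp add: \<rho>_def)
  have \<rho>_Bij: "\<rho> g \<in> Bij ?C" if g: "g \<in> carrier G" for g
  proof -
    have inv: "\<rho> h (\<rho> g Y) = Y" if "g \<in> carrier G" "h \<in> carrier G" "h \<otimes> g = \<one>" "Y \<in> ?C" for g h Y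
      using \<rho>_compose[OF that(2,1)] \<rho>_one[OF that(3,4)] that(4) by (metis compose_eq)
    have cl: "\<rho> g Y \<in> ?C" if "g \<in> carrier G" "Y \<in> ?C" for g Y
      using that C_mult by (simp add: \<rho>_def)
    have "bij_betw (\<rho> g) ?C ?C"
    proof (rule bij_betw_byWitness[where f' = "\<rho> (inv g)"])
      show "\<forall>Y\<in>?C. \<rho> (inv g) (\<rho> g Y) = Y" using inv[of g "inv g"] g by simp
      show "\<forall>Y\<in>?C. \<rho> g (\<rho> (inv g) Y) = Y" using inv[of "inv g" g] g by simp
      show "\<rho> g ` ?C \<subseteq> ?C" using cl[OF g] by (rule image_subsetI)
      show "\<rho> (inv g) ` ?C \<subseteq> ?C" using cl[OF inv_closed[OF g]] by (rule image_subsetI)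
    qed
    then show ?thesis by (simp add: Bij_def \<rho>_def)
  qed
  have carr: "carrier (BijGroup ?C) = Bij ?C" by (simp add: BijGroup_def)
  have "\<rho> \<in> hom G (BijGroup ?C)"
  proof (rule homI)
    show "\<rho> g \<in> carrier (BijGroup ?C)" if "g \<in> carrier G" for g
      using \<rho>_Bij[OF that] by (simp add: carr)
    show "\<rho> (g \<otimes> h) = \<rho> g \<otimes>\<^bsub>BijGroup ?C\<^esub> \<rho> h" if "g \<in> carrier G" "h \<in> carrier G" for g h
      using \<rho>_Bij[OF that(1)] \<rho>_Bij[OF that(2)] \<rho>_compose[OF that] by (simp add: BijGroup_def)
  qed
  then interpret \<rho>: group_hom G "BijGroup ?C" \<rho>
    by (intro group_hom.intro group_hom_axioms.intro is_group B.is_group)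
  have "?C \<subseteq> (\<lambda>r. S #> r) ` R"
  proof
    fix Y assume "Y \<in> ?C"
    then obtain g where g: "g \<in> carrier G" "Y = S #> g" by (auto simp: RCOSETS_def)
    from cover[OF g(1)] obtain s r where sr: "s \<in> S" "r \<in> R" "g = s \<otimes> r" by blast
    then have r: "r \<in> carrier G" using R(2) by blast
    have "g \<in> S #> r" using sr sub r by (auto simp: r_coset_def)
    from repr_independence[OF this r S] have "S #> r = Y" using g(2) by simp
    then show "Y \<in> (\<lambda>r. S #> r) ` R" using sr(2) by blast
  qed
  then have "finite ?C" using R(1) finite_subset by blast
  then have "finite (carrier (BijGroup ?C))" by (rule finite_carrier_BijGroup)
  then have "finite (\<rho> ` carrier G)" by (rule finite_subset[rotated]) (use \<rho>.hom_closed in blast)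
  from \<rho>.kernel_finite_index[OF this] have "kernel G (BijGroup ?C) \<rho> \<in> finite_index_normal G" .
  moreover have "kernel G (BijGroup ?C) \<rho> \<subseteq> S"
  proof
    fix g assume "g \<in> kernel G (BijGroup ?C) \<rho>"
    then have g: "g \<in> carrier G" "\<rho> g = (\<lambda>Y\<in>?C. Y)" by (simp_all add: kernel_def BijGroup_def)
    have SC: "S \<in> ?C" by (rule subgroup.subgroup_in_rcosets[OF S is_group])
    then have "S #> inv g = S" using fun_cong[OF g(2), of S] by (simp add: \<rho>_def)
    then have "inv g \<in> S" using coset_join1 S g(1) inv_closed by blast
    then show "g \<in> S" using subgroup.m_inv_closed[OF S] g(1) by fastforce
  qed
  ultimately show ?thesis by blast
qed

text \<open>By Lagrange, the order of the quotient is such an exponent.\<close>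

lemma (in group) finite_index_exponent:
  assumes N: "N \<in> finite_index_normal G"
  shows "\<exists>J>0. \<forall>d\<in>carrier G. d [^] (J::nat) \<in> N"
proof -
  interpret N: normal N G using N by (rule finite_index_normalD)
  interpret Q: group "G Mod N" by (rule N.factorgroup_is_group)
  have fin: "finite (carrier (G Mod N))" using N by (rule finite_index_normalD)
  have "d [^] Coset.order (G Mod N) \<in> N" if d: "d \<in> carrier G" for d
  proof -
    have "N #> d \<in> carrier (G Mod N)" using d by (auto simp: carrier_FactGroup)
    then have "(N #> d) [^]\<^bsub>G Mod N\<^esub> Coset.order (G Mod N) = N"
      using Q.pow_order_eq_1 by fastforce
    then have "N #> (d [^] Coset.order (G Mod N)) = N" using N.FactGroup_pow[OF d] by simp
    then show ?thesis using coset_join1 N.subgroup_axioms d nat_pow_closed by blast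
  qed
  moreover have "Coset.order (G Mod N) > 0" using fin Q.order_gt_0_iff_finite by simp
  ultimately show ?thesis by blast
qed

lemma integer_hom_finite_index:
  assumes "group G" "f \<in> hom G integer_group" "m > 0"
  shows "{g \<in> carrier G. m dvd f g} \<in> finite_index_normal G"
proof -
  let ?Z = "integer_mod_group (nat m)"
  have "(\<lambda>g. f g mod m) \<in> hom G ?Z"
    using assms(2,3) by (auto simp: hom_def carrier_integer_mod_group mod_simps)
  then interpret h: group_hom G ?Z "\<lambda>g. f g mod m"
    using assms(1) by (intro group_hom.intro group_hom_axioms.intro) simp_all
  have "(\<lambda>g. f g mod m) ` carrier G \<subseteq> {0..<m}" using assms(3) by auto
  then have "finite ((\<lambda>g. f g mod m) ` carrier G)" using finite_subset by blast
  from h.kernel_finite_index[OF this] show ?thesis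
    by (simp add: kernel_def dvd_eq_mod_eq_0)
qed

section \<open>Profinite completions and their finite quotients\<close>

definition coset_family :: "('a, 'm) monoid_scheme \<Rightarrow> 'a \<Rightarrow> 'a set \<Rightarrow> 'a set" where
  "coset_family G g = (\<lambda>N\<in>finite_index_normal G. N #>\<^bsub>G\<^esub> g)"

lemma (in group) coset_family_closed:
  assumes "g \<in> carrier G" shows "coset_family G g \<in> profinite_carrier G"
proof -
  have "M #> g = M #> d"
    if "N \<in> finite_index_normal G" "M \<in> finite_index_normal G" "N \<subseteq> M" "d \<in> carrier G"
      "N #> g = N #> d" for N M d
    using coset_mono_eq[OF finite_index_normalD(2)[OF that(1)] finite_index_normalD(2)[OF that(2)]
        that(3) assms that(4,5)] .
  moreover have "coset_family G g N = N #> g" if "N \<in> finite_index_normal G" for N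
    using that by (simp add: coset_family_def)
  moreover have "coset_family G g \<in> (\<Pi>\<^sub>E N\<in>finite_index_normal G. carrier (G Mod N))"
    using assms by (simp add: coset_family_def carrier_FactGroup)
  ultimately show ?thesis
    unfolding profinite_carrier_def mem_Collect_eq by metis
qed

lemma profinite_carrierD:
  assumes "x \<in> profinite_carrier G"
  shows "x \<in> (\<Pi>\<^sub>E N\<in>finite_index_normal G. carrier (G Mod N))"
    and "\<And>N. N \<in> finite_index_normal G \<Longrightarrow> x N \<in> carrier (G Mod N)"
    and "\<And>N. N \<notin> finite_index_normal G \<Longrightarrow> x N = undefined"
proof -
  show x: "x \<in> (\<Pi>\<^sub>E N\<in>finite_index_normal G. carrier (G Mod N))"
    using assms unfolding profinite_carrier_def by blast
  show "x N \<in> carrier (G Mod N)" if "N \<in> finite_index_normal G" for N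
    by (rule PiE_mem[OF x that])
  show "x N = undefined" if "N \<notin> finite_index_normal G" for N
    by (rule PiE_arb[OF x that])
qed

lemma profinite_carrier_compat:
  assumes "x \<in> profinite_carrier G" "N \<in> finite_index_normal G" "M \<in> finite_index_normal G"
    "N \<subseteq> M" "g \<in> carrier G" "x N = N #>\<^bsub>G\<^esub> g"
  shows "x M = M #>\<^bsub>G\<^esub> g"
  using assms unfolding profinite_carrier_def mem_Collect_eq by metis

lemma profinite_carrierE:
  assumes "x \<in> profinite_carrier G" "N \<in> finite_index_normal G"
  obtains g where "g \<in> carrier G" "x N = N #>\<^bsub>G\<^esub> g"
    "\<And>M. M \<in> finite_index_normal G \<Longrightarrow> N \<subseteq> M \<Longrightarrow> x M = M #>\<^bsub>G\<^esub> g"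
proof -
  obtain g where g: "g \<in> carrier G" "x N = N #>\<^bsub>G\<^esub> g"
    using profinite_carrierD(2)[OF assms] by (auto simp: carrier_FactGroup)
  show ?thesis using that[OF g] profinite_carrier_compat[OF assms _ _ g] by blast
qed

lemma topspace_profinite_topology: "topspace (profinite_topology G) = profinite_carrier G"
  unfolding profinite_topology_def topspace_subtopology topspace_product_topology
    topspace_discrete_topology using profinite_carrierD(1) by blast

lemma profinite_projection_continuous:
  assumes "N \<in> finite_index_normal G"
  shows "continuous_map (profinite_topology G) (discrete_topology (carrier (G Mod N))) (\<lambda>x. x N)"
  unfolding profinite_topology_def
  using continuous_map_product_projection[OF assms,
      of "\<lambda>N. discrete_topology (carrier (G Mod N))"]
  by (rule continuous_map_from_subtopology)

lemma openin_profinite_fibre: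
  assumes "N \<in> finite_index_normal G"
  shows "openin (profinite_topology G) {x \<in> profinite_carrier G. x N = C}"
proof -
  have "openin (profinite_topology G)
      {x \<in> topspace (profinite_topology G). x N \<in> {C} \<inter> carrier (G Mod N)}"
    by (rule openin_continuous_map_preimage[OF profinite_projection_continuous[OF assms]]) auto
  also have "{x \<in> topspace (profinite_topology G). x N \<in> {C} \<inter> carrier (G Mod N)}
      = {x \<in> profinite_carrier G. x N = C}"
    using profinite_carrierD(2)[OF _ assms] unfolding topspace_profinite_topology by blast
  finally show ?thesis .
qed

text \<open>Finite intersections of normal subgroups of finite index have finite index, so a single
  coordinate already cuts out a basic neighbourhood.\<close>

lemma (in group) profinite_nbhd:
  assumes "openin (profinite_topology G) U" "x \<in> U"
  shows "\<exists>N\<in>finite_index_normal G. \<forall>y\<in>profinite_carrier G. y N = x N \<longrightarrow> y \<in> U"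
proof -
  let ?X = "\<lambda>N. discrete_topology (carrier (G Mod N))"
  obtain T where T: "openin (product_topology ?X (finite_index_normal G)) T"
      "U = T \<inter> profinite_carrier G"
    using assms(1) unfolding profinite_topology_def openin_subtopology by blast
  have "x \<in> T" using T(2) assms(2) by blast
  from bspec[OF iffD1[OF openin_product_topology_alt T(1)] this]
  obtain V where V: "finite {N \<in> finite_index_normal G. V N \<noteq> topspace (?X N)}"
      "x \<in> PiE (finite_index_normal G) V" "PiE (finite_index_normal G) V \<subseteq> T"
    by (elim exE conjE) (rule that)
  obtain N where N: "N \<in> finite_index_normal G"
      "\<forall>M\<in>{N \<in> finite_index_normal G. V N \<noteq> topspace (?X N)}. N \<subseteq> M"
    using finite_index_normal_Inter[OF V(1) Collect_subset] by (elim bexE) (rule that)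
  have "y \<in> U" if y: "y \<in> profinite_carrier G" "y N = x N" for y
  proof -
    have x: "x \<in> profinite_carrier G" using T assms(2) by auto
    have "y M \<in> V M" if M: "M \<in> finite_index_normal G" for M
    proof (cases "V M = topspace (?X M)")
      case True
      then show ?thesis using profinite_carrierD(2)[OF y(1) M] by simp
    next
      case False
      then have "N \<subseteq> M" using N(2) M by blast
      moreover obtain g where "x N = N #> g" "g \<in> carrier G"
        using profinite_carrierE[OF x N(1)] .
      ultimately have "y M = x M"
        using profinite_carrier_compat[OF x N(1) M] profinite_carrier_compat[OF y(1) N(1) M] y(2)
        by simp
      then show ?thesis using V(2) M by auto
    qed
    then have "y \<in> PiE (finite_index_normal G) V"
      using profinite_carrierD(3)[OF y(1)] by (intro PiE_I)
    then show ?thesis using V(3) T(2) y(1) by auto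
  qed
  then show ?thesis using N(1) by blast
qed

text \<open>The proposition \<open>appr N g d\<close> says that \<open>d\<close> represents the image of \<open>g\<close> in \<open>H/N\<close> under the map that an
isomorphism of completions induces. Working with representatives \<open>d\<close> instead of cosets allows one to
compute in \<open>H\<close> itself and to pass between different \<open>N\<close>. The last axiom says that the kernels of the
maps \<open>G \<rightarrow> H/N\<close> form a neighbourhood basis of the identity in the profinite topology of \<open>G\<close>.\<close>

locale quotient_matching = G: group G + H: group H
  for G :: "('a, 'm) monoid_scheme" and H :: "('b, 'k) monoid_scheme" +
  fixes appr :: "'b set \<Rightarrow> 'a \<Rightarrow> 'b \<Rightarrow> bool"
  assumes appr_closed: "appr N g d \<Longrightarrow> g \<in> carrier G \<and> d \<in> carrier H"
    and appr_total: "\<lbrakk>N \<in> finite_index_normal H; g \<in> carrier G\<rbrakk> \<Longrightarrow> \<exists>d. appr N g d"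
    and appr_surj: "\<lbrakk>N \<in> finite_index_normal H; d \<in> carrier H\<rbrakk> \<Longrightarrow> \<exists>g. appr N g d"
    and appr_mult: "\<lbrakk>N \<in> finite_index_normal H; appr N g d; appr N g' d'\<rbrakk>
        \<Longrightarrow> appr N (g \<otimes>\<^bsub>G\<^esub> g') (d \<otimes>\<^bsub>H\<^esub> d')"
    and appr_coset: "\<lbrakk>N \<in> finite_index_normal H; appr N g d; d' \<in> carrier H\<rbrakk>
        \<Longrightarrow> appr N g d' \<longleftrightarrow> d' \<otimes>\<^bsub>H\<^esub> inv\<^bsub>H\<^esub> d \<in> N"
    and appr_mono: "\<lbrakk>N \<in> finite_index_normal H; N' \<in> finite_index_normal H; N \<subseteq> N'; appr N g d\<rbrakk>
        \<Longrightarrow> appr N' g d"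
    and appr_separates: "M \<in> finite_index_normal G
        \<Longrightarrow> \<exists>N\<in>finite_index_normal H. \<forall>g. appr N g \<one>\<^bsub>H\<^esub> \<longrightarrow> g \<in> M"

text \<open>Both surjectivity and the last axiom come from the fact that one coordinate cuts out a basic
neighbourhood. The preimage in the completion of \<open>G\<close> of the open set \<open>{z. z N = N #> d}\<close> contains an element
of the dense image of \<open>G\<close>; and the image of the neighbourhood \<open>{x. x M = M}\<close> of the identity contains a
neighbourhood of the form \<open>{z. z N = N}\<close>.\<close>

lemma profinitely_isomorphic_matching:
  assumes "group G" "group H" "profinitely_isomorphic G H"
  shows "\<exists>appr. quotient_matching G H appr"
proof -
  interpret G: group G by fact
  interpret H: group H by fact
  obtain h where iso: "h \<in> iso (profinite_completion G) (profinite_completion H)"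
    and homeo: "homeomorphic_map (profinite_topology G) (profinite_topology H) h"
    using assms(3) by (auto simp: profinitely_isomorphic_def)
  let ?FG = "finite_index_normal G" and ?FH = "finite_index_normal H"
  have carr [simp]: "carrier (profinite_completion G) = profinite_carrier G"
      "carrier (profinite_completion H) = profinite_carrier H"
    by (simp_all add: profinite_completion_def)
  have bij: "bij_betw h (profinite_carrier G) (profinite_carrier H)"
    using iso by (simp add: iso_def)
  have hc: "h x \<in> profinite_carrier H" if "x \<in> profinite_carrier G" for x
    using bij that by (auto simp: bij_betw_def)
  define \<phi> where "\<phi> = (\<lambda>N g. h (coset_family G g) N)"
  have multG: "coset_family G (g \<otimes>\<^bsub>G\<^esub> g')
      = coset_family G g \<otimes>\<^bsub>profinite_completion G\<^esub> coset_family G g'"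
    if "g \<in> carrier G" "g' \<in> carrier G" for g g'
    using that by (auto simp: coset_family_def profinite_completion_def fun_eq_iff
        normal.rcos_sum finite_index_normalD(1))
  have \<phi>_closed: "\<phi> N g \<in> carrier (H Mod N)" if "N \<in> ?FH" "g \<in> carrier G" for N g
    using profinite_carrierD(2)[OF hc[OF G.coset_family_closed[OF that(2)]] that(1)]
    by (simp add: \<phi>_def)
  have \<phi>_mult: "\<phi> N (g \<otimes>\<^bsub>G\<^esub> g') = \<phi> N g <#>\<^bsub>H\<^esub> \<phi> N g'"
    if "N \<in> ?FH" "g \<in> carrier G" "g' \<in> carrier G" for N g g'
  proof -
    have "h (coset_family G (g \<otimes>\<^bsub>G\<^esub> g'))
        = h (coset_family G g) \<otimes>\<^bsub>profinite_completion H\<^esub> h (coset_family G g')"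
      using iso that G.coset_family_closed unfolding multG[OF that(2,3)]
      by (auto simp: iso_def hom_def)
    then show ?thesis using that(1) by (simp add: \<phi>_def profinite_completion_def)
  qed
  have \<phi>_hom: "group_hom G (H Mod N) (\<phi> N)" if "N \<in> ?FH" for N
    using that \<phi>_closed \<phi>_mult
    by (intro group_hom.intro group_hom_axioms.intro)
      (auto simp: hom_def normal.factorgroup_is_group finite_index_normalD(1) assms(1))
  define appr where "appr = (\<lambda>N g d. g \<in> carrier G \<and> d \<in> carrier H \<and> \<phi> N g = N #>\<^bsub>H\<^esub> d)"
  have "quotient_matching G H appr"
  proof
    show "g \<in> carrier G \<and> d \<in> carrier H" if "appr N g d" for N g d
      using that by (simp add: appr_def)
    show "\<exists>d. appr N g d" if "N \<in> ?FH" "g \<in> carrier G" for N g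
      using \<phi>_closed[OF that] that by (auto simp: appr_def carrier_FactGroup)
    show "appr N (g \<otimes>\<^bsub>G\<^esub> g') (d \<otimes>\<^bsub>H\<^esub> d')"
      if "N \<in> ?FH" "appr N g d" "appr N g' d'" for N g d g' d'
      using that \<phi>_mult by (auto simp: appr_def normal.rcos_sum finite_index_normalD(1))
    show "appr N g d' \<longleftrightarrow> d' \<otimes>\<^bsub>H\<^esub> inv\<^bsub>H\<^esub> d \<in> N"
      if "N \<in> ?FH" "appr N g d" "d' \<in> carrier H" for N g d d'
      using that H.coset_eq_iff[OF finite_index_normalD(2)[OF that(1)] that(3), of d]
      by (auto simp: appr_def)
    show "appr N' g d" if "N \<in> ?FH" "N' \<in> ?FH" "N \<subseteq> N'" "appr N g d" for N N' g d
      using that(4) profinite_carrier_compat[OF hc[OF G.coset_family_closed] that(1-3)]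
      unfolding appr_def \<phi>_def by blast
    show "\<exists>g. appr N g d" if N: "N \<in> ?FH" "d \<in> carrier H" for N d
    proof -
      let ?V = "{z \<in> profinite_carrier H. z N = N #>\<^bsub>H\<^esub> d}"
      let ?W = "{x \<in> topspace (profinite_topology G). h x \<in> ?V}"
      have "openin (profinite_topology G) ?W"
        by (rule openin_continuous_map_preimage[OF homeomorphic_imp_continuous_map[OF homeo]
              openin_profinite_fibre[OF N(1)]])
      obtain x where x: "x \<in> profinite_carrier G" "h x = coset_family H d"
        using bij H.coset_family_closed[OF N(2)] by (metis bij_betw_iff_bijections)
      have "x \<in> ?W"
        using N x H.coset_family_closed[OF N(2)]
        by (simp add: topspace_profinite_topology coset_family_def)
      from G.profinite_nbhd[OF \<open>openin (profinite_topology G) ?W\<close> this]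
      obtain M where M: "M \<in> ?FG" "\<forall>y\<in>profinite_carrier G. y M = x M \<longrightarrow> y \<in> ?W"
        by blast
      obtain g where g: "g \<in> carrier G" "x M = M #>\<^bsub>G\<^esub> g"
        using profinite_carrierE[OF x(1) M(1)] .
      then have "coset_family G g \<in> ?W"
        using M G.coset_family_closed[OF g(1)] by (simp add: coset_family_def)
      then show ?thesis using g N(2) by (auto simp: appr_def \<phi>_def)
    qed
    show "\<exists>N\<in>?FH. \<forall>g. appr N g \<one>\<^bsub>H\<^esub> \<longrightarrow> g \<in> M" if M: "M \<in> ?FG" for M
    proof -
      let ?U = "{x \<in> profinite_carrier G. x M = M}"
      have sM: "subgroup M G" using M finite_index_normalD(2) by blast
      have "openin (profinite_topology H) (h ` ?U)"
        using homeo openin_profinite_fibre[OF M] homeomorphic_imp_open_map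
        unfolding open_map_def by blast
      moreover have "coset_family G \<one>\<^bsub>G\<^esub> \<in> ?U"
        using M sM G.coset_family_closed subgroup.subset by (fastforce simp: coset_family_def)
      then have "h (coset_family G \<one>\<^bsub>G\<^esub>) \<in> h ` ?U" by (rule imageI)
      ultimately obtain N where N: "N \<in> ?FH"
        "\<forall>y\<in>profinite_carrier H. y N = h (coset_family G \<one>\<^bsub>G\<^esub>) N \<longrightarrow> y \<in> h ` ?U"
        using H.profinite_nbhd by blast
      have one: "h (coset_family G \<one>\<^bsub>G\<^esub>) N = N"
        using group_hom.hom_one[OF \<phi>_hom[OF N(1)]] by (simp add: \<phi>_def)
      have "g \<in> M" if "appr N g \<one>\<^bsub>H\<^esub>" for g
      proof -
        have g: "g \<in> carrier G" "h (coset_family G g) N = N"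
          using that N(1) finite_index_normalD(2)[OF N(1)] subgroup.subset
          by (fastforce simp: appr_def \<phi>_def)+
        then have "h (coset_family G g) \<in> h ` ?U"
          using N(2) one hc G.coset_family_closed by simp
        then obtain x where "x \<in> ?U" "h (coset_family G g) = h x" by blast
        then have "coset_family G g \<in> ?U"
          using bij G.coset_family_closed[OF g(1)] by (auto simp: bij_betw_def inj_on_def)
        then have "M #>\<^bsub>G\<^esub> g = M" using M by (simp add: coset_family_def)
        then show ?thesis using G.coset_join1 g(1) sM by (metis G.rcos_self)
      qed
      then show ?thesis using N(1) by blast
    qed
  qed
  then show ?thesis by blast
qed

section \<open>Isomorphic groups have isomorphic profinite completions\<close>

text \<open>The map induced on completions by an isomorphism \<open>f\<close>: the coordinate at \<open>N\<close> is the image of the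
coordinate at the preimage of \<open>N\<close>.\<close>

definition transport ::
  "('a, 'm) monoid_scheme \<Rightarrow> ('b, 'k) monoid_scheme \<Rightarrow> ('a \<Rightarrow> 'b)
    \<Rightarrow> ('a set \<Rightarrow> 'a set) \<Rightarrow> 'b set \<Rightarrow> 'b set" where
  "transport G H f x = (\<lambda>N\<in>finite_index_normal H. f ` x (carrier G \<inter> f -` N))"

lemma iso_vimage_finite_index:
  assumes "group G" "group H" "f \<in> iso G H" "N \<in> finite_index_normal H"
  shows "carrier G \<inter> f -` N \<in> finite_index_normal G"
proof -
  interpret G: group G by fact
  interpret H: group H by fact
  interpret N: normal N H using assms(4) finite_index_normalD by blast
  have "(\<lambda>g. N #>\<^bsub>H\<^esub> f g) \<in> hom G (H Mod N)"
    using assms(3) N.rcos_sum by (auto simp: hom_def iso_def carrier_FactGroup Pi_iff)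
  then interpret q: group_hom G "H Mod N" "\<lambda>g. N #>\<^bsub>H\<^esub> f g"
    by (intro group_hom.intro group_hom_axioms.intro) (auto simp: N.factorgroup_is_group assms)
  have fc: "f g \<in> carrier H" if "g \<in> carrier G" for g
    using assms(3) that by (auto simp: iso_def hom_def)
  have "kernel G (H Mod N) (\<lambda>g. N #>\<^bsub>H\<^esub> f g) \<in> finite_index_normal G"
    using finite_index_normalD(3)[OF assms(4)] q.hom_closed
    by (intro q.kernel_finite_index) (meson finite_subset image_subsetI)
  also have "kernel G (H Mod N) (\<lambda>g. N #>\<^bsub>H\<^esub> f g) = carrier G \<inter> f -` N"
  proof -
    have "N #>\<^bsub>H\<^esub> d = N \<longleftrightarrow> d \<in> N" if "d \<in> carrier H" for d
      using H.coset_join1[OF _ that N.subgroup_axioms] H.coset_join2[OF that N.subgroup_axioms]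
      by blast
    then show ?thesis unfolding kernel_def one_FactGroup using fc by blast
  qed
  finally show ?thesis .
qed

lemma iso_image_coset:
  assumes "f \<in> iso G H" "N \<subseteq> carrier H" "g \<in> carrier G"
  shows "f ` ((carrier G \<inter> f -` N) #>\<^bsub>G\<^esub> g) = N #>\<^bsub>H\<^esub> f g"
proof -
  have f: "\<And>x y. x \<in> carrier G \<Longrightarrow> y \<in> carrier G \<Longrightarrow> f (x \<otimes>\<^bsub>G\<^esub> y) = f x \<otimes>\<^bsub>H\<^esub> f y"
      "f ` carrier G = carrier H"
    using assms(1) by (auto simp: iso_def hom_def bij_betw_def)
  show ?thesis
  proof
    show "f ` ((carrier G \<inter> f -` N) #>\<^bsub>G\<^esub> g) \<subseteq> N #>\<^bsub>H\<^esub> f g"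
      using f(1) assms(3) by (auto simp: r_coset_def)
    show "N #>\<^bsub>H\<^esub> f g \<subseteq> f ` ((carrier G \<inter> f -` N) #>\<^bsub>G\<^esub> g)"
    proof
      fix y assume "y \<in> N #>\<^bsub>H\<^esub> f g"
      then obtain d where d: "d \<in> N" "y = d \<otimes>\<^bsub>H\<^esub> f g" by (auto simp: r_coset_def)
      moreover obtain x where "x \<in> carrier G" "f x = d"
        using d(1) assms(2) f(2) by (metis imageE subsetD)
      ultimately show "y \<in> f ` ((carrier G \<inter> f -` N) #>\<^bsub>G\<^esub> g)"
        using f(1) assms(3) by (auto simp: r_coset_def intro!: image_eqI[of _ _ "x \<otimes>\<^bsub>G\<^esub> g"])
    qed
  qed
qed

lemma transport_coset:
  assumes "group G" "group H" "f \<in> iso G H" "N \<in> finite_index_normal H"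
    and "x \<in> profinite_carrier G"
  shows "\<exists>g\<in>carrier G. x (carrier G \<inter> f -` N) = (carrier G \<inter> f -` N) #>\<^bsub>G\<^esub> g \<and>
    (\<forall>M\<in>finite_index_normal H. N \<subseteq> M \<longrightarrow> transport G H f x M = M #>\<^bsub>H\<^esub> f g)"
proof -
  have sub: "M \<subseteq> carrier H" if "M \<in> finite_index_normal H" for M
    using that by (meson finite_index_normalD(2) subgroup.subset)
  note pre = iso_vimage_finite_index[OF assms(1,2,3)]
  obtain g where g: "g \<in> carrier G" "x (carrier G \<inter> f -` N) = (carrier G \<inter> f -` N) #>\<^bsub>G\<^esub> g"
    "\<And>M. M \<in> finite_index_normal G \<Longrightarrow> (carrier G \<inter> f -` N) \<subseteq> M \<Longrightarrow> x M = M #>\<^bsub>G\<^esub> g"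
    using profinite_carrierE[OF assms(5) pre[OF assms(4)]] by metis
  have "transport G H f x M = M #>\<^bsub>H\<^esub> f g" if M: "M \<in> finite_index_normal H" "N \<subseteq> M" for M
  proof -
    have "x (carrier G \<inter> f -` M) = (carrier G \<inter> f -` M) #>\<^bsub>G\<^esub> g"
      using g(3)[OF pre[OF M(1)]] M(2) by blast
    then show ?thesis
      using M(1) g(1) sub by (simp add: transport_def iso_image_coset[OF assms(3)])
  qed
  then show ?thesis using g(1,2) by blast
qed

lemma transport_closed:
  assumes "group G" "group H" "f \<in> iso G H" "x \<in> profinite_carrier G"
  shows "transport G H f x \<in> profinite_carrier H"
proof -
  interpret H: group H by fact
  have fc: "f g \<in> carrier H" if "g \<in> carrier G" for g
    using assms(3) that by (auto simp: iso_def hom_def)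
  have "transport G H f x N \<in> carrier (H Mod N)" if "N \<in> finite_index_normal H" for N
    using transport_coset[OF assms(1-3) that assms(4)] that fc
    unfolding carrier_FactGroup by blast
  moreover have "transport G H f x M = M #>\<^bsub>H\<^esub> d"
    if NM: "N \<in> finite_index_normal H" "M \<in> finite_index_normal H" "N \<subseteq> M" "d \<in> carrier H"
      "transport G H f x N = N #>\<^bsub>H\<^esub> d" for N M d
  proof -
    obtain g where g: "g \<in> carrier G"
      "\<forall>M\<in>finite_index_normal H. N \<subseteq> M \<longrightarrow> transport G H f x M = M #>\<^bsub>H\<^esub> f g"
      using transport_coset[OF assms(1-3) NM(1) assms(4)] by blast
    have "N #>\<^bsub>H\<^esub> f g = N #>\<^bsub>H\<^esub> d" using g(2) NM(1,5) by simp
    then have "M #>\<^bsub>H\<^esub> f g = M #>\<^bsub>H\<^esub> d"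
      using H.coset_mono_eq[OF _ _ NM(3) fc[OF g(1)] NM(4)] finite_index_normalD(2) NM(1,2) by blast
    then show ?thesis using g(2) NM(2,3) by simp
  qed
  moreover have "transport G H f x \<in> extensional (finite_index_normal H)"
    by (simp add: transport_def)
  ultimately show ?thesis
    unfolding profinite_carrier_def mem_Collect_eq PiE_iff by blast
qed

lemma transport_mult:
  assumes "group G" "group H" "f \<in> iso G H" "x \<in> profinite_carrier G" "y \<in> profinite_carrier G"
  shows "transport G H f (x \<otimes>\<^bsub>profinite_completion G\<^esub> y)
    = transport G H f x \<otimes>\<^bsub>profinite_completion H\<^esub> transport G H f y"
proof
  fix N
  interpret H: group H by fact
  interpret G: group G by fact
  show "transport G H f (x \<otimes>\<^bsub>profinite_completion G\<^esub> y) N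
    = (transport G H f x \<otimes>\<^bsub>profinite_completion H\<^esub> transport G H f y) N"
  proof (cases "N \<in> finite_index_normal H")
    case True
    let ?M = "carrier G \<inter> f -` N"
    have M: "?M \<in> finite_index_normal G" using iso_vimage_finite_index[OF assms(1-3) True] .
    obtain g where g: "g \<in> carrier G" "x ?M = ?M #>\<^bsub>G\<^esub> g" "transport G H f x N = N #>\<^bsub>H\<^esub> f g"
      using transport_coset[OF assms(1-3) True assms(4)] True by blast
    obtain g' where g': "g' \<in> carrier G" "y ?M = ?M #>\<^bsub>G\<^esub> g'" "transport G H f y N = N #>\<^bsub>H\<^esub> f g'"
      using transport_coset[OF assms(1-3) True assms(5)] True by blast
    have f: "f (g \<otimes>\<^bsub>G\<^esub> g') = f g \<otimes>\<^bsub>H\<^esub> f g'" "f g \<in> carrier H" "f g' \<in> carrier H"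
      using assms(3) g g' by (auto simp: iso_def hom_def)
    have "N \<subseteq> carrier H" using True by (meson finite_index_normalD(2) subgroup.subset)
    then have "transport G H f (x \<otimes>\<^bsub>profinite_completion G\<^esub> y) N = N #>\<^bsub>H\<^esub> f (g \<otimes>\<^bsub>G\<^esub> g')"
      using True M g g' iso_image_coset[OF assms(3)]
      by (simp add: transport_def profinite_completion_def normal.rcos_sum finite_index_normalD(1))
    also have "\<dots> = (N #>\<^bsub>H\<^esub> f g) <#>\<^bsub>H\<^esub> (N #>\<^bsub>H\<^esub> f g')"
      using True f by (simp add: normal.rcos_sum finite_index_normalD(1))
    finally show ?thesis using True g g' by (simp add: profinite_completion_def)
  next
    case False
    then show ?thesis by (simp add: transport_def profinite_completion_def)
  qed
qed

lemma transport_continuous: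
  assumes "group G" "group H" "f \<in> iso G H"
  shows "continuous_map (profinite_topology G) (profinite_topology H) (transport G H f)"
proof -
  have "continuous_map (profinite_topology G) (discrete_topology (carrier (H Mod N)))
      (\<lambda>x. transport G H f x N)" if N: "N \<in> finite_index_normal H" for N
  proof -
    let ?M = "carrier G \<inter> f -` N"
    have M: "?M \<in> finite_index_normal G" using iso_vimage_finite_index[OF assms N] .
    have "f ` C \<in> carrier (H Mod N)" if C: "C \<in> carrier (G Mod ?M)" for C
    proof -
      obtain g where "g \<in> carrier G" "C = ?M #>\<^bsub>G\<^esub> g" using C by (auto simp: carrier_FactGroup)
      moreover from this have "f g \<in> carrier H" using assms(3) by (auto simp: iso_def hom_def)
      moreover have "N \<subseteq> carrier H" using N by (meson finite_index_normalD(2) subgroup.subset)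
      ultimately show ?thesis by (auto simp: iso_image_coset[OF assms(3)] carrier_FactGroup)
    qed
    then have "continuous_map (discrete_topology (carrier (G Mod ?M)))
        (discrete_topology (carrier (H Mod N))) (image f)"
      by auto
    from continuous_map_compose[OF profinite_projection_continuous[OF M] this]
    show ?thesis using N by (simp add: transport_def o_def)
  qed
  then show ?thesis
    unfolding profinite_topology_def[of H]
    using transport_closed[OF assms]
    by (auto simp: continuous_map_in_subtopology continuous_map_componentwise
        topspace_profinite_topology transport_def)
qed

lemma transport_inverse:
  assumes "group G" "group H" "f \<in> iso G H" "f' \<in> iso H G"
    and inv: "\<And>g. g \<in> carrier G \<Longrightarrow> f' (f g) = g" and x: "x \<in> profinite_carrier G"
  shows "transport H G f' (transport G H f x) = x"
proof
  fix M
  show "transport H G f' (transport G H f x) M = x M"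
  proof (cases "M \<in> finite_index_normal G")
    case True
    let ?N = "carrier H \<inter> f' -` M"
    have N: "?N \<in> finite_index_normal H" using iso_vimage_finite_index[OF assms(2,1,4) True] .
    have "M \<subseteq> carrier G" using True by (meson finite_index_normalD(2) subgroup.subset)
    then have M: "carrier G \<inter> f -` ?N = M"
      using inv assms(3) by (auto simp: iso_def hom_def)
    obtain g where g: "g \<in> carrier G" "x M = M #>\<^bsub>G\<^esub> g"
      using profinite_carrierE[OF x True] by metis
    have "x M \<subseteq> carrier G"
      using g assms(1) \<open>M \<subseteq> carrier G\<close> by (simp add: group.is_monoid monoid.r_coset_subset_G)
    then have "f' ` f ` x M = x M" using inv by force
    then show ?thesis using True N M by (simp add: transport_def)
  next
    case False
    then show ?thesis using profinite_carrierD(3)[OF x] by (simp add: transport_def)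
  qed
qed

lemma iso_imp_profinitely_isomorphic:
  assumes "group G" "group H" "G \<cong> H"
  shows "profinitely_isomorphic G H"
proof -
  obtain f where f: "f \<in> iso G H" using assms(3) by (auto simp: is_iso_def)
  define f' where "f' = inv_into (carrier G) f"
  have f': "f' \<in> iso H G" unfolding f'_def using group.iso_set_sym[OF assms(1) f] .
  have bij: "bij_betw f (carrier G) (carrier H)" using f by (simp add: iso_def)
  have l: "f' (f g) = g" if "g \<in> carrier G" for g
    using bij that by (simp add: f'_def bij_betw_inv_into_left)
  have r: "f (f' d) = d" if "d \<in> carrier H" for d
    using bij that by (simp add: f'_def bij_betw_inv_into_right)
  let ?T = "transport G H f" and ?T' = "transport H G f'"
  have TT: "?T' (?T x) = x" if "x \<in> profinite_carrier G" for x
    by (rule transport_inverse[OF assms(1,2) f f' l that])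
  have TT': "?T (?T' y) = y" if "y \<in> profinite_carrier H" for y
    by (rule transport_inverse[OF assms(2,1) f' f r that])
  have "bij_betw ?T (profinite_carrier G) (profinite_carrier H)"
    using TT TT' transport_closed[OF assms(1,2) f] transport_closed[OF assms(2,1) f']
    by (intro bij_betw_byWitness[where f' = ?T']) auto
  then have "?T \<in> iso (profinite_completion G) (profinite_completion H)"
    using transport_mult[OF assms(1,2) f] transport_closed[OF assms(1,2) f]
    by (auto simp: iso_def hom_def profinite_completion_def)
  moreover have "homeomorphic_maps (profinite_topology G) (profinite_topology H) ?T ?T'"
    using transport_continuous[OF assms(1,2) f] transport_continuous[OF assms(2,1) f'] TT TT'
    by (auto simp: homeomorphic_maps_def topspace_profinite_topology)
  ultimately show ?thesis
    unfolding profinitely_isomorphic_def using homeomorphic_maps_imp_map by blast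
qed

section \<open>Homomorphisms out of a presented group\<close>

definition letter_value :: "('h, 'k) monoid_scheme \<Rightarrow> ('g \<Rightarrow> 'h) \<Rightarrow> 'g \<times> bool \<Rightarrow> 'h" where
  "letter_value H f l = (if snd l then f (fst l) else inv\<^bsub>H\<^esub> f (fst l))"

definition word_value :: "('h, 'k) monoid_scheme \<Rightarrow> ('g \<Rightarrow> 'h) \<Rightarrow> 'g word \<Rightarrow> 'h" where
  "word_value H f u = foldr (\<lambda>l y. letter_value H f l \<otimes>\<^bsub>H\<^esub> y) u \<one>\<^bsub>H\<^esub>"

context group
begin

lemma letter_value_closed [simp]: "range f \<subseteq> carrier G \<Longrightarrow> letter_value G f l \<in> carrier G"
  by (auto simp: letter_value_def)

lemma word_value_simps [simp]:
  "word_value G f [] = \<one>" "word_value G f (l # u) = letter_value G f l \<otimes> word_value G f u"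
  by (simp_all add: word_value_def)

lemma word_value_closed [simp]: "range f \<subseteq> carrier G \<Longrightarrow> word_value G f u \<in> carrier G"
  by (induction u) simp_all

lemma word_value_append:
  "range f \<subseteq> carrier G \<Longrightarrow> word_value G f (u @ v) = word_value G f u \<otimes> word_value G f v"
  by (induction u) (simp_all add: m_assoc)

lemma word_value_replicate:
  "range f \<subseteq> carrier G \<Longrightarrow> word_value G f (replicate k l) = letter_value G f l [^] k"
proof (induction k)
  case (Suc k)
  then show ?case using nat_pow_Suc2[of "letter_value G f l" k] by simp
qed simp

lemma word_value_gen_power:
  assumes "range f \<subseteq> carrier G" shows "word_value G f (gen_power x k) = f x [^] (k::int)"
proof -
  have x: "f x \<in> carrier G" using assms by blast
  show ?thesis
  proof (cases "k \<ge> 0")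
    case True
    then show ?thesis
      using int_pow_int[of G "f x" "nat k"] by (simp add: word_value_replicate[OF assms] letter_value_def)
  next
    case False
    then obtain m where "k = - int m" using that[of "nat (- k)"] by simp
    then show ?thesis
      using False x int_pow_neg_int[OF x, of m]
      by (simp add: word_value_replicate[OF assms] letter_value_def nat_pow_inv)
  qed
qed

lemma word_value_cong:
  assumes "word_cong R u v" "range f \<subseteq> carrier G"
    and rel: "\<And>u v. (u, v) \<in> R \<Longrightarrow> word_value G f u = word_value G f v"
  shows "word_value G f u = word_value G f v"
  using assms(1)
proof induction
  case (rel u v) then show ?case using assms(3) by blast
next
  case (cancel x b)
  have "f x \<in> carrier G" using assms(2) by blast
  then show ?case by (cases b) (simp_all add: letter_value_def)
next
  case (append u u' v v') then show ?case using assms(2) by (simp add: word_value_append)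
qed simp_all

text \<open>The universal property of a presentation. The value at a class is computed on an arbitrary
representative.\<close>

lemma presented_group_hom:
  assumes f: "range f \<subseteq> carrier G"
    and rel: "\<And>u v. (u, v) \<in> R \<Longrightarrow> word_value G f u = word_value G f v"
  shows "\<exists>h\<in>hom (presented_group R) G. \<forall>u. h (word_class R u) = word_value G f u"
proof -
  define h where "h = (\<lambda>C. word_value G f (SOME u. u \<in> C))"
  have h: "h (word_class R u) = word_value G f u" for u
  proof -
    have "u \<in> word_class R u" by (simp add: word_class_def word_cong.refl)
    then have "(SOME v. v \<in> word_class R u) \<in> word_class R u" by (rule someI)
    then have "word_cong R u (SOME v. v \<in> word_class R u)" by (simp add: word_class_def)
    from word_value_cong[OF this f rel] show ?thesis by (simp add: h_def)
  qed
  have carr: "carrier (presented_group R) = range (word_class R)" by (simp add: presented_group_def)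
  have "h \<in> hom (presented_group R) G"
  proof (rule homI)
    show "h C \<in> carrier G" if "C \<in> carrier (presented_group R)" for C
      using that f h by (auto simp: carr)
    show "h (C \<otimes>\<^bsub>presented_group R\<^esub> D) = h C \<otimes> h D"
      if CD: "C \<in> carrier (presented_group R)" "D \<in> carrier (presented_group R)" for C D
    proof -
      obtain u v where "C = word_class R u" "D = word_class R v" using CD by (auto simp: carr)
      then show ?thesis using f by (simp add: presented_group_mult h word_value_append)
    qed
  qed
  then show ?thesis using h by blast
qed

section \<open>The relation of the solvable Baumslag--Solitar groups\<close>

lemma conj_int_pow:
  assumes "x \<in> carrier G" "y \<in> carrier G"
  shows "inv y \<otimes> x [^] (c::int) \<otimes> y = (inv y \<otimes> x \<otimes> y) [^] c"
proof -
  have "y \<otimes> (inv y \<otimes> z) = z" if "z \<in> carrier G" for z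
    using assms(2) that by (simp add: m_assoc[symmetric])
  then have "(\<lambda>x. inv y \<otimes> x \<otimes> y) \<in> hom G G"
    using assms(2) by (intro homI) (simp_all add: m_assoc)
  then have "group_hom G G (\<lambda>x. inv y \<otimes> x \<otimes> y)"
    by (intro group_hom.intro group_hom_axioms.intro is_group)
  from group_hom.hom_int_pow[OF this assms(1)] show ?thesis by simp
qed

text \<open>Moving a power of \<open>y\<close> to the left multiplies the exponent of \<open>x\<close> by a power of \<open>n\<close>.\<close>

lemma bs_relation_pow:
  assumes x: "x \<in> carrier G" and y: "y \<in> carrier G" and rel: "inv y \<otimes> x \<otimes> y = x [^] (n::int)"
  shows "x [^] (c::int) \<otimes> y [^] (i::nat) = y [^] i \<otimes> x [^] (c * n ^ i)"
proof (induction i)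
  case 0 then show ?case using x by simp
next
  case (Suc i)
  have step: "x [^] d \<otimes> y = y \<otimes> x [^] (d * n)" for d :: int
  proof -
    have "y \<otimes> (inv y \<otimes> x [^] d \<otimes> y) = y \<otimes> x [^] (d * n)"
      using x by (simp add: conj_int_pow[OF x y] rel int_pow_pow mult.commute)
    then show ?thesis using x y by (simp add: m_assoc[symmetric])
  qed
  have "x [^] c \<otimes> y [^] Suc i = (x [^] c \<otimes> y [^] i) \<otimes> y"
    using x y by (simp add: m_assoc)
  also have "\<dots> = y [^] i \<otimes> (x [^] (c * n ^ i) \<otimes> y)"
    using x y by (simp add: Suc m_assoc)
  also have "\<dots> = y [^] Suc i \<otimes> x [^] (c * n ^ Suc i)"
    using x y by (simp add: step m_assoc mult.assoc mult.commute[of n])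
  finally show ?case .
qed

end

locale baumslag_solitar =
  fixes n :: int
begin

abbreviation "\<Gamma> \<equiv> BS1 n"

definition bs_relators :: "(bs_gen word \<times> bs_gen word) set" where
  "bs_relators = {([(gen_t, False), (gen_a, True), (gen_t, True)], gen_power gen_a n)}"

lemma \<Gamma>_presentation: "\<Gamma> = presented_group bs_relators"
  by (simp add: BS1_def bs_relators_def)

sublocale \<Gamma>: group \<Gamma>
  unfolding \<Gamma>_presentation by (rule group_presented_group)

lemma \<Gamma>_mult: "word_class bs_relators u \<otimes>\<^bsub>\<Gamma>\<^esub> word_class bs_relators v = word_class bs_relators (u @ v)"
  unfolding \<Gamma>_presentation by (rule presented_group_mult)

lemma \<Gamma>_one: "\<one>\<^bsub>\<Gamma>\<^esub> = word_class bs_relators []"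
  by (simp add: \<Gamma>_presentation presented_group_def)

definition A where "A = word_class bs_relators [(gen_a, True)]"
definition T where "T = word_class bs_relators [(gen_t, True)]"

lemma carrier_\<Gamma>: "carrier \<Gamma> = range (word_class bs_relators)"
  by (simp add: \<Gamma>_presentation presented_group_def)

lemma A_closed [simp]: "A \<in> carrier \<Gamma>" and T_closed [simp]: "T \<in> carrier \<Gamma>"
  by (simp_all add: carrier_\<Gamma> A_def T_def)

abbreviation gen_value :: "bs_gen \<Rightarrow> bs_gen word set" where
  "gen_value \<equiv> case_bs_gen A T"

lemma word_class_eq_value: "word_class bs_relators u = word_value \<Gamma> gen_value u"
proof (induction u)
  case Nil then show ?case by (simp add: \<Gamma>_one)
next
  case (Cons l u)
  obtain g b where l: "l = (g, b)" by force
  have pos: "word_class bs_relators [(g, True)] = gen_value g" by (cases g) (simp_all add: A_def T_def)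
  have neg: "word_class bs_relators [(g, False)] = inv\<^bsub>\<Gamma>\<^esub> gen_value g"
  proof (rule \<Gamma>.inv_equality[symmetric])
    have "word_class bs_relators [(g, False), (g, True)] = word_class bs_relators []"
      unfolding word_class_eq_iff using word_cong.cancel[of bs_relators g False] by simp
    then show "word_class bs_relators [(g, False)] \<otimes>\<^bsub>\<Gamma>\<^esub> gen_value g = \<one>\<^bsub>\<Gamma>\<^esub>"
      unfolding pos[symmetric] by (simp add: \<Gamma>_mult \<Gamma>_one)
    show "word_class bs_relators [(g, False)] \<in> carrier \<Gamma>"
      unfolding carrier_\<Gamma> by (rule rangeI)
    show "gen_value g \<in> carrier \<Gamma>" by (cases g) simp_all
  qed
  have "word_class bs_relators (l # u) = word_class bs_relators [l] \<otimes>\<^bsub>\<Gamma>\<^esub> word_class bs_relators u"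
    by (simp add: \<Gamma>_mult)
  also have "word_class bs_relators [l] = letter_value \<Gamma> gen_value l"
    using pos neg by (cases b) (simp_all add: l letter_value_def)
  finally show ?case using Cons by simp
qed

lemma gen_value_range: "range gen_value \<subseteq> carrier \<Gamma>"
  by (auto split: bs_gen.split)

lemma bs_relation: "inv\<^bsub>\<Gamma>\<^esub> T \<otimes>\<^bsub>\<Gamma>\<^esub> A \<otimes>\<^bsub>\<Gamma>\<^esub> T = A [^]\<^bsub>\<Gamma>\<^esub> n"
proof -
  have "word_class bs_relators [(gen_t, False), (gen_a, True), (gen_t, True)]
      = word_class bs_relators (gen_power gen_a n)"
    unfolding word_class_eq_iff by (rule word_cong.rel) (simp add: bs_relators_def)
  then show ?thesis
    unfolding word_class_eq_value
    using \<Gamma>.word_value_gen_power[OF gen_value_range, of gen_a n]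
    by (simp add: letter_value_def \<Gamma>.m_assoc)
qed

lemma \<Gamma>_induct [consumes 1, case_names one A inv_A T inv_T]:
  assumes "g \<in> carrier \<Gamma>" "P \<one>\<^bsub>\<Gamma>\<^esub>"
    and "\<And>g. g \<in> carrier \<Gamma> \<Longrightarrow> P g \<Longrightarrow> P (A \<otimes>\<^bsub>\<Gamma>\<^esub> g)"
    and "\<And>g. g \<in> carrier \<Gamma> \<Longrightarrow> P g \<Longrightarrow> P (inv\<^bsub>\<Gamma>\<^esub> A \<otimes>\<^bsub>\<Gamma>\<^esub> g)"
    and "\<And>g. g \<in> carrier \<Gamma> \<Longrightarrow> P g \<Longrightarrow> P (T \<otimes>\<^bsub>\<Gamma>\<^esub> g)"
    and "\<And>g. g \<in> carrier \<Gamma> \<Longrightarrow> P g \<Longrightarrow> P (inv\<^bsub>\<Gamma>\<^esub> T \<otimes>\<^bsub>\<Gamma>\<^esub> g)"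
  shows "P g"
proof -
  have "P (word_value \<Gamma> gen_value u)" for u
  proof (induction u)
    case Nil then show ?case using assms(2) by simp
  next
    case (Cons l u)
    have c: "word_value \<Gamma> gen_value u \<in> carrier \<Gamma>" using gen_value_range by simp
    obtain x b where l: "l = (x, b)" by force
    show ?case
      using assms(3-6)[OF c Cons] by (cases x; cases b) (simp_all add: l letter_value_def)
  qed
  moreover obtain u where "g = word_value \<Gamma> gen_value u"
    using assms(1) unfolding carrier_\<Gamma> word_class_eq_value by blast
  ultimately show ?thesis by simp
qed

text \<open>The elements with such a form contain the identity and are closed under left multiplication by the
generators and their inverses. A form \<open>g = T^i A^k T^(-j)\<close> with natural exponents avoids dividing
\<open>k\<close> by \<open>n\<close>.\<close>

lemma normal_form:
  assumes "g \<in> carrier \<Gamma>"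
  shows "\<exists>(i::nat) (j::nat) (k::int). g \<otimes>\<^bsub>\<Gamma>\<^esub> T [^]\<^bsub>\<Gamma>\<^esub> j = T [^]\<^bsub>\<Gamma>\<^esub> i \<otimes>\<^bsub>\<Gamma>\<^esub> A [^]\<^bsub>\<Gamma>\<^esub> k"
proof -
  have powA: "\<exists>(i::nat) (j::nat) (k::int). (A [^]\<^bsub>\<Gamma>\<^esub> c \<otimes>\<^bsub>\<Gamma>\<^esub> g) \<otimes>\<^bsub>\<Gamma>\<^esub> T [^]\<^bsub>\<Gamma>\<^esub> j
      = T [^]\<^bsub>\<Gamma>\<^esub> i \<otimes>\<^bsub>\<Gamma>\<^esub> A [^]\<^bsub>\<Gamma>\<^esub> k"
    if g: "g \<in> carrier \<Gamma>" "\<exists>(i::nat) (j::nat) (k::int). g \<otimes>\<^bsub>\<Gamma>\<^esub> T [^]\<^bsub>\<Gamma>\<^esub> j = T [^]\<^bsub>\<Gamma>\<^esub> i \<otimes>\<^bsub>\<Gamma>\<^esub> A [^]\<^bsub>\<Gamma>\<^esub> k"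
    for g and c :: int
  proof -
    obtain i j :: nat and k :: int
      where eq: "g \<otimes>\<^bsub>\<Gamma>\<^esub> T [^]\<^bsub>\<Gamma>\<^esub> j = T [^]\<^bsub>\<Gamma>\<^esub> i \<otimes>\<^bsub>\<Gamma>\<^esub> A [^]\<^bsub>\<Gamma>\<^esub> k" using g(2) by (elim exE) (rule that)
    have "(A [^]\<^bsub>\<Gamma>\<^esub> c \<otimes>\<^bsub>\<Gamma>\<^esub> g) \<otimes>\<^bsub>\<Gamma>\<^esub> T [^]\<^bsub>\<Gamma>\<^esub> j = A [^]\<^bsub>\<Gamma>\<^esub> c \<otimes>\<^bsub>\<Gamma>\<^esub> T [^]\<^bsub>\<Gamma>\<^esub> i \<otimes>\<^bsub>\<Gamma>\<^esub> A [^]\<^bsub>\<Gamma>\<^esub> k"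
      using g(1) by (simp add: \<Gamma>.m_assoc eq)
    also have "\<dots> = T [^]\<^bsub>\<Gamma>\<^esub> i \<otimes>\<^bsub>\<Gamma>\<^esub> A [^]\<^bsub>\<Gamma>\<^esub> (c * n ^ i + k)"
      by (simp add: \<Gamma>.bs_relation_pow[OF A_closed T_closed bs_relation] \<Gamma>.m_assoc \<Gamma>.int_pow_mult)
    finally show ?thesis by blast
  qed
  show ?thesis
  using assms
proof (induction rule: \<Gamma>_induct)
  case one
  have "\<one>\<^bsub>\<Gamma>\<^esub> \<otimes>\<^bsub>\<Gamma>\<^esub> T [^]\<^bsub>\<Gamma>\<^esub> (0::nat) = T [^]\<^bsub>\<Gamma>\<^esub> (0::nat) \<otimes>\<^bsub>\<Gamma>\<^esub> A [^]\<^bsub>\<Gamma>\<^esub> (0::int)" by simp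
  then show ?case by blast
next
  case (A g)
  then show ?case using powA[of g 1] by simp
next
  case (inv_A g)
  then show ?case using powA[of g "- 1"] by (simp add: \<Gamma>.int_pow_neg)
next
  case (T g)
  then obtain i j :: nat and k :: int
    where eq: "g \<otimes>\<^bsub>\<Gamma>\<^esub> T [^]\<^bsub>\<Gamma>\<^esub> j = T [^]\<^bsub>\<Gamma>\<^esub> i \<otimes>\<^bsub>\<Gamma>\<^esub> A [^]\<^bsub>\<Gamma>\<^esub> k" by (elim exE) (rule that)
  have "(T \<otimes>\<^bsub>\<Gamma>\<^esub> g) \<otimes>\<^bsub>\<Gamma>\<^esub> T [^]\<^bsub>\<Gamma>\<^esub> j = T [^]\<^bsub>\<Gamma>\<^esub> Suc i \<otimes>\<^bsub>\<Gamma>\<^esub> A [^]\<^bsub>\<Gamma>\<^esub> k"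
    using T(1) eq unfolding \<Gamma>.nat_pow_Suc2[OF T_closed, of i] by (simp add: \<Gamma>.m_assoc)
  then show ?case by blast
next
  case (inv_T g)
  then obtain i j :: nat and k :: int
    where eq: "g \<otimes>\<^bsub>\<Gamma>\<^esub> T [^]\<^bsub>\<Gamma>\<^esub> j = T [^]\<^bsub>\<Gamma>\<^esub> i \<otimes>\<^bsub>\<Gamma>\<^esub> A [^]\<^bsub>\<Gamma>\<^esub> k" by (elim exE) (rule that)
  show ?case
  proof (cases i)
    case (Suc i')
    have "(inv\<^bsub>\<Gamma>\<^esub> T \<otimes>\<^bsub>\<Gamma>\<^esub> g) \<otimes>\<^bsub>\<Gamma>\<^esub> T [^]\<^bsub>\<Gamma>\<^esub> j = inv\<^bsub>\<Gamma>\<^esub> T \<otimes>\<^bsub>\<Gamma>\<^esub> (T \<otimes>\<^bsub>\<Gamma>\<^esub> (T [^]\<^bsub>\<Gamma>\<^esub> i' \<otimes>\<^bsub>\<Gamma>\<^esub> A [^]\<^bsub>\<Gamma>\<^esub> k))"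
      using inv_T(1) eq unfolding Suc \<Gamma>.nat_pow_Suc2[OF T_closed, of i'] by (simp add: \<Gamma>.m_assoc)
    also have "\<dots> = T [^]\<^bsub>\<Gamma>\<^esub> i' \<otimes>\<^bsub>\<Gamma>\<^esub> A [^]\<^bsub>\<Gamma>\<^esub> k"
      by (simp add: \<Gamma>.m_assoc[symmetric])
    finally show ?thesis by blast
  next
    case 0
    have "(inv\<^bsub>\<Gamma>\<^esub> T \<otimes>\<^bsub>\<Gamma>\<^esub> g) \<otimes>\<^bsub>\<Gamma>\<^esub> T [^]\<^bsub>\<Gamma>\<^esub> Suc j = inv\<^bsub>\<Gamma>\<^esub> T \<otimes>\<^bsub>\<Gamma>\<^esub> (g \<otimes>\<^bsub>\<Gamma>\<^esub> T [^]\<^bsub>\<Gamma>\<^esub> j) \<otimes>\<^bsub>\<Gamma>\<^esub> T"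
      using inv_T(1) by (simp add: \<Gamma>.m_assoc)
    also have "\<dots> = A [^]\<^bsub>\<Gamma>\<^esub> (n * k)"
      by (simp add: eq 0 \<Gamma>.conj_int_pow bs_relation \<Gamma>.int_pow_pow)
    finally have "(inv\<^bsub>\<Gamma>\<^esub> T \<otimes>\<^bsub>\<Gamma>\<^esub> g) \<otimes>\<^bsub>\<Gamma>\<^esub> T [^]\<^bsub>\<Gamma>\<^esub> Suc j = T [^]\<^bsub>\<Gamma>\<^esub> (0::nat) \<otimes>\<^bsub>\<Gamma>\<^esub> A [^]\<^bsub>\<Gamma>\<^esub> (n * k)"
      by simp
    then show ?thesis by blast
  qed
qed
qed

lemma finitely_generated: "finitely_generated_group \<Gamma>"
proof -
  have sub: "{A, T} \<subseteq> carrier \<Gamma>" by simp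
  have "g \<in> generate \<Gamma> {A, T}" if "g \<in> carrier \<Gamma>" for g
    using that by (induction rule: \<Gamma>_induct) (auto intro: generate.intros)
  then show ?thesis
    using \<Gamma>.generate_incl[OF sub] sub \<Gamma>.is_group
    unfolding finitely_generated_group_def by (intro conjI exI[of _ "{A, T}"]) auto
qed

lemma hom_exists:
  assumes "group H" "x \<in> carrier H" "y \<in> carrier H" "inv\<^bsub>H\<^esub> y \<otimes>\<^bsub>H\<^esub> x \<otimes>\<^bsub>H\<^esub> y = x [^]\<^bsub>H\<^esub> n"
  shows "\<exists>h\<in>hom \<Gamma> H. h A = x \<and> h T = y"
proof -
  interpret H: group H by fact
  let ?f = "case_bs_gen x y"
  have f: "range ?f \<subseteq> carrier H" using assms(2,3) by (auto split: bs_gen.split)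
  have "word_value H ?f [(gen_t, False), (gen_a, True), (gen_t, True)] = word_value H ?f (gen_power gen_a n)"
    unfolding H.word_value_gen_power[OF f] using assms by (simp add: letter_value_def H.m_assoc)
  then have "\<exists>h\<in>hom (presented_group bs_relators) H. \<forall>u. h (word_class bs_relators u) = word_value H ?f u"
    by (intro H.presented_group_hom[OF f]) (simp add: bs_relators_def)
  then obtain h where h: "h \<in> hom \<Gamma> H" "\<forall>u. h (word_class bs_relators u) = word_value H ?f u"
    unfolding \<Gamma>_presentation by blast
  have "h A = x" "h T = y"
    using h(2) assms(2,3) by (simp_all add: A_def T_def letter_value_def)
  then show ?thesis using h(1) by blast
qed

text \<open>For \<open>n = 0\<close> the relation makes a conjugate of \<open>A\<close> trivial, and \<open>\<Gamma>\<close> is infinite cyclic.\<close>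

lemma A_trivial:
  assumes "n = 0" shows "A [^]\<^bsub>\<Gamma>\<^esub> (k::int) = \<one>\<^bsub>\<Gamma>\<^esub>"
proof -
  have "A [^]\<^bsub>\<Gamma>\<^esub> n = A [^]\<^bsub>\<Gamma>\<^esub> (0::int)" by (rule arg_cong[OF assms])
  then have "inv\<^bsub>\<Gamma>\<^esub> T \<otimes>\<^bsub>\<Gamma>\<^esub> A \<otimes>\<^bsub>\<Gamma>\<^esub> T = \<one>\<^bsub>\<Gamma>\<^esub>" using bs_relation by simp
  then have "T \<otimes>\<^bsub>\<Gamma>\<^esub> (inv\<^bsub>\<Gamma>\<^esub> T \<otimes>\<^bsub>\<Gamma>\<^esub> A \<otimes>\<^bsub>\<Gamma>\<^esub> T) = T" by simp
  then have "A = \<one>\<^bsub>\<Gamma>\<^esub>" by (simp add: \<Gamma>.m_assoc[symmetric])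
  then show ?thesis by simp
qed

lemma degree_hom:
  obtains \<epsilon> where "\<epsilon> \<in> hom \<Gamma> integer_group" "\<epsilon> A = 0" "\<epsilon> T = 1"
  using hom_exists[of integer_group 0 1] by auto

text \<open>The group acts on the integers modulo \<open>m\<close> by affine maps, \<open>A\<close> as the translation by one and \<open>T\<close> as the
multiplication by an inverse \<open>n'\<close> of \<open>n\<close>. A power of \<open>A\<close> that moves \<open>0\<close> to \<open>0\<close> has an exponent
divisible by \<open>m\<close>.\<close>

lemma cyclic_finite_quotient:
  assumes m: "m > 0" and cop: "coprime m n"
  obtains M where "M \<in> finite_index_normal \<Gamma>"
    "\<forall>k::int. A [^]\<^bsub>\<Gamma>\<^esub> k \<in> M \<longrightarrow> m dvd k"
proof -
  let ?S = "{0..<m}"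
  interpret B: group "BijGroup ?S" by (rule group_BijGroup)
  have carr: "carrier (BijGroup ?S) = Bij ?S" by (simp add: BijGroup_def)
  have mult: "f \<otimes>\<^bsub>BijGroup ?S\<^esub> g = compose ?S f g" if "f \<in> Bij ?S" "g \<in> Bij ?S" for f g
    using that by (simp add: BijGroup_def)
  have one: "\<one>\<^bsub>BijGroup ?S\<^esub> = (\<lambda>z\<in>?S. z)" by (simp add: BijGroup_def)
  have modS: "z mod m \<in> ?S" for z using m by simp
  define shift where "shift = (\<lambda>k. \<lambda>z\<in>?S. (z + k) mod m)"
  have shift_compose: "compose ?S (shift j) (shift k) = shift (j + k)" for j k
    using modS by (auto simp: compose_def shift_def fun_eq_iff mod_simps ac_simps)
  have shift_Bij: "shift k \<in> Bij ?S" for k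
  proof -
    have "bij_betw (shift k) ?S ?S"
      using modS m by (intro bij_betw_byWitness[where f' = "shift (- k)"])
        (auto simp: shift_def mod_simps)
    then show ?thesis by (simp add: Bij_def shift_def)
  qed
  have "shift \<in> hom integer_group (BijGroup ?S)"
    using shift_Bij by (intro homI) (simp_all add: carr mult shift_compose)
  then interpret sh: group_hom integer_group "BijGroup ?S" shift
    by (intro group_hom.intro group_hom_axioms.intro) (simp_all add: B.is_group)
  have shift_pow: "shift 1 [^]\<^bsub>BijGroup ?S\<^esub> k = shift k" for k :: int
    using sh.hom_int_pow[of 1 k] by simp
  obtain n' where n': "[n * n' = 1] (mod m)"
    using cong_solve_coprime_int[of n m] cop by (auto simp: ac_simps)
  define y where "y = (\<lambda>z\<in>?S. (n' * z) mod m)"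
  have nn: "(n * (n' * z)) mod m = z mod m" for z
    using cong_scalar_right[OF n', of z] by (simp add: cong_def mult.assoc)
  have y_Bij: "y \<in> Bij ?S"
  proof -
    have "(n' * (n * z mod m)) mod m = z" "(n * (n' * z mod m)) mod m = z" if "z \<in> ?S" for z
      using nn[of z] that by (simp_all add: mod_simps ac_simps)
    then have "bij_betw y ?S ?S"
      using modS by (intro bij_betw_byWitness[where f' = "\<lambda>z. n * z mod m"]) (auto simp: y_def)
    then show ?thesis by (simp add: Bij_def y_def)
  qed
  have "compose ?S (shift 1) y = compose ?S y (shift n)"
  proof
    fix z
    have "(n' * (z + n)) mod m = (n' * z + 1) mod m"
      using cong_add[OF cong_refl[of "n' * z"] n'] by (simp add: cong_def distrib_left mult.commute)
    then show "compose ?S (shift 1) y z = compose ?S y (shift n) z"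
      using modS by (auto simp: compose_def shift_def y_def mod_simps)
  qed
  then have comm: "shift 1 \<otimes>\<^bsub>BijGroup ?S\<^esub> y = y \<otimes>\<^bsub>BijGroup ?S\<^esub> shift 1 [^]\<^bsub>BijGroup ?S\<^esub> n"
    using shift_Bij y_Bij by (simp add: mult shift_pow)
  have c: "shift k \<in> carrier (BijGroup ?S)" "y \<in> carrier (BijGroup ?S)" for k
    using shift_Bij y_Bij by (simp_all add: carr)
  have "inv\<^bsub>BijGroup ?S\<^esub> y \<otimes>\<^bsub>BijGroup ?S\<^esub> shift 1 \<otimes>\<^bsub>BijGroup ?S\<^esub> y = shift 1 [^]\<^bsub>BijGroup ?S\<^esub> n"
    using c by (simp add: B.m_assoc comm) (simp add: B.m_assoc[symmetric])
  then obtain h where h: "h \<in> hom \<Gamma> (BijGroup ?S)" "h A = shift 1"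
    using hom_exists[OF B.is_group c(1) c(2)] by blast
  interpret h: group_hom \<Gamma> "BijGroup ?S" h
    by (intro group_hom.intro group_hom_axioms.intro h(1)) (simp_all add: B.is_group)
  have "finite (Bij ?S)" using finite_carrier_BijGroup[of ?S] by (simp add: carr)
  moreover have "h ` carrier \<Gamma> \<subseteq> Bij ?S" using h.hom_closed unfolding carr by blast
  ultimately have "finite (h ` carrier \<Gamma>)" using finite_subset by blast
  from h.kernel_finite_index[OF this]
  have "kernel \<Gamma> (BijGroup ?S) h \<in> finite_index_normal \<Gamma>" .
  moreover have "m dvd k" if "A [^]\<^bsub>\<Gamma>\<^esub> k \<in> kernel \<Gamma> (BijGroup ?S) h" for k :: int
  proof -
    have "shift k = (\<lambda>z\<in>?S. z)"
      using that h.hom_int_pow[OF A_closed, of k] by (simp add: kernel_def h(2) shift_pow one)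
    then have "shift k 0 = 0" using m by simp
    then show ?thesis using m by (simp add: shift_def dvd_eq_mod_eq_0)
  qed
  ultimately show ?thesis using that by blast
qed

text \<open>An element of nonzero degree survives in a cyclic quotient of \<open>\<Gamma>\<close>. An element of degree zero is
conjugate to a power \<open>A^k\<close>, which survives in the affine action modulo \<open>\<bar>kn\<bar> + 1\<close>.\<close>

lemma residually_finite: "residually_finite \<Gamma>"
proof -
  have "\<exists>M\<in>finite_index_normal \<Gamma>. g \<notin> M" if g: "g \<in> carrier \<Gamma>" "g \<noteq> \<one>\<^bsub>\<Gamma>\<^esub>" for g
  proof -
    obtain \<epsilon> where \<epsilon>: "\<epsilon> \<in> hom \<Gamma> integer_group" "\<epsilon> A = 0" "\<epsilon> T = 1" by (rule degree_hom)
    interpret \<epsilon>: group_hom \<Gamma> integer_group \<epsilon>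
      by (intro group_hom.intro group_hom_axioms.intro \<epsilon>(1)) simp_all
    obtain i j k where eq: "g \<otimes>\<^bsub>\<Gamma>\<^esub> T [^]\<^bsub>\<Gamma>\<^esub> (j::nat) = T [^]\<^bsub>\<Gamma>\<^esub> (i::nat) \<otimes>\<^bsub>\<Gamma>\<^esub> A [^]\<^bsub>\<Gamma>\<^esub> (k::int)"
      using normal_form[OF g(1)] by (elim exE) (rule that)
    have "\<epsilon> (g \<otimes>\<^bsub>\<Gamma>\<^esub> T [^]\<^bsub>\<Gamma>\<^esub> j) = \<epsilon> g + int j" "\<epsilon> (T [^]\<^bsub>\<Gamma>\<^esub> i \<otimes>\<^bsub>\<Gamma>\<^esub> A [^]\<^bsub>\<Gamma>\<^esub> k) = int i"
      using g(1) by (simp_all add: \<epsilon>.hom_nat_pow \<epsilon>.hom_int_pow \<epsilon>(2,3))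
    then have \<epsilon>g: "\<epsilon> g = int i - int j" using eq by simp
    show ?thesis
    proof (cases "i = j")
      case False
      let ?m = "\<bar>\<epsilon> g\<bar> + 1"
      have "\<not> ?m dvd \<epsilon> g" using False \<epsilon>g zdvd_imp_le[of ?m "\<bar>\<epsilon> g\<bar>"] by auto
      then have "g \<notin> {g \<in> carrier \<Gamma>. ?m dvd \<epsilon> g}" by simp
      moreover have "{g \<in> carrier \<Gamma>. ?m dvd \<epsilon> g} \<in> finite_index_normal \<Gamma>"
        by (rule integer_hom_finite_index[OF \<Gamma>.is_group \<epsilon>(1)]) simp
      ultimately show ?thesis by (rule bexI)
    next
      case True
      have Ak: "A [^]\<^bsub>\<Gamma>\<^esub> k \<noteq> \<one>\<^bsub>\<Gamma>\<^esub>"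
      proof
        assume "A [^]\<^bsub>\<Gamma>\<^esub> k = \<one>\<^bsub>\<Gamma>\<^esub>"
        then have "g \<otimes>\<^bsub>\<Gamma>\<^esub> T [^]\<^bsub>\<Gamma>\<^esub> j = T [^]\<^bsub>\<Gamma>\<^esub> j" using eq True by simp
        then show False using g by simp
      qed
      have "n \<noteq> 0"
        using A_trivial Ak by blast
      define m where "m = \<bar>k * n\<bar> + 1"
      have "k \<noteq> 0" using Ak by auto
      have "1 \<le> \<bar>n\<bar>" using \<open>n \<noteq> 0\<close> by simp
      then have "\<bar>k\<bar> * 1 \<le> \<bar>k\<bar> * \<bar>n\<bar>" by (rule mult_left_mono) simp
      then have "\<bar>k\<bar> < m" by (simp add: m_def abs_mult)
      then have "\<not> m dvd k" using zdvd_imp_le[of m "\<bar>k\<bar>"] \<open>k \<noteq> 0\<close> by auto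
      have "coprime m n"
      proof (rule coprimeI)
        fix d assume d: "d dvd m" "d dvd n"
        then have "d dvd \<bar>k * n\<bar>" by simp
        with d(1) have "d dvd m - \<bar>k * n\<bar>" by (rule dvd_diff)
        then show "is_unit d" by (simp add: m_def)
      qed
      moreover have "m > 0" by (simp add: m_def)
      ultimately obtain M where M: "M \<in> finite_index_normal \<Gamma>" "\<forall>k::int. A [^]\<^bsub>\<Gamma>\<^esub> k \<in> M \<longrightarrow> m dvd k"
        using cyclic_finite_quotient by blast
      have "g \<notin> M"
      proof
        assume "g \<in> M"
        then have "inv\<^bsub>\<Gamma>\<^esub> (T [^]\<^bsub>\<Gamma>\<^esub> j) \<otimes>\<^bsub>\<Gamma>\<^esub> g \<otimes>\<^bsub>\<Gamma>\<^esub> T [^]\<^bsub>\<Gamma>\<^esub> j \<in> M"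
          using normal.inv_op_closed1[OF finite_index_normalD(1)[OF M(1)]] by simp
        also have "inv\<^bsub>\<Gamma>\<^esub> (T [^]\<^bsub>\<Gamma>\<^esub> j) \<otimes>\<^bsub>\<Gamma>\<^esub> g \<otimes>\<^bsub>\<Gamma>\<^esub> T [^]\<^bsub>\<Gamma>\<^esub> j = A [^]\<^bsub>\<Gamma>\<^esub> k"
          using g(1) eq True by (simp add: \<Gamma>.m_assoc) (simp add: \<Gamma>.m_assoc[symmetric])
        finally show False using M(2) \<open>\<not> m dvd k\<close> by blast
      qed
      then show ?thesis using M(1) by blast
    qed
  qed
  then show ?thesis using \<Gamma>.is_group by (simp add: residually_finite_def)
qed

text \<open>The homomorphism given by the relation is injective: the degree \<open>\<pi>\<close> determines \<open>i - j\<close> in a normal form,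
and for \<open>i = j\<close> only the power of \<open>x\<close> remains.\<close>

lemma isomorphic_if_presented:
  assumes H: "group H" and x: "x \<in> carrier H" and t: "t \<in> carrier H"
    and rel: "inv\<^bsub>H\<^esub> t \<otimes>\<^bsub>H\<^esub> x \<otimes>\<^bsub>H\<^esub> t = x [^]\<^bsub>H\<^esub> n"
    and \<pi>: "\<pi> \<in> hom H integer_group" "\<pi> x = 0" "\<pi> t \<noteq> 0"
    and gen: "\<And>S. subgroup S H \<Longrightarrow> x \<in> S \<Longrightarrow> t \<in> S \<Longrightarrow> carrier H \<subseteq> S"
    and free: "\<And>k::int. n \<noteq> 0 \<Longrightarrow> x [^]\<^bsub>H\<^esub> k = \<one>\<^bsub>H\<^esub> \<Longrightarrow> k = 0"
  shows "\<Gamma> \<cong> H"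
proof -
  interpret H: group H by fact
  interpret \<pi>: group_hom H integer_group \<pi>
    by (intro group_hom.intro group_hom_axioms.intro \<pi>(1)) (simp_all add: H)
  obtain h where h: "h \<in> hom \<Gamma> H" "h A = x" "h T = t" using hom_exists[OF H x t rel] by blast
  interpret h: group_hom \<Gamma> H h
    by (intro group_hom.intro group_hom_axioms.intro h(1)) (simp_all add: H)
  have "x \<in> h ` carrier \<Gamma>" "t \<in> h ` carrier \<Gamma>"
    using h(2,3) A_closed T_closed by (metis image_eqI)+
  then have "carrier H \<subseteq> h ` carrier \<Gamma>" using gen[OF h.img_is_subgroup] by blast
  moreover have "g = \<one>\<^bsub>\<Gamma>\<^esub>" if g: "g \<in> carrier \<Gamma>" "h g = \<one>\<^bsub>H\<^esub>" for g
  proof -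
    obtain i j k where eq: "g \<otimes>\<^bsub>\<Gamma>\<^esub> T [^]\<^bsub>\<Gamma>\<^esub> (j::nat) = T [^]\<^bsub>\<Gamma>\<^esub> (i::nat) \<otimes>\<^bsub>\<Gamma>\<^esub> A [^]\<^bsub>\<Gamma>\<^esub> (k::int)"
      using normal_form[OF g(1)] by (elim exE) (rule that)
    have "h (g \<otimes>\<^bsub>\<Gamma>\<^esub> T [^]\<^bsub>\<Gamma>\<^esub> j) = h (T [^]\<^bsub>\<Gamma>\<^esub> i \<otimes>\<^bsub>\<Gamma>\<^esub> A [^]\<^bsub>\<Gamma>\<^esub> k)" by (simp only: eq)
    then have heq: "t [^]\<^bsub>H\<^esub> j = t [^]\<^bsub>H\<^esub> i \<otimes>\<^bsub>H\<^esub> x [^]\<^bsub>H\<^esub> k"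
      using g t by (simp add: h.hom_nat_pow h.hom_int_pow h(2,3))
    have "int j * \<pi> t = \<pi> (t [^]\<^bsub>H\<^esub> j)"
      using t by (simp add: \<pi>.hom_nat_pow)
    also have "\<dots> = \<pi> (t [^]\<^bsub>H\<^esub> i \<otimes>\<^bsub>H\<^esub> x [^]\<^bsub>H\<^esub> k)" by (simp only: heq)
    also have "\<dots> = int i * \<pi> t"
      using x t by (simp add: \<pi>.hom_nat_pow \<pi>.hom_int_pow \<pi>(2))
    finally have ij: "j = i" using \<pi>(3) by simp
    have "t [^]\<^bsub>H\<^esub> i \<otimes>\<^bsub>H\<^esub> x [^]\<^bsub>H\<^esub> k = t [^]\<^bsub>H\<^esub> i \<otimes>\<^bsub>H\<^esub> \<one>\<^bsub>H\<^esub>"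
      using heq[symmetric] t unfolding ij by simp
    then have xk: "x [^]\<^bsub>H\<^esub> k = \<one>\<^bsub>H\<^esub>"
      using H.l_cancel[of "t [^]\<^bsub>H\<^esub> i" "x [^]\<^bsub>H\<^esub> k" "\<one>\<^bsub>H\<^esub>"] x t by simp
    have "A [^]\<^bsub>\<Gamma>\<^esub> k = \<one>\<^bsub>\<Gamma>\<^esub>"
    proof (cases "n = 0")
      case True
      then show ?thesis by (rule A_trivial)
    next
      case False
      then show ?thesis using free[OF False xk] by simp
    qed
    then show ?thesis using eq ij g(1) by simp
  qed
  ultimately have "h \<in> iso \<Gamma> H" by (simp add: h.iso_iff)
  then show ?thesis by (rule is_isoI)
qed

end

section \<open>Abelian groups\<close>

lemma (in comm_group) subgroup_adjoin:
  assumes "subgroup S G" "k \<in> carrier G"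
  shows "subgroup {k [^] (i::int) \<otimes> s | i s. s \<in> S} G" (is "subgroup ?T G")
proof -
  interpret S: subgroup S G by fact
  show ?thesis
  proof (rule subgroupI)
    show "?T \<subseteq> carrier G" using assms(2) S.mem_carrier by auto
    have "\<one> = k [^] (0::int) \<otimes> \<one>" by simp
    then show "?T \<noteq> {}" using S.one_closed by blast
    show "inv x \<in> ?T" if x: "x \<in> ?T" for x
    proof -
      obtain i s where s: "s \<in> S" "x = k [^] (i::int) \<otimes> s" using x by blast
      then have "inv x = k [^] (- i) \<otimes> inv s"
        using assms(2) S.mem_carrier[OF s(1)] by (simp add: inv_mult int_pow_neg)
      then show ?thesis using s(1) S.m_inv_closed by blast
    qed
    show "x \<otimes> y \<in> ?T" if xy: "x \<in> ?T" "y \<in> ?T" for x y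
    proof -
      obtain i s where s: "s \<in> S" "x = k [^] (i::int) \<otimes> s" using xy by blast
      obtain j t where t: "t \<in> S" "y = k [^] (j::int) \<otimes> t" using xy by blast
      have "x \<otimes> y = k [^] (i + j) \<otimes> (s \<otimes> t)"
        using assms(2) S.mem_carrier[OF s(1)] S.mem_carrier[OF t(1)] s(2) t(2)
        by (simp add: int_pow_mult m_ac)
      then show ?thesis using s(1) t(1) S.m_closed by blast
    qed
  qed
qed

lemma (in comm_group) adjoin_incl:
  assumes "subgroup S G" "k \<in> carrier G"
  shows "S \<subseteq> {k [^] (i::int) \<otimes> s | i s. s \<in> S}" "k \<in> {k [^] (i::int) \<otimes> s | i s. s \<in> S}"
proof -
  interpret S: subgroup S G by fact
  have "s = k [^] (0::int) \<otimes> s" if "s \<in> S" for s using S.mem_carrier[OF that] by simp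
  then show "S \<subseteq> {k [^] (i::int) \<otimes> s | i s. s \<in> S}" by blast
  have "k = k [^] (1::int) \<otimes> \<one>" using assms(2) by simp
  then show "k \<in> {k [^] (i::int) \<otimes> s | i s. s \<in> S}" using S.one_closed by blast
qed

text \<open>Finite index, phrased by representatives, so that it makes sense for any subset and does not involve
the quotient group.\<close>

definition finitely_many_cosets :: "('a, 'm) monoid_scheme \<Rightarrow> 'a set \<Rightarrow> bool" where
  "finitely_many_cosets G L \<longleftrightarrow> (\<exists>R. finite R \<and> R \<subseteq> carrier G \<and>
     (\<forall>y\<in>carrier G. \<exists>r\<in>R. \<exists>l\<in>L. y = r \<otimes>\<^bsub>G\<^esub> l))"

text \<open>Adjoin the elements of \<open>E\<close> one at a time: each adjunction multiplies the set of representatives by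
the powers \<open>k^0, ..., k^(m-1)\<close>.\<close>

lemma (in comm_group) finitely_many_cosets_bounded_exponent:
  assumes L: "subgroup L G" and E: "finite E" "E \<subseteq> carrier G" and m: "m > (0::int)"
    and exp: "\<And>y. y \<in> carrier G \<Longrightarrow> y [^] m \<in> L"
    and gen: "carrier G \<subseteq> generate G (E \<union> L)"
  shows "finitely_many_cosets G L"
proof -
  interpret L: subgroup L G by fact
  have "\<exists>S R. subgroup S G \<and> L \<subseteq> S \<and> E \<subseteq> S \<and> finite R \<and> R \<subseteq> carrier G \<and>
      (\<forall>y\<in>S. \<exists>r\<in>R. \<exists>l\<in>L. y = r \<otimes> l)"
    using E
  proof (induction E)
    case empty
    have "\<forall>y\<in>L. \<exists>r\<in>{\<one>}. \<exists>l\<in>L. y = r \<otimes> l" using L.mem_carrier by simp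
    then show ?case using L by (intro exI[of _ L] exI[of _ "{\<one>}"]) simp
  next
    case (insert k E)
    then obtain S R where S: "subgroup S G" "L \<subseteq> S" "E \<subseteq> S" and R: "finite R" "R \<subseteq> carrier G"
      "\<forall>y\<in>S. \<exists>r\<in>R. \<exists>l\<in>L. y = r \<otimes> l" by auto
    have k: "k \<in> carrier G" using insert.prems by simp
    let ?S = "{k [^] (i::int) \<otimes> s | i s. s \<in> S}"
    let ?R = "(\<lambda>(j, r). k [^] (j::int) \<otimes> r) ` ({0..<m} \<times> R)"
    have reps: "\<exists>r\<in>?R. \<exists>l\<in>L. y = r \<otimes> l" if y: "y \<in> ?S" for y
    proof -
      obtain i s where s: "s \<in> S" "y = k [^] (i::int) \<otimes> s" using y by blast
      obtain r l where rl: "r \<in> R" "l \<in> L" "s = r \<otimes> l" using R(3) s(1) by blast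
      have c: "r \<in> carrier G" "l \<in> carrier G" using rl R(2) L.mem_carrier by auto
      have "k [^] i = k [^] (i mod m) \<otimes> (k [^] m) [^] (i div m)"
        using k by (simp add: int_pow_pow int_pow_mult[symmetric])
      then have "y = (k [^] (i mod m) \<otimes> r) \<otimes> ((k [^] m) [^] (i div m) \<otimes> l)"
        using k c by (simp add: s(2) rl(3) m_ac)
      moreover have "(k [^] m) [^] (i div m) \<otimes> l \<in> L"
        using L.m_closed subgroup_int_pow_closed[OF L exp[OF k]] rl(2) by blast
      moreover have "k [^] (i mod m) \<otimes> r \<in> ?R"
        using m rl(1) by (intro image_eqI[of _ _ "(i mod m, r)"]) auto
      ultimately show ?thesis by blast
    qed
    have "?R \<subseteq> carrier G" "finite ?R" using k R(1,2) by auto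
    moreover have "L \<subseteq> ?S" "insert k E \<subseteq> ?S"
      using adjoin_incl[OF S(1) k] S(2,3) by blast+
    ultimately show ?case
      using subgroup_adjoin[OF S(1) k] reps
      by (intro exI[of _ ?S] exI[of _ ?R] conjI ballI)
  qed
  then obtain S R where S: "subgroup S G" "L \<subseteq> S" "E \<subseteq> S" and R: "finite R" "R \<subseteq> carrier G"
      "\<forall>y\<in>S. \<exists>r\<in>R. \<exists>l\<in>L. y = r \<otimes> l" by (elim exE conjE) (rule that)
  have sub: "carrier G \<subseteq> S"
    using gen generate_subgroup_incl[OF Un_least[OF S(3,2)] S(1)] by (rule order_trans)
  show ?thesis
    unfolding finitely_many_cosets_def
    by (intro exI[of _ R] conjI ballI R(1,2)) (rule bspec[OF R(3) subsetD[OF sub]])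
qed

text \<open>Nakayama's argument over the integers localised at \<open>q\<close>, with elimination of one generator \<open>k\<close> at a
time. If \<open>k = e^i v^q\<close> and \<open>v^m\<close> is \<open>k^j\<close> up to an element of \<open>B\<close>, then \<open>k^(m - jq)\<close> lies in \<open>B\<close>, and
\<open>m - jq\<close> is still coprime to \<open>q\<close>. Taking \<open>B\<close> as a parameter avoids quotient groups.\<close>

lemma (in comm_group) nakayama_rank:
  assumes e: "\<And>y. y \<in> carrier G \<Longrightarrow> \<exists>i::int. \<exists>v\<in>carrier G. y = e [^] i \<otimes> v [^] (q::int)"
    and E: "finite E" "E \<subseteq> carrier G" and B: "subgroup B G" "e \<in> B"
    and gen: "\<And>y. y \<in> carrier G \<Longrightarrow> \<exists>m. coprime m q \<and> y [^] (m::int) \<in> generate G (B \<union> E)"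
    and y: "y \<in> carrier G"
  shows "\<exists>m. coprime m q \<and> y [^] (m::int) \<in> B"
  using E B gen y
proof (induction E arbitrary: B y)
  case empty
  then show ?case using generate_subgroup_incl[of B B] by auto
next
  case (insert k E)
  interpret B: subgroup B G by fact
  have k: "k \<in> carrier G" using insert.prems by simp
  let ?B = "{k [^] (i::int) \<otimes> s | i s. s \<in> B}"
  have sB: "subgroup ?B G" "B \<subseteq> ?B" "k \<in> ?B"
    using subgroup_adjoin[OF insert.prems(2) k] adjoin_incl[OF insert.prems(2) k] by blast+
  have "generate G (B \<union> insert k E) \<subseteq> generate G (?B \<union> E)"
    using sB by (intro mono_generate) blast
  then have IH: "\<exists>m. coprime m q \<and> y [^] (m::int) \<in> ?B" if "y \<in> carrier G" for y
    using insert.IH[OF _ sB(1) _ _ that] insert.prems(1,3,4) sB(2) by blast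
  obtain i v where v: "v \<in> carrier G" "k = e [^] (i::int) \<otimes> v [^] q" using e[OF k] by blast
  obtain m j b where m: "coprime m q" "b \<in> B" "v [^] m = k [^] (j::int) \<otimes> b"
    using IH[OF v(1)] by blast
  have ec: "e \<in> carrier G" "b \<in> carrier G" using insert.prems(3) m(2) B.mem_carrier by auto
  have "k [^] m = e [^] (i * m) \<otimes> (v [^] m) [^] q"
    using v ec by (simp add: int_pow_distrib int_pow_pow mult.commute)
  also have "\<dots> = e [^] (i * m) \<otimes> (b [^] q \<otimes> k [^] (j * q))"
    using k ec by (simp add: m(3) int_pow_distrib int_pow_pow m_ac)
  finally have "k [^] m \<otimes> inv (k [^] (j * q)) = e [^] (i * m) \<otimes> b [^] q"
    using k ec by (simp add: m_assoc)
  then have kB: "k [^] (m - j * q) \<in> B"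
    using k insert.prems(3) m(2) by (simp add: int_pow_diff subgroup_int_pow_closed[OF insert.prems(2)])
  have cop: "coprime (m - j * q) q"
  proof (rule coprimeI)
    fix d assume d: "d dvd m - j * q" "d dvd q"
    then have "d dvd m" using dvd_add[OF d(1) dvd_mult[OF d(2), of j]] by simp
    then show "is_unit d" using coprime_common_divisor[OF m(1)] d(2) by simp
  qed
  obtain m' j' b' where m': "coprime m' q" "b' \<in> B" "y [^] m' = k [^] (j'::int) \<otimes> b'"
    using IH[OF insert.prems(5)] by blast
  have "y [^] (m' * (m - j * q)) = (k [^] (m - j * q)) [^] j' \<otimes> b' [^] (m - j * q)"
    using k insert.prems(5) B.mem_carrier[OF m'(2)]
    by (simp add: int_pow_pow[symmetric] m'(3) int_pow_distrib) (simp add: int_pow_pow mult.commute)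
  then have "y [^] (m' * (m - j * q)) \<in> B"
    using kB m'(2) by (simp add: subgroup_int_pow_closed[OF insert.prems(2)])
  then show ?case using cop m'(1) by (intro exI[of _ "m' * (m - j * q)"]) simp
qed

text \<open>Two elements \<open>x\<close>, \<open>k\<close> with \<open>x^D = e^A\<close> and \<open>k^D = e^B\<close> are powers of \<open>x^u k^v\<close>, where
\<open>u A + v B = gcd A B\<close>: this holds after raising to the power \<open>D\<close>, and \<open>D\<close>-th roots are unique.\<close>

lemma (in comm_group) fg_rank_one_cyclic:
  assumes tf: "\<And>y m. y \<in> carrier G \<Longrightarrow> m \<noteq> (0::int) \<Longrightarrow> y [^] m = \<one> \<Longrightarrow> y = \<one>"
    and e: "e \<in> carrier G" and rank: "\<And>y. y \<in> carrier G \<Longrightarrow> \<exists>m i. m \<noteq> (0::int) \<and> y [^] m = e [^] (i::int)"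
    and F: "finite F" "F \<subseteq> carrier G"
  shows "\<exists>x\<in>carrier G. \<forall>y\<in>F. \<exists>i::int. y = x [^] i"
  using F
proof (induction F)
  case empty then show ?case by (intro bexI[of _ \<one>]) auto
next
  case (insert k F)
  then obtain x where x: "x \<in> carrier G" "\<forall>y\<in>F. \<exists>i::int. y = x [^] i" by auto
  have k: "k \<in> carrier G" using insert.prems by simp
  have eqI: "y = w" if "y \<in> carrier G" "w \<in> carrier G" "D \<noteq> (0::int)" "y [^] D = w [^] D" for y w D
  proof -
    have "(y \<otimes> inv w) [^] D = \<one>" using that by (simp add: int_pow_distrib int_pow_inv)
    then have "y \<otimes> inv w = \<one>" using tf that by simp
    then have "y = inv (inv w)" using that by (metis inv_closed inv_equality)
    then show ?thesis using that by simp
  qed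
  obtain m i where m: "m \<noteq> 0" "x [^] (m::int) = e [^] (i::int)" using rank[OF x(1)] by blast
  obtain m' i' where m': "m' \<noteq> 0" "k [^] (m'::int) = e [^] (i'::int)" using rank[OF k] by blast
  define D A B where "D = m * m'" and "A = i * m'" and "B = i' * m"
  have D: "D \<noteq> 0" using m m' by (simp add: D_def)
  have xD: "x [^] D = e [^] A" using m x(1) e by (simp add: D_def A_def int_pow_pow[symmetric])
  have kD: "k [^] D = e [^] B" using m' k e
    by (simp add: D_def B_def int_pow_pow[symmetric] mult.commute[of m])
  obtain u v where uv: "u * A + v * B = gcd A B" using bezout_int by blast
  define z where "z = x [^] u \<otimes> k [^] v"
  have z: "z \<in> carrier G" using x k by (simp add: z_def)
  have "z [^] D = (x [^] D) [^] u \<otimes> (k [^] D) [^] v"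
    using x(1) k by (simp add: z_def int_pow_distrib int_pow_pow mult.commute)
  also have "\<dots> = e [^] gcd A B"
    using e by (simp add: xD kD int_pow_pow int_pow_mult[symmetric] uv[symmetric] mult.commute)
  finally have zD: "z [^] D = e [^] gcd A B" .
  have xz: "x = z [^] (A div gcd A B)"
  proof (rule eqI[OF x(1) _ D])
    have "(z [^] (A div gcd A B)) [^] D = (z [^] D) [^] (A div gcd A B)"
      using z by (simp add: int_pow_pow mult.commute)
    also have "\<dots> = e [^] A" using e by (simp add: zD int_pow_pow)
    finally show "x [^] D = (z [^] (A div gcd A B)) [^] D" using xD by simp
  qed (use z in simp)
  have kz: "k = z [^] (B div gcd A B)"
  proof (rule eqI[OF k _ D])
    have "(z [^] (B div gcd A B)) [^] D = (z [^] D) [^] (B div gcd A B)"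
      using z by (simp add: int_pow_pow mult.commute)
    also have "\<dots> = e [^] B" using e by (simp add: zD int_pow_pow)
    finally show "k [^] D = (z [^] (B div gcd A B)) [^] D" using kD by simp
  qed (use z in simp)
  have "\<exists>i::int. y = z [^] i" if y: "y \<in> F" for y
  proof -
    obtain i :: int where "y = x [^] i" using x(2) y by blast
    then have "y = z [^] (A div gcd A B * i)" using xz z by (metis int_pow_pow)
    then show ?thesis by blast
  qed
  then show ?case using kz z by (intro bexI[of _ z]) auto
qed

section \<open>Abelian groups with an automorphism as modules over the integer polynomials\<close>

text \<open>An abelian group with an automorphism is a module over the Laurent polynomials. The inverse \<open>\<tau>\<close> of \<open>\<sigma>\<close>
is a parameter, so that only ordinary polynomials have to act.\<close>

locale abelian_automorphism = comm_group G for G (structure) +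
  fixes \<sigma> \<tau> :: "'a \<Rightarrow> 'a"
  assumes hom_\<sigma>: "\<sigma> \<in> hom G G" and hom_\<tau>: "\<tau> \<in> hom G G"
    and \<sigma>_\<tau>: "x \<in> carrier G \<Longrightarrow> \<sigma> (\<tau> x) = x" and \<tau>_\<sigma>: "x \<in> carrier G \<Longrightarrow> \<tau> (\<sigma> x) = x"
begin

lemma group_hom_\<sigma>: "group_hom G G \<sigma>" and group_hom_\<tau>: "group_hom G G \<tau>"
  using hom_\<sigma> hom_\<tau> by (auto intro!: group_hom.intro group_hom_axioms.intro is_group)

lemma \<sigma>_simps [simp]:
  "x \<in> carrier G \<Longrightarrow> \<sigma> x \<in> carrier G"
  "x \<in> carrier G \<Longrightarrow> y \<in> carrier G \<Longrightarrow> \<sigma> (x \<otimes> y) = \<sigma> x \<otimes> \<sigma> y"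
  "\<sigma> \<one> = \<one>" "x \<in> carrier G \<Longrightarrow> \<sigma> (inv x) = inv (\<sigma> x)"
  "x \<in> carrier G \<Longrightarrow> \<sigma> (x [^] (i::int)) = \<sigma> x [^] i"
  using hom_\<sigma> group_hom.hom_one[OF group_hom_\<sigma>] group_hom.hom_inv[OF group_hom_\<sigma>]
    group_hom.hom_int_pow[OF group_hom_\<sigma>] hom_mult[OF hom_\<sigma>] by (auto simp: hom_def)

lemma \<tau>_simps [simp]:
  "x \<in> carrier G \<Longrightarrow> \<tau> x \<in> carrier G"
  "x \<in> carrier G \<Longrightarrow> y \<in> carrier G \<Longrightarrow> \<tau> (x \<otimes> y) = \<tau> x \<otimes> \<tau> y"
  "\<tau> \<one> = \<one>" "x \<in> carrier G \<Longrightarrow> \<tau> (inv x) = inv (\<tau> x)"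
  "x \<in> carrier G \<Longrightarrow> \<tau> (x [^] (i::int)) = \<tau> x [^] i"
  using hom_\<tau> group_hom.hom_one[OF group_hom_\<tau>] group_hom.hom_inv[OF group_hom_\<tau>]
    group_hom.hom_int_pow[OF group_hom_\<tau>] hom_mult[OF hom_\<tau>] by (auto simp: hom_def)

definition invariant_subgroup :: "'a set \<Rightarrow> bool" where
  "invariant_subgroup L \<longleftrightarrow> subgroup L G \<and> (\<forall>x\<in>L. \<sigma> x \<in> L \<and> \<tau> x \<in> L)"

text \<open>Horner's scheme for the action of a polynomial in \<open>\<sigma>\<close>; the group is written multiplicatively.\<close>

definition act :: "int poly \<Rightarrow> 'a \<Rightarrow> 'a" where
  "act p x = fold_coeffs (\<lambda>c y. x [^] c \<otimes> \<sigma> y) p \<one>"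

lemma act_0 [simp]: "act 0 x = \<one>"
  by (simp add: act_def)

lemma act_pCons [simp]:
  assumes "x \<in> carrier G" shows "act (pCons c p) x = x [^] c \<otimes> \<sigma> (act p x)"
proof (cases "c = 0 \<and> p = 0")
  case True then show ?thesis using assms by simp
next
  case False then show ?thesis by (auto simp: act_def)
qed

lemma act_closed [simp]: "x \<in> carrier G \<Longrightarrow> act p x \<in> carrier G"
  by (induction p) auto

lemma act_1 [simp]: "x \<in> carrier G \<Longrightarrow> act 1 x = x"
  by (simp add: one_pCons)

lemma act_add: "x \<in> carrier G \<Longrightarrow> act (p + q) x = act p x \<otimes> act q x"
  by (induction p q rule: poly_induct2) (simp_all add: int_pow_mult m_ac)

lemma act_smult: "x \<in> carrier G \<Longrightarrow> act (smult c p) x = act p x [^] c"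
  by (induction p) (simp_all add: int_pow_pow int_pow_distrib mult.commute)

lemma act_uminus: "x \<in> carrier G \<Longrightarrow> act (- p) x = inv (act p x)"
  using act_smult[of x "- 1" p] int_pow_neg[of "act p x" 1] by simp

lemma act_diff: "x \<in> carrier G \<Longrightarrow> act (p - q) x = act p x \<otimes> inv (act q x)"
  using act_add[of x p "- q"] act_uminus[of x q] by simp

lemma act_mult: "x \<in> carrier G \<Longrightarrow> act (p * q) x = act p (act q x)"
  by (induction p) (simp_all add: mult_pCons_left act_add act_smult)

lemma act_arg_mult: "x \<in> carrier G \<Longrightarrow> y \<in> carrier G \<Longrightarrow> act p (x \<otimes> y) = act p x \<otimes> act p y"
  by (induction p) (simp_all add: int_pow_distrib m_ac)

lemma act_one [simp]: "act p \<one> = \<one>"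
  by (induction p) simp_all

lemma act_arg_inv: "x \<in> carrier G \<Longrightarrow> act p (inv x) = inv (act p x)"
  using act_mult[of x p "- 1"] act_mult[of x "- 1" p] by (simp add: act_uminus)

lemma act_arg_int_pow: "x \<in> carrier G \<Longrightarrow> act p (x [^] (c::int)) = act p x [^] c"
  using act_mult[of x p "smult c 1"] act_mult[of x "smult c 1" p] by (simp add: act_smult)

lemma act_\<sigma>: "x \<in> carrier G \<Longrightarrow> act p (\<sigma> x) = \<sigma> (act p x)"
  by (induction p) simp_all

lemma act_\<tau>: "x \<in> carrier G \<Longrightarrow> act p (\<tau> x) = \<tau> (act p x)"
  using act_\<sigma>[of "\<tau> x" p] \<tau>_\<sigma>[of "act p (\<tau> x)"] by (simp add: \<sigma>_\<tau>)

lemma act_monom_Suc: "x \<in> carrier G \<Longrightarrow> act (Polynomial.monom 1 (Suc n)) x = \<sigma> (act (Polynomial.monom 1 n) x)"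
  by (simp add: monom_Suc)

lemma act_monom: "x \<in> carrier G \<Longrightarrow> act (Polynomial.monom c n) x = act (Polynomial.monom 1 n) x [^] c"
  using act_smult[of x c "Polynomial.monom 1 n"] by (simp add: smult_monom)

lemma invariant_subgroupD:
  assumes "invariant_subgroup L"
  shows "subgroup L G" "x \<in> L \<Longrightarrow> x \<in> carrier G" "x \<in> L \<Longrightarrow> \<sigma> x \<in> L" "x \<in> L \<Longrightarrow> \<tau> x \<in> L" "\<one> \<in> L"
    "x \<in> L \<Longrightarrow> y \<in> L \<Longrightarrow> x \<otimes> y \<in> L" "x \<in> L \<Longrightarrow> inv x \<in> L" "x \<in> L \<Longrightarrow> x [^] (i::int) \<in> L"
proof -
  show L: "subgroup L G" using assms by (simp add: invariant_subgroup_def)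
  show "x \<in> L \<Longrightarrow> x \<in> carrier G" by (rule subgroup.mem_carrier[OF L])
  show "x \<in> L \<Longrightarrow> \<sigma> x \<in> L" "x \<in> L \<Longrightarrow> \<tau> x \<in> L" using assms by (simp_all add: invariant_subgroup_def)
  show "\<one> \<in> L" by (rule subgroup.one_closed[OF L])
  show "x \<in> L \<Longrightarrow> y \<in> L \<Longrightarrow> x \<otimes> y \<in> L" by (rule subgroup.m_closed[OF L])
  show "x \<in> L \<Longrightarrow> inv x \<in> L" by (rule subgroup.m_inv_closed[OF L])
  show "x \<in> L \<Longrightarrow> x [^] (i::int) \<in> L" by (rule subgroup_int_pow_closed[OF L])
qed

lemma invariant_subgroup_act:
  assumes "invariant_subgroup L" "x \<in> L" shows "act p x \<in> L"
  using assms(2) by (induction p) (simp_all add: invariant_subgroupD[OF assms(1)])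

lemma invariant_subgroup_act_monomD:
  assumes "invariant_subgroup L" "x \<in> carrier G" "act (Polynomial.monom 1 m) x \<in> L" shows "x \<in> L"
  using assms(3)
proof (induction m)
  case 0 then show ?case using assms(2) by (simp add: monom_0)
next
  case (Suc m)
  then have "\<tau> (\<sigma> (act (Polynomial.monom 1 m) x)) \<in> L"
    using assms(1,2) by (simp add: act_monom_Suc invariant_subgroupD)
  then show ?case using Suc.IH assms(2) by (simp add: \<tau>_\<sigma>)
qed

lemma act_in_subgroup:
  assumes "subgroup L G" "x \<in> carrier G" "\<And>i. i \<le> Polynomial.degree p \<Longrightarrow> act (Polynomial.monom 1 i) x \<in> L"
  shows "act p x \<in> L"
  using assms(2,3)
proof (induction p arbitrary: x)
  case 0 then show ?case using subgroup.one_closed[OF assms(1)] by simp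
next
  case (pCons a p)
  have "act (Polynomial.monom 1 0) x \<in> L" using pCons.prems(2)[of 0] by blast
  then have x: "x \<in> L" using pCons.prems(1) by (simp add: monom_0)
  have "act p (\<sigma> x) \<in> L"
  proof (cases "p = 0")
    case True then show ?thesis using subgroup.one_closed[OF assms(1)] by simp
  next
    case False
    show ?thesis
    proof (rule pCons.IH)
      show "act (Polynomial.monom 1 i) (\<sigma> x) \<in> L" if "i \<le> Polynomial.degree p" for i
        using pCons.prems(2)[of "Suc i"] that False pCons.prems(1) by (simp add: act_monom_Suc act_\<sigma>)
    qed (use pCons.prems(1) in simp)
  qed
  then show ?case
    using pCons.prems(1) x by (simp add: act_\<sigma> subgroup.m_closed[OF assms(1)]
        subgroup_int_pow_closed[OF assms(1)])
qed

abbreviation X_pow :: "nat \<Rightarrow> int poly" where "X_pow n \<equiv> Polynomial.monom 1 n"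

lemma X_pow_mult: "X_pow m * X_pow n = X_pow (m + n)"
  by (simp add: mult_monom)

text \<open>The submodule over the Laurent polynomials generated by \<open>B\<close> and \<open>k\<close>: after multiplication by a power of
\<open>X\<close>, the multiples of \<open>k\<close> have polynomial coefficients.\<close>

lemma invariant_submodule_adjoin:
  assumes B: "invariant_subgroup B" and k: "k \<in> carrier G"
  defines "B' \<equiv> {y \<in> carrier G. \<exists>m g. \<exists>b\<in>B. act (X_pow m) y = act g k \<otimes> b}"
  shows "invariant_subgroup B'" "B \<subseteq> B'" "k \<in> B'"
proof -
  note [simp] = invariant_subgroupD[OF B] k
  have memI: "y \<in> B'" if "y \<in> carrier G" "b \<in> B" "act (X_pow m) y = act g k \<otimes> b" for y b m g
    using that unfolding B'_def by blast
  have memE: "\<exists>m g. \<exists>b\<in>B. y \<in> carrier G \<and> act (X_pow m) y = act g k \<otimes> b" if "y \<in> B'" for y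
    using that unfolding B'_def by blast
  show "B \<subseteq> B'"
  proof
    fix y assume y: "y \<in> B"
    then show "y \<in> B'" by (intro memI[of y y 0 0]) (simp_all add: monom_0)
  qed
  show "k \<in> B'" by (intro memI[of k \<one> 0 1]) (simp_all add: monom_0)
  show "invariant_subgroup B'"
    unfolding invariant_subgroup_def
  proof (intro conjI ballI subgroupI)
    show "B' \<subseteq> carrier G" by (auto simp: B'_def)
    show "B' \<noteq> {}" using \<open>k \<in> B'\<close> by blast
  next
    fix y assume "y \<in> B'"
    from memE[OF this] obtain m g b
      where y: "y \<in> carrier G" "b \<in> B" "act (X_pow m) y = act g k \<otimes> b" by blast
    show "inv y \<in> B'"
      by (intro memI[of "inv y" "inv b" m "- g"]) (use y in \<open>simp_all add: act_arg_inv act_uminus inv_mult\<close>)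
    show "\<sigma> y \<in> B'"
      by (intro memI[of "\<sigma> y" "\<sigma> b" m "pCons 0 g"]) (use y in \<open>simp_all add: act_\<sigma>\<close>)
    show "\<tau> y \<in> B'"
      by (intro memI[of "\<tau> y" b "Suc m" g]) (use y in \<open>simp_all add: act_\<tau> act_monom_Suc \<sigma>_\<tau> \<tau>_\<sigma> flip: \<tau>_simps(2) \<sigma>_simps(2)\<close>)
  next
    fix y z assume "y \<in> B'" "z \<in> B'"
    from memE[OF this(1)] obtain m g b
      where y: "y \<in> carrier G" "b \<in> B" "act (X_pow m) y = act g k \<otimes> b" by blast
    from memE[OF \<open>z \<in> B'\<close>] obtain m' g' b'
      where z: "z \<in> carrier G" "b' \<in> B" "act (X_pow m') z = act g' k \<otimes> b'" by blast
    have "act (X_pow (m + m')) (y \<otimes> z)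
        = act (X_pow m') (act (X_pow m) y) \<otimes> act (X_pow m) (act (X_pow m') z)"
      using y(1) z(1) by (simp add: act_mult[symmetric] X_pow_mult act_arg_mult add.commute)
    also have "\<dots> = act (X_pow m' * g + X_pow m * g') k \<otimes> (act (X_pow m') b \<otimes> act (X_pow m) b')"
      using y z by (simp add: act_arg_mult act_mult act_add m_ac)
    finally show "y \<otimes> z \<in> B'"
      using y z by (intro memI[of _ "act (X_pow m') b \<otimes> act (X_pow m) b'" "m + m'"
            "X_pow m' * g + X_pow m * g'"]) (simp_all add: invariant_subgroup_act[OF B])
  qed
qed

text \<open>The quotient by this submodule is the largest one in which \<open>\<sigma>\<close> has order dividing \<open>N\<close> and the
exponent divides two. It is finite for a finitely generated module.\<close>

lemma truncation_invariant:
  fixes N :: nat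
  defines "L \<equiv> {act (X_pow N - 1) u \<otimes> v [^] (2::int) | u v. u \<in> carrier G \<and> v \<in> carrier G}"
  shows "invariant_subgroup L" "y \<in> carrier G \<Longrightarrow> y [^] (2::int) \<in> L"
    "y \<in> carrier G \<Longrightarrow> act (X_pow N - 1) y \<in> L"
proof -
  let ?W = "X_pow N - 1"
  have memI: "y \<in> L" if "u \<in> carrier G" "v \<in> carrier G" "y = act ?W u \<otimes> v [^] (2::int)" for y u v
    using that unfolding L_def by blast
  show "y [^] (2::int) \<in> L" if "y \<in> carrier G"
    by (rule memI[of \<one> y]) (use that in simp_all)
  show "act ?W y \<in> L" if "y \<in> carrier G"
    by (rule memI[of y \<one>]) (use that in simp_all)
  show "invariant_subgroup L"
    unfolding invariant_subgroup_def
  proof (intro conjI ballI subgroupI)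
    show "L \<subseteq> carrier G" by (auto simp: L_def)
    show "L \<noteq> {}" using memI[of \<one> \<one> \<one>] by auto
  next
    fix y assume "y \<in> L"
    then obtain u v where y: "u \<in> carrier G" "v \<in> carrier G" "y = act ?W u \<otimes> v [^] (2::int)"
      unfolding L_def by blast
    show "inv y \<in> L"
      by (rule memI[of "inv u" "inv v"]) (use y in \<open>simp_all add: act_arg_inv inv_mult int_pow_inv\<close>)
    show "\<sigma> y \<in> L"
      by (rule memI[of "\<sigma> u" "\<sigma> v"]) (use y in \<open>simp_all add: act_\<sigma>\<close>)
    show "\<tau> y \<in> L"
      by (rule memI[of "\<tau> u" "\<tau> v"]) (use y in \<open>simp_all add: act_\<tau>\<close>)
  next
    fix y z assume "y \<in> L" "z \<in> L"
    then obtain u v u' v' where y: "u \<in> carrier G" "v \<in> carrier G" "y = act ?W u \<otimes> v [^] (2::int)"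
      and z: "u' \<in> carrier G" "v' \<in> carrier G" "z = act ?W u' \<otimes> v' [^] (2::int)"
      unfolding L_def by blast
    show "y \<otimes> z \<in> L"
      by (rule memI[of "u \<otimes> u'" "v \<otimes> v'"]) (use y z in \<open>simp_all add: act_arg_mult int_pow_distrib m_ac\<close>)
  qed
qed

lemma powers_invariant:
  "invariant_subgroup {v [^] (q::int) | v. v \<in> carrier G}"
  unfolding invariant_subgroup_def
proof (intro conjI ballI subgroupI)
  show "{v [^] q | v. v \<in> carrier G} \<subseteq> carrier G" by auto
  show "{v [^] q | v. v \<in> carrier G} \<noteq> {}" by blast
next
  fix x y assume "x \<in> {v [^] q | v. v \<in> carrier G}" "y \<in> {v [^] q | v. v \<in> carrier G}"
  then obtain u v where "u \<in> carrier G" "v \<in> carrier G" "x = u [^] q" "y = v [^] q" by blast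
  then show "x \<otimes> y \<in> {v [^] q | v. v \<in> carrier G}"
    by (auto intro!: exI[of _ "u \<otimes> v"] simp: int_pow_distrib)
next
  fix x assume "x \<in> {v [^] q | v. v \<in> carrier G}"
  then obtain u where u: "u \<in> carrier G" "x = u [^] q" by blast
  then show "inv x \<in> {v [^] q | v. v \<in> carrier G}"
    by (auto intro!: exI[of _ "inv u"] simp: int_pow_inv)
  show "\<sigma> x \<in> {v [^] q | v. v \<in> carrier G}" using u by (auto intro!: exI[of _ "\<sigma> u"])
  show "\<tau> x \<in> {v [^] q | v. v \<in> carrier G}" using u by (auto intro!: exI[of _ "\<tau> u"])
qed

text \<open>If \<open>y^m\<close> lies in the span of \<open>E\<close> with \<open>m\<close> coprime to \<open>q\<close>, then Bezout's identity puts \<open>y\<close> in the span of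
\<open>E\<close> and \<open>y^q\<close>.\<close>

lemma powers_finitely_many_cosets:
  assumes E: "finite E" "E \<subseteq> carrier G" and q: "q > (0::int)"
    and gen: "\<And>y. y \<in> carrier G \<Longrightarrow> \<exists>m. coprime m q \<and> y [^] (m::int) \<in> generate G E"
  shows "finitely_many_cosets G {v [^] q | v. v \<in> carrier G}"
proof -
  let ?L = "{v [^] q | v. v \<in> carrier G}"
  have L: "subgroup ?L G" by (rule invariant_subgroupD(1)[OF powers_invariant])
  have sub: "E \<union> ?L \<subseteq> carrier G" using E(2) by auto
  note H = generate_is_subgroup[OF sub]
  have "y \<in> generate G (E \<union> ?L)" if y: "y \<in> carrier G" for y
  proof -
    obtain m where m: "coprime m q" "y [^] m \<in> generate G E" using gen[OF y] by blast
    obtain u v where "u * m + v * q = gcd m q" using bezout_int by blast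
    then have uv: "u * m + v * q = 1" using m(1) by (simp add: coprime_iff_gcd_eq_1)
    have eq: "(y [^] m) [^] u \<otimes> (y [^] q) [^] v = y"
      using y uv by (simp add: int_pow_pow int_pow_mult[symmetric] mult.commute)
    have 1: "(y [^] m) [^] u \<in> generate G (E \<union> ?L)"
      by (rule subgroup_int_pow_closed[OF H subsetD[OF mono_generate[OF Un_upper1] m(2)]])
    have 2: "(y [^] q) [^] v \<in> generate G (E \<union> ?L)"
      by (rule subgroup_int_pow_closed[OF H generate.incl]) (use y in blast)
    show ?thesis using subgroup.m_closed[OF H 1 2] unfolding eq .
  qed
  then have "carrier G \<subseteq> generate G (E \<union> ?L)" by (rule subsetI)
  then show ?thesis
    by (rule finitely_many_cosets_bounded_exponent[OF L E q, rotated]) blast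
qed

end

section \<open>Reduction of integer polynomials modulo two\<close>

definition mod2 :: "int poly \<Rightarrow> bit poly" where
  "mod2 p = map_poly of_int p"

lemma coeff_mod2: "Polynomial.coeff (mod2 p) i = of_int (Polynomial.coeff p i)"
  by (simp add: mod2_def coeff_map_poly)

lemma mod2_simps [simp]:
  "mod2 0 = 0" "mod2 1 = 1" "mod2 (p + q) = mod2 p + mod2 q" "mod2 (p - q) = mod2 p - mod2 q"
  "mod2 (Polynomial.monom 1 n) = Polynomial.monom 1 n" "mod2 (pCons c p) = pCons (of_int c) (mod2 p)"
  by (simp_all add: poly_eq_iff coeff_mod2 coeff_pCons split: nat.split)

lemma mod2_mult [simp]: "mod2 (p * q) = mod2 p * mod2 q"
  by (simp add: poly_eq_iff coeff_mod2 coeff_mult of_int_sum)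

lemma degree_mod2_le: "Polynomial.degree (mod2 p) \<le> Polynomial.degree p"
  by (rule degree_le) (simp add: coeff_mod2 coeff_eq_0)

lemma of_int_bit_eq_0_iff: "(of_int i :: bit) = 0 \<longleftrightarrow> even i"
proof (cases "even i")
  case True
  then obtain k where "i = 2 * k" by (rule evenE)
  then show ?thesis by simp
next
  case False
  then obtain k where "i = 2 * k + 1" by (rule oddE)
  then show ?thesis by simp
qed

text \<open>The polynomial \<open>X^N - 1\<close> divides \<open>X^(N j) - 1\<close>, so it divides \<open>X^(N j) u\<close> only if it divides \<open>u\<close>, which
is impossible for degree reasons.\<close>

lemma mod2_monom_not_dvd:
  assumes "mod2 u \<noteq> 0" "Polynomial.degree u < N" "0 < N"
    and eq: "mod2 (Polynomial.monom 1 (N * j) * u) = mod2 ((Polynomial.monom 1 N - 1) * g)"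
  shows False
proof -
  let ?X = "Polynomial.monom 1 N :: bit poly"
  have pow: "Polynomial.monom 1 (N * j) = ?X ^ j"
    by (simp add: monom_power)
  have "?X - 1 dvd ?X ^ j - 1"
    using power_diff_1_eq[of "?X" j] by (metis dvd_triv_left)
  moreover have "?X ^ j * mod2 u = (?X - 1) * mod2 g"
    using eq by (simp add: pow)
  then have "?X - 1 dvd ?X ^ j * mod2 u" by (metis dvd_triv_left)
  ultimately have "?X - 1 dvd ?X ^ j * mod2 u - (?X ^ j - 1) * mod2 u"
    using dvd_diff dvd_mult2 by blast
  then have "?X - 1 dvd mod2 u" by (simp add: algebra_simps)
  then have "Polynomial.degree (?X - 1) \<le> Polynomial.degree (mod2 u)"
    using assms(1) by (rule dvd_imp_degree_le)
  moreover have "Polynomial.coeff (?X - 1) N \<noteq> 0"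
    using assms(3) by simp
  then have "N \<le> Polynomial.degree (?X - 1)" by (rule le_degree)
  ultimately show False using degree_mod2_le[of u] assms(2) by linarith
qed

section \<open>Modules whose finite quotients are cyclic\<close>

text \<open>A finitely generated module over the Laurent polynomials all of whose finite quotients are cyclic as
abelian groups.\<close>

locale cyclic_quotients = abelian_automorphism +
  fixes F :: "'a set"
  assumes finite_F: "finite F" and F_closed: "F \<subseteq> carrier G"
    and F_generates: "invariant_subgroup L \<Longrightarrow> F \<subseteq> L \<Longrightarrow> carrier G \<subseteq> L"
    and cyclic_quotient: "invariant_subgroup L \<Longrightarrow> finitely_many_cosets G L
      \<Longrightarrow> \<exists>e\<in>carrier G. \<forall>y\<in>carrier G. \<exists>i::int. \<exists>l\<in>L. y = e [^] i \<otimes> l"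
begin

text \<open>The quotient has exponent dividing two and is spanned by the \<open>X^i f\<close> with \<open>i < N\<close> and \<open>f\<close> a generator:
the wrap-around at \<open>i = N\<close> and at \<open>i = -1\<close> is \<open>X^N = 1\<close>.\<close>

lemma truncation_finite:
  assumes L: "invariant_subgroup L" and N: "0 < N" and exp: "\<And>y. y \<in> carrier G \<Longrightarrow> y [^] (2::int) \<in> L"
    and W: "\<And>y. y \<in> carrier G \<Longrightarrow> act (X_pow N - 1) y \<in> L"
  shows "finitely_many_cosets G L"
proof -
  define E where "E = (\<lambda>(i, f). act (X_pow i) f) ` ({..<N} \<times> F)"
  have E: "finite E" "E \<subseteq> carrier G" using finite_F F_closed by (auto simp: E_def)
  have EI: "act (X_pow i) f \<in> E" if "i < N" "f \<in> F" for i f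
    using that by (auto simp: E_def intro!: image_eqI[of _ _ "(i, f)"])
  let ?H = "generate G (E \<union> L)"
  have sub: "E \<union> L \<subseteq> carrier G" using E(2) invariant_subgroupD(2)[OF L] by blast
  have H: "subgroup ?H G" using generate_is_subgroup[OF sub] .
  have incl: "x \<in> ?H" if "x \<in> E \<union> L" for x using that by (rule generate.incl)
  note H' = subgroup.one_closed[OF H] subgroup.m_closed[OF H] subgroup.m_inv_closed[OF H]
    subgroup.mem_carrier[OF H]
  let ?T = "{y \<in> carrier G. \<sigma> y \<in> ?H \<and> \<tau> y \<in> ?H}"
  have T: "subgroup ?T G"
    by (rule subgroupI) (auto simp: H' intro!: exI[of _ \<one>])
  have F_E: "f \<in> E" if "f \<in> F" for f
    using EI[of 0 f] N that F_closed by (simp add: monom_0 subset_iff)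
  have "E \<union> L \<subseteq> ?T"
  proof
    fix x assume "x \<in> E \<union> L"
    then consider "x \<in> L" | i f where "i < N" "f \<in> F" "x = act (X_pow i) f"
      by (auto simp: E_def)
    then show "x \<in> ?T"
    proof cases
      case 1
      then show ?thesis using invariant_subgroupD[OF L] incl by simp
    next
      case 2
      have f: "f \<in> carrier G" using 2 F_closed by blast
      have "\<sigma> x \<in> ?H"
      proof (cases "Suc i < N")
        case True
        then show ?thesis using EI[OF True 2(2)] incl f by (simp add: 2(3) act_monom_Suc)
      next
        case False
        then have "\<sigma> x = act (X_pow N) f"
          using 2(1,3) act_monom_Suc[OF f, of i] by (metis Suc_lessI)
        also have "\<dots> = act (X_pow N - 1) f \<otimes> f"
          using f by (simp add: act_diff m_assoc)
        finally show ?thesis using W[OF f] F_E[OF 2(2)] incl H' by simp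
      qed
      moreover have "\<tau> x \<in> ?H"
      proof (cases i)
        case 0
        obtain N' where N': "N = Suc N'" using N gr0_implies_Suc by blast
        have "act (X_pow N - 1) (\<tau> f) = act (X_pow N') f \<otimes> inv (\<tau> f)"
          using f by (simp add: act_diff N' act_monom_Suc act_\<tau> \<sigma>_\<tau> \<tau>_\<sigma>)
        then have "\<tau> f = act (X_pow N') f \<otimes> inv (act (X_pow N - 1) (\<tau> f))"
          using f by (simp add: inv_mult m_assoc[symmetric])
        moreover have "act (X_pow N') f \<in> E" using EI[of N' f] 2(2) N' by simp
        ultimately have "\<tau> f \<in> ?H" using W[of "\<tau> f"] f incl H'(2,3) by (metis UnCI \<tau>_simps(1))
        then show ?thesis using 0 2 f by (simp add: monom_0)
      next
        case (Suc i')
        then show ?thesis using EI[of i' f] 2 f incl by (simp add: act_monom_Suc \<tau>_\<sigma>)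
      qed
      ultimately show ?thesis using f 2(3) by simp
    qed
  qed
  then have "?H \<subseteq> ?T" using generate_subgroup_incl[OF _ T] by blast
  then have "invariant_subgroup ?H" using H by (auto simp: invariant_subgroup_def)
  then have "carrier G \<subseteq> ?H" using F_generates F_E incl by blast
  then show ?thesis
    using finitely_many_cosets_bounded_exponent[OF invariant_subgroupD(1)[OF L] E, of 2] exp by simp
qed

text \<open>Generators are eliminated one at a time as in Nakayama's lemma, but over the ring of Laurent
polynomials. Let \<open>s\<close> send everything into the submodule generated by \<open>B\<close> and \<open>k\<close>. In the cyclic quotient
of \<open>truncation_finite\<close> the elements \<open>k\<close> and \<open>\<sigma> k\<close> are dependent, so some \<open>w\<close> of degree at most one,
nonzero modulo two, sends \<open>k\<close> into \<open>(X^N - 1) K + 2 K\<close>. Applying \<open>s\<close> gives a relation modulo \<open>B\<close> for \<open>k\<close>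
alone, with coefficient \<open>P = X^m s w - (X^N - 1) h1 - 2 h2\<close>. If \<open>P\<close> vanished modulo two, \<open>X^N - 1\<close> would
divide \<open>s w\<close>, whose degree is less than \<open>N\<close>. So \<open>P s\<close> is nonzero modulo two and sends everything into
\<open>B\<close>.\<close>

lemma annihilator_modulo:
  assumes "finite S" "S \<subseteq> carrier G" "invariant_subgroup B"
    and "\<And>L. invariant_subgroup L \<Longrightarrow> B \<union> S \<subseteq> L \<Longrightarrow> carrier G \<subseteq> L"
  shows "\<exists>s. mod2 s \<noteq> 0 \<and> (\<forall>y\<in>carrier G. act s y \<in> B)"
  using assms
proof (induction S arbitrary: B)
  case empty
  then have "carrier G \<subseteq> B" by simp
  then show ?case by (intro exI[of _ 1]) auto
next
  case (insert k S)
  note [simp] = invariant_subgroupD[OF insert.prems(2)]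
  have k [simp]: "k \<in> carrier G" using insert.prems by simp
  let ?B' = "{y \<in> carrier G. \<exists>m g. \<exists>b\<in>B. act (X_pow m) y = act g k \<otimes> b}"
  note B' = invariant_submodule_adjoin[OF insert.prems(2) k]
  have "\<exists>s. mod2 s \<noteq> 0 \<and> (\<forall>y\<in>carrier G. act s y \<in> ?B')"
  proof (rule insert.IH[OF _ B'(1)])
    show "S \<subseteq> carrier G" using insert.prems by simp
    show "carrier G \<subseteq> L" if "invariant_subgroup L" "?B' \<union> S \<subseteq> L" for L
      using insert.prems(3)[OF that(1)] that(2) B'(2,3) by blast
  qed
  then obtain s where s: "mod2 s \<noteq> 0" "\<forall>y\<in>carrier G. act s y \<in> ?B'" by blast
  have sE: "\<exists>m g. \<exists>b\<in>B. act (X_pow m) (act s y) = act g k \<otimes> b" if "y \<in> carrier G" for y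
    using s(2) that by blast
  \<comment> \<open>large enough that \<open>s w\<close> has degree less than \<open>N\<close> when \<open>w\<close> has degree at most one\<close>
  define N where "N = Polynomial.degree s + 2"
  define L where "L = {act (X_pow N - 1) u \<otimes> v [^] (2::int) | u v. u \<in> carrier G \<and> v \<in> carrier G}"
  note L = truncation_invariant[where N = N, folded L_def]
  have "finitely_many_cosets G L"
    using truncation_finite[OF L(1) _ L(2,3)] by (simp add: N_def)
  from cyclic_quotient[OF L(1) this] obtain e where e: "e \<in> carrier G"
    "\<forall>y\<in>carrier G. \<exists>i::int. \<exists>l\<in>L. y = e [^] i \<otimes> l" by blast
  note LD = invariant_subgroupD[OF L(1)]
  obtain i l where i: "l \<in> L" "k = e [^] (i::int) \<otimes> l" using e(2) k by blast
  obtain j l' where j: "l' \<in> L" "\<sigma> k = e [^] (j::int) \<otimes> l'" using e(2) \<sigma>_simps(1)[OF k] by blast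
  have "\<exists>w. mod2 w \<noteq> 0 \<and> Polynomial.degree w \<le> 1 \<and> act w k \<in> L"
  proof (cases "even i \<and> even j")
    case True
    then obtain i' where "i = 2 * i'" by (auto elim: evenE)
    then have "k = (e [^] i') [^] (2::int) \<otimes> l" using i(2) e(1) by (simp add: int_pow_pow mult.commute)
    then have "k \<in> L" using L(2)[of "e [^] i'"] e(1) LD(6) i(1) by simp
    then show ?thesis by (intro exI[of _ 1]) simp
  next
    case False
    have c: "l \<in> carrier G" "l' \<in> carrier G" using i j LD(2) by auto
    have "act [:j, - i:] k = k [^] j \<otimes> \<sigma> k [^] (- i)" by simp
    also have "\<dots> = (e [^] (i * j) \<otimes> l [^] j) \<otimes> (e [^] (- (i * j)) \<otimes> l' [^] (- i))"
      using e(1) c by (simp add: j(2) del: \<sigma>_simps) (simp add: i(2) int_pow_distrib int_pow_pow mult.commute)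
    also have "\<dots> = l [^] j \<otimes> l' [^] (- i)"
      using e(1) c by (simp add: int_pow_neg m_ac)
    also have "\<dots> \<in> L" using LD i(1) j(1) by simp
    finally have "act [:j, - i:] k \<in> L" .
    moreover have "mod2 [:j, - i:] \<noteq> 0"
      using False by (auto simp: of_int_bit_eq_0_iff simp flip: of_int_minus)
    ultimately show ?thesis by (intro exI[of _ "[:j, - i:]"]) simp
  qed
  then obtain w u v where w: "mod2 w \<noteq> 0" "Polynomial.degree w \<le> 1"
    and uv [simp]: "u \<in> carrier G" "v \<in> carrier G" and wk: "act w k = act (X_pow N - 1) u \<otimes> v [^] (2::int)"
    unfolding L_def by blast
  obtain m1 g1 b1 where 1: "b1 \<in> B" "act (X_pow m1) (act s u) = act g1 k \<otimes> b1"
    using sE[OF uv(1)] by blast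
  obtain m2 g2 b2 where 2: "b2 \<in> B" "act (X_pow m2) (act s v) = act g2 k \<otimes> b2"
    using sE[OF uv(2)] by blast
  \<comment> \<open>a common exponent, and a multiple of \<open>N\<close> so that \<open>X^m = 1\<close> modulo \<open>X^N - 1\<close>\<close>
  define m where "m = N * (m1 + m2)"
  have "m1 \<le> m" "m2 \<le> m" by (simp_all add: m_def N_def)
  then have m: "X_pow m = X_pow (m - m1) * X_pow m1" "X_pow m = X_pow (m - m2) * X_pow m2"
    by (simp_all add: X_pow_mult)
  define h1 where "h1 = X_pow (m - m1) * g1"
  define h2 where "h2 = X_pow (m - m2) * g2"
  define c1 where "c1 = act (X_pow (m - m1)) b1"
  define c2 where "c2 = act (X_pow (m - m2)) b2"
  have c [simp]: "c1 \<in> B" "c2 \<in> B"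
    using 1 2 invariant_subgroup_act[OF insert.prems(2)] by (auto simp: c1_def c2_def)
  have A1: "act (X_pow m * s) u = act h1 k \<otimes> c1"
  proof -
    have "act (X_pow m * s) u = act (X_pow (m - m1)) (act (X_pow m1) (act s u))"
      by (subst m(1)) (simp add: act_mult)
    then show ?thesis using 1 by (simp add: h1_def c1_def act_mult act_arg_mult)
  qed
  have A2: "act (X_pow m * s) v = act h2 k \<otimes> c2"
  proof -
    have "act (X_pow m * s) v = act (X_pow (m - m2)) (act (X_pow m2) (act s v))"
      by (subst m(2)) (simp add: act_mult)
    then show ?thesis using 2 by (simp add: h2_def c2_def act_mult act_arg_mult)
  qed
  define W where "W = X_pow N - 1"
  define P where "P = X_pow m * s * w - (W * h1 + smult 2 h2)"
  have "act (X_pow m * s * w) k = act W (act (X_pow m * s) u) \<otimes> act (X_pow m * s) v [^] (2::int)"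
  proof -
    have "act (X_pow m * s * w) k = act (X_pow m * s) (act W u) \<otimes> act (X_pow m * s) (v [^] (2::int))"
      using wk by (simp add: act_mult[of k] act_arg_mult W_def)
    also have "act (X_pow m * s) (act W u) = act W (act (X_pow m * s) u)"
      using act_mult[OF uv(1), of "X_pow m * s" W] act_mult[OF uv(1), of W "X_pow m * s"]
      by (simp add: mult.commute)
    finally show ?thesis by (simp add: act_arg_int_pow)
  qed
  also have "\<dots> = act (W * h1 + smult 2 h2) k \<otimes> (act W c1 \<otimes> c2 [^] (2::int))"
    by (simp add: A1 A2 act_arg_mult act_add act_mult act_smult int_pow_distrib m_ac)
  finally have "act P k = act W c1 \<otimes> c2 [^] (2::int)"
    by (simp add: P_def act_diff m_ac invariant_subgroup_act[OF insert.prems(2)])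
  then have Pk: "act P k \<in> B"
    using invariant_subgroup_act[OF insert.prems(2) c(1)] by simp
  have P: "mod2 P \<noteq> 0"
  proof
    assume "mod2 P = 0"
    moreover have "mod2 (smult 2 h2) = 0" by (simp add: poly_eq_iff coeff_mod2)
    ultimately have "mod2 (X_pow (N * (m1 + m2)) * (s * w)) = mod2 ((X_pow N - 1) * h1)"
      by (simp add: P_def W_def m_def mult.assoc)
    moreover have "Polynomial.degree (s * w) < N"
      using degree_mult_le[of s w] w(2) by (simp add: N_def)
    moreover have "mod2 (s * w) \<noteq> 0" using s(1) w(1) by simp
    ultimately show False using mod2_monom_not_dvd[of "s * w" N "m1 + m2" h1] by (simp add: N_def)
  qed
  have "act (P * s) y \<in> B" if yc [simp]: "y \<in> carrier G" for y
  proof -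
    obtain n g b where y: "b \<in> B" "act (X_pow n) (act s y) = act g k \<otimes> b"
      using sE[OF yc] by blast
    have "act (X_pow n) (act (P * s) y) = act P (act (X_pow n) (act s y))"
      using act_mult[of "act s y" P "X_pow n"] act_mult[of "act s y" "X_pow n" P]
      by (simp add: act_mult mult.commute)
    also have "\<dots> = act g (act P k) \<otimes> act P b"
      using y act_mult[of k P g] act_mult[of k g P] by (simp add: act_arg_mult mult.commute)
    also have "\<dots> \<in> B" using Pk y(1) invariant_subgroup_act[OF insert.prems(2)] by simp
    finally have "act (X_pow n) (act (P * s) y) \<in> B" .
    from invariant_subgroup_act_monomD[OF insert.prems(2) act_closed[OF yc] this] show ?thesis .
  qed
  then show ?case using P s(1) by (intro exI[of _ "P * s"]) simp
qed

text \<open>The constant coefficient can be made nonzero because \<open>\<sigma>\<close> is invertible.\<close>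

lemma annihilator_exists:
  obtains f where "Polynomial.coeff f 0 \<noteq> 0" "\<And>y. y \<in> carrier G \<Longrightarrow> act f y = \<one>"
proof -
  have "invariant_subgroup {\<one>}"
    by (auto simp: invariant_subgroup_def intro!: subgroupI)
  moreover have "carrier G \<subseteq> L" if "invariant_subgroup L" "{\<one>} \<union> F \<subseteq> L" for L
    using F_generates[OF that(1)] that(2) by blast
  ultimately have "\<exists>s. mod2 s \<noteq> 0 \<and> (\<forall>y\<in>carrier G. act s y \<in> {\<one>})"
    using annihilator_modulo[OF finite_F F_closed] by blast
  then obtain s where "mod2 s \<noteq> 0" "\<forall>y\<in>carrier G. act s y \<in> {\<one>}" by blast
  then have s: "s \<noteq> 0" "\<forall>y\<in>carrier G. act s y = \<one>" by auto
  have "\<exists>f. Polynomial.coeff f 0 \<noteq> 0 \<and> (\<forall>y\<in>carrier G. act f y = \<one>)"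
    using s
  proof (induction s)
    case 0 then show ?case by simp
  next
    case (pCons c p)
    show ?case
    proof (cases "c = 0")
      case False then show ?thesis using pCons.prems by (intro exI[of _ "pCons c p"]) simp
    next
      case True
      have "act p y = \<one>" if "y \<in> carrier G" for y
        using that pCons.prems(2) True \<tau>_\<sigma>[of "act p y"] by simp
      then show ?thesis using pCons.IH pCons.prems(1) True by simp
    qed
  qed
  then show ?thesis using that by blast
qed

text \<open>Let \<open>f\<close> of degree \<open>d\<close> annihilate the module, with outer coefficients \<open>c0\<close> and \<open>c1\<close>, and let \<open>E\<close> consist of
the \<open>X^i z\<close> with \<open>i \<le> d\<close> and \<open>z\<close> a generator. Solving \<open>f = 0\<close> for its leading term shows that
\<open>c1\<close> times \<open>\<sigma>\<close> maps the span of \<open>E\<close> to itself, and solving for its constant term does the same for \<open>c0\<close>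
times \<open>\<tau>\<close>. So the elements with a suitable multiple in this span form a submodule that contains the
generators.\<close>

lemma finite_span_up_to_power:
  "\<exists>E c. finite E \<and> E \<subseteq> carrier G \<and> (c::int) \<noteq> 0 \<and>
    (\<forall>q. \<forall>y\<in>carrier G. coprime c q \<longrightarrow> (\<exists>m. coprime m q \<and> y [^] (m::int) \<in> generate G E))"
proof -
  obtain f where f0: "Polynomial.coeff f 0 \<noteq> 0" and f: "\<And>y. y \<in> carrier G \<Longrightarrow> act f y = \<one>"
    using annihilator_exists by blast
  define d where "d = Polynomial.degree f"
  define c0 where "c0 = Polynomial.coeff f 0"
  define c1 where "c1 = Polynomial.coeff f d"
  have c1: "c1 \<noteq> 0" using f0 by (auto simp: c1_def d_def)
  define E where "E = (\<lambda>(i, z). act (X_pow i) z) ` ({..d} \<times> F)"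
  have E: "finite E" "E \<subseteq> carrier G" using finite_F F_closed by (auto simp: E_def)
  have EI: "act (X_pow i) z \<in> E" if "i \<le> d" "z \<in> F" for i z
    using that by (auto simp: E_def intro!: image_eqI[of _ _ "(i, z)"])
  let ?H = "generate G E"
  have H: "subgroup ?H G" using generate_is_subgroup[OF E(2)] .
  note H' = subgroup.one_closed[OF H] subgroup.m_closed[OF H] subgroup.m_inv_closed[OF H]
    subgroup.mem_carrier[OF H] subgroup_int_pow_closed[OF H]
  have low: "act p z \<in> ?H" if "Polynomial.degree p \<le> d" "z \<in> F" for p z
  proof (rule act_in_subgroup[OF H])
    show "z \<in> carrier G" using that(2) F_closed by blast
    show "act (X_pow i) z \<in> ?H" if "i \<le> Polynomial.degree p" for i
      using that \<open>Polynomial.degree p \<le> d\<close> \<open>z \<in> F\<close> by (intro generate.incl EI) simp_all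
  qed
  have cancel: "x \<in> ?H" if "x \<in> carrier G" "y \<in> ?H" "x \<otimes> y = \<one>" for x y
  proof -
    have "inv y = x" by (rule inv_equality[OF that(3) H'(4)[OF that(2)] that(1)])
    then show ?thesis using H'(3)[OF that(2)] by simp
  qed
  let ?T = "{y \<in> carrier G. \<sigma> y [^] c1 \<in> ?H \<and> \<tau> y [^] c0 \<in> ?H}"
  have T: "subgroup ?T G"
    by (rule subgroupI) (auto simp: H' int_pow_distrib int_pow_inv intro!: exI[of _ \<one>])
  have "E \<subseteq> ?T"
  proof
    fix x assume "x \<in> E"
    then obtain i z where x: "i \<le> d" "z \<in> F" "x = act (X_pow i) z" by (auto simp: E_def)
    have z: "z \<in> carrier G" using x(2) F_closed by blast
    have "\<sigma> x [^] c1 \<in> ?H"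
    proof (cases "i < d")
      case True
      then have "\<sigma> x \<in> ?H"
        using EI[of "Suc i" z] x z by (auto simp: act_monom_Suc intro: generate.incl)
      then show ?thesis by (rule H'(5))
    next
      case False
      let ?r = "pCons 0 f - Polynomial.monom c1 (Suc d)"
      have "Polynomial.degree ?r \<le> d"
      proof (rule degree_le, intro allI impI)
        fix j assume "d < j"
        then obtain j' where "j = Suc j'" "d \<le> j'" by (metis Suc_le_D less_eq_Suc_le Suc_le_mono)
        then show "Polynomial.coeff ?r j = 0"
          by (auto simp: coeff_pCons c1_def d_def coeff_eq_0)
      qed
      then have r: "act ?r z \<in> ?H" using low x(2) by blast
      have "act (Polynomial.monom c1 (Suc d)) z \<otimes> act ?r z = act (pCons 0 f) z"
        using act_add[OF z, of "Polynomial.monom c1 (Suc d)" ?r] by simp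
      also have "\<dots> = \<one>" using f[OF z] z by simp
      finally have "act (Polynomial.monom c1 (Suc d)) z \<in> ?H"
        using cancel r z by (meson act_closed)
      moreover have "i = d" using False x(1) by simp
      ultimately show ?thesis
        using z by (simp add: x(3) act_monom[of z c1] act_monom_Suc)
    qed
    moreover have "\<tau> x [^] c0 \<in> ?H"
    proof (cases i)
      case 0
      obtain g where g: "f = pCons c0 g" by (metis c0_def coeff_pCons_0 pCons_cases)
      have "Polynomial.degree g \<le> d" using g degree_pCons_eq_if[of c0 g] by (simp add: d_def split: if_splits)
      then have "act g z \<in> ?H" using low x(2) by blast
      moreover have "\<tau> z [^] c0 \<otimes> act g z = \<one>"
        using f[of "\<tau> z"] z by (simp add: g act_\<tau> \<sigma>_\<tau> \<tau>_\<sigma>)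
      ultimately have "\<tau> z [^] c0 \<in> ?H" using cancel z by simp
      then show ?thesis using 0 x(3) z by (simp add: monom_0)
    next
      case (Suc i')
      then have "\<tau> x \<in> ?H"
        using EI[of i' z] x z by (auto simp: act_monom_Suc \<tau>_\<sigma> intro: generate.incl)
      then show ?thesis by (rule H'(5))
    qed
    ultimately show "x \<in> ?T" using z x(3) by simp
  qed
  then have HT: "?H \<subseteq> ?T" using generate_subgroup_incl[OF _ T] by blast
  have all: "\<exists>m. coprime m q \<and> y [^] (m::int) \<in> ?H" if q: "coprime (c0 * c1) q" and y: "y \<in> carrier G" for q y
  proof -
    let ?K = "{y \<in> carrier G. \<exists>m. coprime m q \<and> y [^] (m::int) \<in> ?H}"
    have KI: "y \<in> ?K" if "y \<in> carrier G" "coprime m q" "y [^] m \<in> ?H" for y m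
      using that by blast
    have "invariant_subgroup ?K"
      unfolding invariant_subgroup_def
    proof (intro conjI ballI subgroupI)
      show "?K \<subseteq> carrier G" by blast
      show "?K \<noteq> {}" using KI[of \<one> 1] H'(1) by force
    next
      fix y assume "y \<in> ?K"
      then obtain m where y: "y \<in> carrier G" "coprime m q" "y [^] (m::int) \<in> ?H" by blast
      show "inv y \<in> ?K" by (rule KI[of _ m]) (use y H' in \<open>simp_all add: int_pow_inv\<close>)
      have T': "\<sigma> (y [^] m) [^] c1 \<in> ?H" "\<tau> (y [^] m) [^] c0 \<in> ?H" using HT y(3) by blast+
      show "\<sigma> y \<in> ?K"
        by (rule KI[of _ "m * c1"]) (use y T' q in \<open>simp_all add: int_pow_pow[symmetric]\<close>)
      show "\<tau> y \<in> ?K"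
        by (rule KI[of _ "m * c0"]) (use y T' q in \<open>simp_all add: int_pow_pow[symmetric]\<close>)
    next
      fix y z assume "y \<in> ?K" "z \<in> ?K"
      then obtain m m' where y: "y \<in> carrier G" "coprime m q" "y [^] (m::int) \<in> ?H"
        and z: "z \<in> carrier G" "coprime m' q" "z [^] (m'::int) \<in> ?H" by blast
      have "(y \<otimes> z) [^] (m * m') = (y [^] m) [^] m' \<otimes> (z [^] m') [^] m"
        using y z by (simp add: int_pow_distrib int_pow_pow mult.commute)
      then have "(y \<otimes> z) [^] (m * m') \<in> ?H" using H'(2,5) y(3) z(3) by simp
      then show "y \<otimes> z \<in> ?K" using y z by (intro KI[of _ "m * m'"]) simp_all
    qed
    moreover have "F \<subseteq> ?K"
    proof
      fix z assume z: "z \<in> F"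
      have "z \<in> E" using EI[of 0 z] z subsetD[OF F_closed z] by (simp add: monom_0)
      then have "z \<in> ?H" by (rule generate.incl)
      then show "z \<in> ?K" using z F_closed by (intro KI[of _ 1]) auto
    qed
    ultimately show ?thesis using F_generates y by blast
  qed
  show ?thesis
    using E all c1 f0 by (intro exI[of _ E] exI[of _ "c0 * c1"]) (simp add: c0_def)
qed

text \<open>Reduce modulo an integer \<open>q > 1\<close> coprime to the constant \<open>c\<close> of \<open>finite_span_up_to_power\<close>: the quotient by
the \<open>q\<close>-th powers is finite, hence generated by some \<open>e\<close>, and \<open>nakayama_rank\<close> applies.\<close>

lemma rank_one:
  "\<exists>e\<in>carrier G. \<forall>y\<in>carrier G. \<exists>m i. m \<noteq> (0::int) \<and> y [^] m = e [^] (i::int)"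
proof -
  obtain E c where E: "finite E" "E \<subseteq> carrier G" "(c::int) \<noteq> 0"
    "\<forall>q. \<forall>y\<in>carrier G. coprime c q \<longrightarrow> (\<exists>m. coprime m q \<and> y [^] (m::int) \<in> generate G E)"
    using finite_span_up_to_power by (elim exE conjE) (rule that)
  obtain q where q: "coprime c q" "q > (1::int)"
  proof
    show "coprime c (\<bar>c\<bar> + 1)"
    proof (rule coprimeI)
      fix d assume "d dvd c" "d dvd \<bar>c\<bar> + 1"
      then show "is_unit d" by (metis abs_dvd_iff dvd_abs_iff dvd_add_right_iff)
    qed
    show "\<bar>c\<bar> + 1 > 1" using E(3) by simp
  qed
  have E4: "\<exists>m. coprime m q \<and> y [^] (m::int) \<in> generate G E" if "y \<in> carrier G" for y
    using E(4) q(1) that by blast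
  let ?L = "{v [^] q | v. v \<in> carrier G}"
  have "finitely_many_cosets G ?L"
    using powers_finitely_many_cosets[OF E(1,2) _ E4] q(2) by simp
  from cyclic_quotient[OF powers_invariant this] obtain e where e: "e \<in> carrier G"
    "\<forall>y\<in>carrier G. \<exists>i::int. \<exists>l\<in>?L. y = e [^] i \<otimes> l" by (elim bexE) (rule that)
  have e': "\<exists>i::int. \<exists>v\<in>carrier G. y = e [^] i \<otimes> v [^] q" if "y \<in> carrier G" for y
    using bspec[OF e(2) that] by blast
  have B: "subgroup (generate G {e}) G" using e(1) by (simp add: generate_is_subgroup)
  have "\<exists>m i. m \<noteq> (0::int) \<and> y [^] m = e [^] (i::int)" if y: "y \<in> carrier G" for y
  proof -
    have "\<exists>m. coprime m q \<and> y [^] (m::int) \<in> generate G {e}"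
    proof (rule nakayama_rank[OF e' E(1,2) B _ _ y])
      show "\<exists>m. coprime m q \<and> y [^] (m::int) \<in> generate G (generate G {e} \<union> E)"
        if "y \<in> carrier G" for y
        using E4[OF that] subsetD[OF mono_generate[OF Un_upper2]] by blast
    qed (auto intro: generate.incl)
    then obtain m where m: "coprime m q" "y [^] m \<in> generate G {e}" by blast
    then have "m \<noteq> 0" using q(2) by auto
    moreover have "\<exists>i::int. y [^] m = e [^] i" using m(2) by (auto simp: generate_pow[OF e(1)])
    ultimately show ?thesis by blast
  qed
  then show ?thesis using e(1) by blast
qed

text \<open>By rank one, finitely many generators are powers of a single \<open>x\<close>, and \<open>\<sigma> x\<close> and \<open>x\<close> have a common power.
Uniqueness of roots reduces that relation to coprime exponents \<open>a\<close>, \<open>b\<close> and spreads it to the submodule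
generated by \<open>x\<close>, which is everything. The last clause says that the module is spanned by \<open>x\<close> over the
integers with \<open>ab\<close> inverted.\<close>

lemma torsion_free_structure:
  assumes tf: "\<And>y m. y \<in> carrier G \<Longrightarrow> m \<noteq> (0::int) \<Longrightarrow> y [^] m = \<one> \<Longrightarrow> y = \<one>"
    and nontrivial: "carrier G \<noteq> {\<one>}"
  shows "\<exists>x a b. x \<in> carrier G \<and> x \<noteq> \<one> \<and> a \<noteq> 0 \<and> b \<noteq> 0 \<and> coprime a (b::int) \<and>
    (\<forall>y\<in>carrier G. \<sigma> y [^] b = y [^] a) \<and>
    (\<forall>L. invariant_subgroup L \<longrightarrow> x \<in> L \<longrightarrow> carrier G \<subseteq> L) \<and>
    (\<forall>y\<in>carrier G. \<exists>j i. y [^] ((a * b) ^ j) = x [^] (i::int))"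
proof -
  obtain e where e: "e \<in> carrier G"
    "\<forall>y\<in>carrier G. \<exists>m i. m \<noteq> (0::int) \<and> y [^] m = e [^] (i::int)"
    using rank_one by (elim bexE) (rule that)
  have "\<exists>x\<in>carrier G. \<forall>y\<in>F. \<exists>i::int. y = x [^] i"
  proof (rule fg_rank_one_cyclic[OF _ e(1) _ finite_F F_closed])
    show "y = \<one>" if "y \<in> carrier G" "m \<noteq> (0::int)" "y [^] m = \<one>" for y m
      using tf[OF that] .
    show "\<exists>m i. m \<noteq> (0::int) \<and> y [^] m = e [^] (i::int)" if "y \<in> carrier G" for y
      using bspec[OF e(2) that] .
  qed
  then obtain x where x: "x \<in> carrier G" "\<forall>y\<in>F. \<exists>i::int. y = x [^] i"
    by (elim bexE) (rule that)
  have gen: "carrier G \<subseteq> L" if L: "invariant_subgroup L" "x \<in> L" for L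
  proof (rule F_generates[OF L(1)], rule subsetI)
    fix y assume "y \<in> F"
    then obtain i :: int where "y = x [^] i" using x(2) by blast
    then show "y \<in> L" using invariant_subgroupD(8)[OF L(1,2)] by simp
  qed
  have "x \<noteq> \<one>"
  proof
    assume "x = \<one>"
    moreover have "invariant_subgroup {\<one>}"
      by (auto simp: invariant_subgroup_def intro!: subgroupI)
    ultimately have "carrier G \<subseteq> {\<one>}" using gen by blast
    then show False using nontrivial one_closed by blast
  qed
  obtain m1 i1 where 1: "m1 \<noteq> 0" "x [^] (m1::int) = e [^] (i1::int)" using bspec[OF e(2) x(1)] by blast
  obtain m2 i2 where 2: "m2 \<noteq> 0" "\<sigma> x [^] (m2::int) = e [^] (i2::int)"
    using bspec[OF e(2) \<sigma>_simps(1)[OF x(1)]] by blast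
  have i1: "i1 \<noteq> 0" using 1 tf[OF x(1) 1(1)] \<open>x \<noteq> \<one>\<close> by auto
  define a0 b0 where "a0 = m1 * i2" and "b0 = m2 * i1"
  have b0: "b0 \<noteq> 0" using 2 i1 by (simp add: b0_def)
  have "\<sigma> x [^] b0 = (\<sigma> x [^] m2) [^] i1" using x(1) by (simp add: b0_def int_pow_pow)
  also have "\<dots> = (x [^] m1) [^] i2" using e(1) by (simp add: 1 2 int_pow_pow mult.commute)
  also have "\<dots> = x [^] a0" using x(1) by (simp add: a0_def int_pow_pow)
  finally have eq0: "\<sigma> x [^] b0 = x [^] a0" .
  define g where "g = gcd a0 b0"
  define a b where "a = a0 div g" and "b = b0 div g"
  have g: "g \<noteq> 0" "a0 = a * g" "b0 = b * g" using b0 by (simp_all add: g_def a_def b_def)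
  have cop: "coprime a b" using b0 by (simp add: a_def b_def g_def div_gcd_coprime)
  have b: "b \<noteq> 0" using b0 g by auto
  have "(\<sigma> x [^] b \<otimes> inv (x [^] a)) [^] g = \<one>"
    using x(1) eq0 by (simp add: int_pow_distrib int_pow_inv int_pow_pow g(2,3))
  then have "\<sigma> x [^] b \<otimes> inv (x [^] a) = \<one>" using tf[OF _ g(1)] x(1) by simp
  from inv_equality[OF this] have eq: "\<sigma> x [^] b = x [^] a" using x(1) by simp
  have a: "a \<noteq> 0"
  proof
    assume "a = 0"
    then have "\<sigma> x = \<one>" using eq tf[OF _ b] x(1) by simp
    then have "\<tau> (\<sigma> x) = \<one>" by simp
    then show False using \<open>x \<noteq> \<one>\<close> x(1) by (simp add: \<tau>_\<sigma>)
  qed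
  let ?S = "{y \<in> carrier G. \<sigma> y [^] b = y [^] a}"
  have "invariant_subgroup ?S"
    unfolding invariant_subgroup_def
  proof (intro conjI ballI subgroupI)
    show "?S \<noteq> {}" using x(1) eq by blast
    show "inv y \<in> ?S" if "y \<in> ?S" for y using that by (simp add: int_pow_inv)
    show "y \<otimes> z \<in> ?S" if "y \<in> ?S" "z \<in> ?S" for y z using that by (simp add: int_pow_distrib)
  next
    fix y assume "y \<in> ?S"
    then have y: "y \<in> carrier G" and e: "\<sigma> y [^] b = y [^] a" by simp_all
    have "\<sigma> (\<sigma> y) [^] b = \<sigma> (\<sigma> y [^] b)" using y by simp
    also have "\<dots> = \<sigma> y [^] a" unfolding e using y by simp
    finally show "\<sigma> y \<in> ?S" using y by simp
    have "\<sigma> (\<tau> y) [^] b = \<tau> (\<sigma> y [^] b)" using y by (simp add: \<tau>_\<sigma> \<sigma>_\<tau>)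
    also have "\<dots> = \<tau> y [^] a" unfolding e using y by simp
    finally show "\<tau> y \<in> ?S" using y by simp
  qed auto
  then have all: "\<sigma> y [^] b = y [^] a" if "y \<in> carrier G" for y
    using gen[of ?S] eq x(1) that by blast
  let ?T = "{y \<in> carrier G. \<exists>j i. y [^] ((a * b) ^ j) = x [^] (i::int)}"
  have TI: "y \<in> ?T" if "y \<in> carrier G" "y [^] ((a * b) ^ j) = x [^] (i::int)" for y j i
    using that by blast
  have "invariant_subgroup ?T"
    unfolding invariant_subgroup_def
  proof (intro conjI ballI subgroupI)
    have "x \<in> ?T" by (rule TI[of x 0 1]) (use x(1) in simp_all)
    then show "?T \<noteq> {}" by blast
  next
    fix y assume "y \<in> ?T"
    then obtain j i where y: "y \<in> carrier G" "y [^] ((a * b) ^ j) = x [^] (i::int)" by blast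
    show "inv y \<in> ?T"
      by (rule TI[of _ j "- i"]) (use y x(1) in \<open>simp_all add: int_pow_inv int_pow_neg\<close>)
    have "\<sigma> y [^] ((a * b) ^ Suc j) = (\<sigma> (y [^] ((a * b) ^ j)) [^] b) [^] a"
      using y(1) by (simp add: int_pow_pow ac_simps)
    also have "\<dots> = (\<sigma> x [^] b) [^] (i * a)"
      using x(1) by (simp add: y(2) int_pow_pow ac_simps)
    also have "\<dots> = x [^] (a * (i * a))"
      using x(1) by (simp add: eq int_pow_pow)
    finally show "\<sigma> y \<in> ?T" using y(1) by (intro TI[of _ "Suc j"]) simp_all
    have xa: "\<tau> x [^] a = x [^] b" using all[of "\<tau> x"] x(1) by (simp add: \<sigma>_\<tau>)
    have "\<tau> y [^] ((a * b) ^ Suc j) = (\<tau> (y [^] ((a * b) ^ j)) [^] a) [^] b"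
      using y(1) by (simp add: int_pow_pow ac_simps)
    also have "\<dots> = (\<tau> x [^] a) [^] (i * b)"
      using x(1) by (simp add: y(2) int_pow_pow ac_simps)
    also have "\<dots> = x [^] (b * (i * b))"
      using x(1) by (simp add: xa int_pow_pow)
    finally show "\<tau> y \<in> ?T" using y(1) by (intro TI[of _ "Suc j"]) simp_all
  next
    fix y z assume "y \<in> ?T" "z \<in> ?T"
    then obtain j i j' i' where y: "y \<in> carrier G" "y [^] ((a * b) ^ j) = x [^] (i::int)"
      and z: "z \<in> carrier G" "z [^] ((a * b) ^ j') = x [^] (i'::int)" by blast
    have "(y \<otimes> z) [^] ((a * b) ^ (j + j'))
        = (y [^] ((a * b) ^ j)) [^] ((a * b) ^ j') \<otimes> (z [^] ((a * b) ^ j')) [^] ((a * b) ^ j)"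
      using y(1) z(1) by (simp add: int_pow_distrib int_pow_pow power_add mult.commute)
    also have "\<dots> = x [^] (i * (a * b) ^ j' + i' * (a * b) ^ j)"
      using x(1) by (simp add: y z int_pow_pow int_pow_mult)
    finally show "y \<otimes> z \<in> ?T" using y(1) z(1) by (intro TI[of _ "j + j'"]) simp_all
  qed auto
  moreover have "x \<in> ?T" by (rule TI[of x 0 1]) (use x(1) in simp_all)
  ultimately have "\<exists>j i. y [^] ((a * b) ^ j) = x [^] (i::int)" if "y \<in> carrier G" for y
    using gen[of ?T] that by blast
  then show ?thesis
    using x(1) \<open>x \<noteq> \<one>\<close> a b cop all gen
    by (intro exI[of _ x] exI[of _ a] exI[of _ b] conjI ballI allI impI)
qed

end

section \<open>Homomorphisms to the integers\<close>

text \<open>A finitely generated abelian group of infinite exponent maps nontrivially to the integers. When \<open>k\<close>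
is adjoined to \<open>B\<close> and all \<open>E\<close>-th powers lie in the subgroup that \<open>B\<close> and \<open>k\<close> generate, either some
multiple of \<open>k\<close> lies in \<open>B\<close>, which bounds the exponent modulo \<open>B\<close>, or the exponent of \<open>k\<close> in an
\<open>E\<close>-th power is well defined modulo \<open>B\<close> and is the required homomorphism.\<close>

lemma (in comm_group) bounded_exponent_or_integer_hom:
  assumes "finite F" "F \<subseteq> carrier G" "subgroup B G"
    and "\<And>S. subgroup S G \<Longrightarrow> B \<union> F \<subseteq> S \<Longrightarrow> carrier G \<subseteq> S"
  shows "(\<exists>E>0. \<forall>x\<in>carrier G. x [^] (E::int) \<in> B) \<or>
    (\<exists>f\<in>hom G integer_group. \<exists>x\<in>carrier G. f x \<noteq> 0)"
  using assms
proof (induction F arbitrary: B)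
  case empty
  then have "carrier G \<subseteq> B" by simp
  then have "\<forall>x\<in>carrier G. x [^] (1::int) \<in> B" by auto
  then show ?case using zero_less_one by blast
next
  case (insert k F)
  have k: "k \<in> carrier G" using insert.prems by simp
  note B = insert.prems(2)
  let ?B = "{k [^] (i::int) \<otimes> s | i s. s \<in> B}"
  note B' = subgroup_adjoin[OF B k] adjoin_incl[OF B k]
  have Bc: "b \<in> carrier G" if "b \<in> B" for b using subgroup.mem_carrier[OF B that] .
  have "(\<exists>E>0. \<forall>x\<in>carrier G. x [^] (E::int) \<in> ?B) \<or>
    (\<exists>f\<in>hom G integer_group. \<exists>x\<in>carrier G. f x \<noteq> 0)"
  proof (rule insert.IH[OF _ B'(1)])
    show "F \<subseteq> carrier G" using insert.prems by simp
    show "carrier G \<subseteq> S" if S: "subgroup S G" "?B \<union> F \<subseteq> S" for S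
    proof (rule insert.prems(3)[OF S(1)])
      have "B \<subseteq> S" "k \<in> S" using B'(2,3) S(2) by (meson Un_subset_iff subset_trans subsetD)+
      then show "B \<union> insert k F \<subseteq> S" using S(2) by simp
    qed
  qed
  then show ?case
  proof
    assume "\<exists>E>0. \<forall>x\<in>carrier G. x [^] (E::int) \<in> ?B"
    then obtain E where E: "E > (0::int)" "\<forall>x\<in>carrier G. x [^] E \<in> ?B" by blast
    have ex: "\<exists>i b. b \<in> B \<and> x [^] E = k [^] (i::int) \<otimes> b" if "x \<in> carrier G" for x
      using bspec[OF E(2) that] by blast
    show ?thesis
    proof (cases "\<exists>m>0. k [^] (m::int) \<in> B")
      case True
      then obtain m where m: "m > 0" "k [^] (m::int) \<in> B" by blast
      have "x [^] (E * m) \<in> B" if x: "x \<in> carrier G" for x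
      proof -
        obtain i b where ib: "b \<in> B" "x [^] E = k [^] (i::int) \<otimes> b" using ex[OF x] by blast
        have "x [^] (E * m) = (k [^] m) [^] i \<otimes> b [^] m"
          using x k Bc[OF ib(1)] by (simp add: int_pow_pow[symmetric] ib(2) int_pow_distrib)
            (simp add: int_pow_pow mult.commute)
        then show ?thesis
          using subgroup_int_pow_closed[OF B m(2)] subgroup_int_pow_closed[OF B ib(1)]
            subgroup.m_closed[OF B] by simp
      qed
      moreover have "E * m > 0" using E(1) m(1) by simp
      ultimately show ?thesis by blast
    next
      case False
      have uniq: "i = j" if eq: "b \<in> B" "c \<in> B" "k [^] (i::int) \<otimes> b = k [^] (j::int) \<otimes> c" for i j b c
      proof -
        have mem: "k [^] (i - j) \<in> B" if "b \<in> B" "c \<in> B" "k [^] (i::int) \<otimes> b = k [^] (j::int) \<otimes> c" for i j b c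
        proof -
          have "k [^] (i - j) = inv (k [^] j) \<otimes> (k [^] i \<otimes> b) \<otimes> inv b"
            using k Bc[OF that(1)] by (simp add: int_pow_diff m_assoc) (simp add: m_comm)
          also have "\<dots> = c \<otimes> inv b"
            unfolding that(3) using k Bc[OF that(1)] Bc[OF that(2)] by (simp add: m_assoc[symmetric])
          finally show ?thesis
            using subgroup.m_closed[OF B that(2) subgroup.m_inv_closed[OF B that(1)]] by simp
        qed
        have "\<not> i - j > 0" using mem[OF eq] False by blast
        moreover have "\<not> j - i > 0" using mem[OF eq(2,1) eq(3)[symmetric]] False by blast
        ultimately show ?thesis by simp
      qed
      define f where "f = (\<lambda>x. THE i. \<exists>b. b \<in> B \<and> x [^] E = k [^] (i::int) \<otimes> b)"
      have fI: "f x = i" if "b \<in> B" "x [^] E = k [^] (i::int) \<otimes> b" for x i b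
        unfolding f_def using that uniq by (intro the_equality) (blast, metis)
      have "f \<in> hom G integer_group"
      proof (rule homI)
        fix x y assume x: "x \<in> carrier G" and y: "y \<in> carrier G"
        obtain i b where ib: "b \<in> B" "x [^] E = k [^] (i::int) \<otimes> b" using ex[OF x] by blast
        obtain j c where jc: "c \<in> B" "y [^] E = k [^] (j::int) \<otimes> c" using ex[OF y] by blast
        have "(x \<otimes> y) [^] E = k [^] (i + j) \<otimes> (b \<otimes> c)"
          using x y k Bc[OF ib(1)] Bc[OF jc(1)] by (simp add: int_pow_distrib ib(2) jc(2) int_pow_mult m_ac)
        from fI[OF subgroup.m_closed[OF B ib(1) jc(1)] this]
        show "f (x \<otimes> y) = f x \<otimes>\<^bsub>integer_group\<^esub> f y" using fI[OF ib] fI[OF jc] by simp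
      qed simp
      moreover have "f k = E" using k by (intro fI[OF subgroup.one_closed[OF B]]) simp
      ultimately show ?thesis using k E(1) by force
    qed
  qed blast
qed

text \<open>Divide by the least positive value.\<close>

lemma (in group) surjective_integer_hom:
  assumes f: "f \<in> hom G integer_group" and x: "x \<in> carrier G" "f x \<noteq> 0"
  shows "\<exists>\<pi>\<in>hom G integer_group. \<exists>t\<in>carrier G. \<pi> t = 1"
proof -
  interpret f: group_hom G integer_group f
    by (intro group_hom.intro group_hom_axioms.intro is_group f) simp
  have "f (if f x > 0 then x else inv x) > 0" using x by auto
  then have "\<exists>c. \<exists>y\<in>carrier G. f y = int c \<and> c > 0"
    using x(1) by (intro exI[of _ "nat (f (if f x > 0 then x else inv x))"]
        bexI[of _ "if f x > 0 then x else inv x"]) auto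
  then have L: "\<exists>y\<in>carrier G. f y = int (LEAST c. \<exists>y\<in>carrier G. f y = int c \<and> c > 0) \<and>
      (LEAST c. \<exists>y\<in>carrier G. f y = int c \<and> c > 0) > 0" by (rule LeastI_ex)
  define c where "c = int (LEAST c. \<exists>y\<in>carrier G. f y = int c \<and> c > 0)"
  obtain y where y: "y \<in> carrier G" "f y = c" "c > 0" using L unfolding c_def by auto
  have dvd: "c dvd f z" if z: "z \<in> carrier G" for z
  proof (rule ccontr)
    assume nd: "\<not> c dvd f z"
    let ?w = "z \<otimes> y [^] (- (f z div c))"
    have w: "?w \<in> carrier G" "f ?w = f z mod c"
      using z y by (simp_all add: f.hom_int_pow minus_div_mult_eq_mod[symmetric])
    have pos: "f z mod c > 0" using nd y(3) by (simp add: dvd_eq_mod_eq_0 order_less_le)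
    have "(LEAST c. \<exists>y\<in>carrier G. f y = int c \<and> c > 0) \<le> nat (f z mod c)"
      using w pos by (intro Least_le bexI[of _ ?w]) auto
    then have "c \<le> f z mod c" using pos by (simp add: c_def)
    then show False using pos_mod_bound[OF y(3), of "f z"] by simp
  qed
  have hom: "(\<lambda>z. f z div c) \<in> hom G integer_group"
  proof (rule homI)
    fix u v assume u: "u \<in> carrier G" and v: "v \<in> carrier G"
    have "(f u + f v) div c = f u div c + f v div c"
      by (rule div_plus_div_distrib_dvd_left[OF dvd[OF u]])
    then show "f (u \<otimes> v) div c = (f u div c) \<otimes>\<^bsub>integer_group\<^esub> (f v div c)"
      using u v by simp
  qed simp
  have "f y div c = 1" using y by simp
  then show ?thesis by (intro bexI[OF _ hom] bexI[OF _ y(1)])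
qed

section \<open>Calculus of matched elements\<close>

context quotient_matching
begin

lemma finite_index_H:
  assumes "N \<in> finite_index_normal H"
  shows "subgroup N H" "N \<lhd> H" "d \<in> N \<Longrightarrow> d \<in> carrier H" "\<one>\<^bsub>H\<^esub> \<in> N"
    "d \<in> N \<Longrightarrow> d' \<in> N \<Longrightarrow> d \<otimes>\<^bsub>H\<^esub> d' \<in> N" "d \<in> N \<Longrightarrow> inv\<^bsub>H\<^esub> d \<in> N" "d \<in> N \<Longrightarrow> d [^]\<^bsub>H\<^esub> (i::int) \<in> N"
    "d \<in> N \<Longrightarrow> d [^]\<^bsub>H\<^esub> (k::nat) \<in> N"
proof -
  show s: "subgroup N H" and "N \<lhd> H" using assms by (auto intro: finite_index_normalD)
  show "d \<in> N \<Longrightarrow> d \<in> carrier H" by (rule subgroup.mem_carrier[OF s])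
  show "\<one>\<^bsub>H\<^esub> \<in> N" by (rule subgroup.one_closed[OF s])
  show "d \<in> N \<Longrightarrow> d' \<in> N \<Longrightarrow> d \<otimes>\<^bsub>H\<^esub> d' \<in> N" by (rule subgroup.m_closed[OF s])
  show "d \<in> N \<Longrightarrow> inv\<^bsub>H\<^esub> d \<in> N" by (rule subgroup.m_inv_closed[OF s])
  show i: "d \<in> N \<Longrightarrow> d [^]\<^bsub>H\<^esub> (i::int) \<in> N" for i by (rule H.subgroup_int_pow_closed[OF s])
  show "d \<in> N \<Longrightarrow> d [^]\<^bsub>H\<^esub> (k::nat) \<in> N" using i[of "int k"] by (simp add: int_pow_int)
qed

lemma appr_eqD:
  assumes "N \<in> finite_index_normal H" "appr N g d" "appr N g d'"
  shows "d' \<otimes>\<^bsub>H\<^esub> inv\<^bsub>H\<^esub> d \<in> N"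
  using appr_coset[OF assms(1,2)] assms(3) appr_closed by blast

lemma appr_one:
  assumes "N \<in> finite_index_normal H" shows "appr N \<one>\<^bsub>G\<^esub> \<one>\<^bsub>H\<^esub>"
proof -
  obtain d where d: "appr N \<one>\<^bsub>G\<^esub> d" using appr_total[OF assms] G.one_closed by blast
  have dc: "d \<in> carrier H" using appr_closed[OF d] by simp
  have "appr N (\<one>\<^bsub>G\<^esub> \<otimes>\<^bsub>G\<^esub> \<one>\<^bsub>G\<^esub>) (d \<otimes>\<^bsub>H\<^esub> d)" by (rule appr_mult[OF assms d d])
  then have "appr N \<one>\<^bsub>G\<^esub> (d \<otimes>\<^bsub>H\<^esub> d)" by simp
  from appr_eqD[OF assms d this] have "d \<in> N" using dc by (simp add: H.m_assoc)
  then have "\<one>\<^bsub>H\<^esub> \<otimes>\<^bsub>H\<^esub> inv\<^bsub>H\<^esub> d \<in> N" using finite_index_H[OF assms] dc by simp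
  then show ?thesis using appr_coset[OF assms d] by simp
qed

lemma appr_one_iff:
  assumes "N \<in> finite_index_normal H" "d \<in> carrier H"
  shows "appr N \<one>\<^bsub>G\<^esub> d \<longleftrightarrow> d \<in> N"
  using appr_coset[OF assms(1) appr_one[OF assms(1)] assms(2)] assms(2) by simp

lemma appr_inv:
  assumes N: "N \<in> finite_index_normal H" and "appr N g d"
  shows "appr N (inv\<^bsub>G\<^esub> g) (inv\<^bsub>H\<^esub> d)"
proof -
  have c: "g \<in> carrier G" "d \<in> carrier H" using appr_closed assms(2) by auto
  obtain d' where d': "appr N (inv\<^bsub>G\<^esub> g) d'" using appr_total[OF N] c by blast
  have c': "d' \<in> carrier H" using appr_closed d' by auto
  have "appr N (inv\<^bsub>G\<^esub> g \<otimes>\<^bsub>G\<^esub> g) (d' \<otimes>\<^bsub>H\<^esub> d)" by (rule appr_mult[OF N d' assms(2)])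
  then have "d' \<otimes>\<^bsub>H\<^esub> d \<in> N" using c c' by (simp add: appr_one_iff[OF N])
  then have "inv\<^bsub>H\<^esub> (d' \<otimes>\<^bsub>H\<^esub> d) \<in> N" by (rule finite_index_H(6)[OF N])
  then have "inv\<^bsub>H\<^esub> d \<otimes>\<^bsub>H\<^esub> inv\<^bsub>H\<^esub> d' \<in> N" using c c' by (simp add: H.inv_mult_group)
  then show ?thesis using appr_coset[OF N d'] c by simp
qed

lemma appr_nat_pow:
  assumes N: "N \<in> finite_index_normal H" and "appr N g d"
  shows "appr N (g [^]\<^bsub>G\<^esub> (k::nat)) (d [^]\<^bsub>H\<^esub> k)"
proof (induction k)
  case 0 then show ?case using appr_one[OF N] by simp
next
  case (Suc k) then show ?case using appr_mult[OF N Suc assms(2)] by simp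
qed

lemma appr_int_pow:
  assumes N: "N \<in> finite_index_normal H" and "appr N g d"
  shows "appr N (g [^]\<^bsub>G\<^esub> (k::int)) (d [^]\<^bsub>H\<^esub> k)"
proof (cases k rule: int_cases2)
  case (nonneg m)
  then show ?thesis using appr_nat_pow[OF assms, of m] by (simp add: int_pow_int)
next
  case (nonpos m)
  then show ?thesis
    using appr_inv[OF N appr_nat_pow[OF assms, of m]] appr_closed[OF assms(2)]
    by (simp add: G.int_pow_neg_int H.int_pow_neg_int)
qed

lemma appr_shift:
  assumes N: "N \<in> finite_index_normal H" and "appr N g d" "z \<in> N"
  shows "appr N g (z \<otimes>\<^bsub>H\<^esub> d)"
proof -
  have "appr N (\<one>\<^bsub>G\<^esub> \<otimes>\<^bsub>G\<^esub> g) (z \<otimes>\<^bsub>H\<^esub> d)"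
    using appr_one_iff[OF N] finite_index_H(3)[OF N] assms by (intro appr_mult[OF N]) blast+
  then show ?thesis using appr_closed[OF assms(2)] by simp
qed

lemma appr_shift_source:
  assumes N: "N \<in> finite_index_normal H" and "appr N g d" "appr N h \<one>\<^bsub>H\<^esub>"
  shows "appr N (g \<otimes>\<^bsub>G\<^esub> h) d" "appr N (h \<otimes>\<^bsub>G\<^esub> g) d"
  using appr_mult[OF N assms(2,3)] appr_mult[OF N assms(3,2)] appr_closed[OF assms(2)] by simp_all

lemma appr_IntD:
  assumes "N \<in> finite_index_normal H" "M \<in> finite_index_normal H" "appr (N \<inter> M) g d"
  shows "appr N g d" "appr M g d"
  using appr_mono[OF H.finite_index_normal_Int[OF assms(1,2)] assms(1) Int_lower1 assms(3)]
    appr_mono[OF H.finite_index_normal_Int[OF assms(1,2)] assms(2) Int_lower2 assms(3)] .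

text \<open>Otherwise the abelianisation of \<open>H\<close> has some exponent \<open>E\<close>. But an \<open>N\<close> whose matching kernel lies in
the elements of \<open>G\<close> of degree divisible by \<open>E + 1\<close> makes the cyclic group of order \<open>E + 1\<close> a quotient of \<open>H\<close>.\<close>

lemma integer_hom_transfer:
  assumes \<epsilon>: "\<epsilon> \<in> hom G integer_group" "T \<in> carrier G" "\<epsilon> T = 1"
    and fg: "finitely_generated_group H"
  shows "\<exists>\<pi>\<in>hom H integer_group. \<exists>t\<in>carrier H. \<pi> t = 1"
proof -
  interpret \<epsilon>: group_hom G integer_group \<epsilon>
    by (intro group_hom.intro group_hom_axioms.intro G.is_group \<epsilon>(1)) simp
  let ?D = "derived H (carrier H)"
  interpret D: normal ?D H by (rule H.derived_self_is_normal)
  interpret Q: comm_group "H Mod ?D" by (rule H.derived_quot_is_comm_group)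
  interpret q: group_hom H "H Mod ?D" "\<lambda>d. ?D #>\<^bsub>H\<^esub> d"
    by (intro group_hom.intro group_hom_axioms.intro H.is_group Q.is_group D.r_coset_hom_Mod)
  obtain S where S: "finite S" "S \<subseteq> carrier H" "generate H S = carrier H"
    using fg unfolding finitely_generated_group_def by blast
  let ?F = "(\<lambda>d. ?D #>\<^bsub>H\<^esub> d) ` S"
  have F: "finite ?F" "?F \<subseteq> carrier (H Mod ?D)" using S q.hom_closed by auto
  have gen: "carrier (H Mod ?D) \<subseteq> U" if U: "subgroup U (H Mod ?D)" "{\<one>\<^bsub>H Mod ?D\<^esub>} \<union> ?F \<subseteq> U" for U
  proof -
    have "carrier (H Mod ?D) = (\<lambda>d. ?D #>\<^bsub>H\<^esub> d) ` generate H S"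
      unfolding S(3) by (auto simp: carrier_FactGroup)
    also have "\<dots> = generate (H Mod ?D) ?F" using q.generate_img[OF S(2)] by simp
    also have "\<dots> \<subseteq> U" using Q.generate_subgroup_incl[OF _ U(1)] U(2) by blast
    finally show ?thesis .
  qed
  have "(\<exists>E>0. \<forall>x\<in>carrier (H Mod ?D). x [^]\<^bsub>H Mod ?D\<^esub> (E::int) \<in> {\<one>\<^bsub>H Mod ?D\<^esub>}) \<or>
    (\<exists>f\<in>hom (H Mod ?D) integer_group. \<exists>x\<in>carrier (H Mod ?D). f x \<noteq> 0)"
    by (rule Q.bounded_exponent_or_integer_hom[OF F Q.triv_subgroup gen])
  then show ?thesis
  proof
    assume "\<exists>f\<in>hom (H Mod ?D) integer_group. \<exists>x\<in>carrier (H Mod ?D). f x \<noteq> 0"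
    then obtain f x where f: "f \<in> hom (H Mod ?D) integer_group" "x \<in> carrier (H Mod ?D)" "f x \<noteq> 0" by blast
    obtain d where d: "d \<in> carrier H" "x = ?D #>\<^bsub>H\<^esub> d" using f(2) by (auto simp: carrier_FactGroup)
    have "f \<circ> (\<lambda>d. ?D #>\<^bsub>H\<^esub> d) \<in> hom H integer_group"
      by (rule hom_compose[OF D.r_coset_hom_Mod f(1)])
    from H.surjective_integer_hom[OF this d(1)] show ?thesis using f(3) d(2) by simp
  next
    assume "\<exists>E>0. \<forall>x\<in>carrier (H Mod ?D). x [^]\<^bsub>H Mod ?D\<^esub> (E::int) \<in> {\<one>\<^bsub>H Mod ?D\<^esub>}"
    then obtain E where E: "E > 0" "\<forall>x\<in>carrier (H Mod ?D). x [^]\<^bsub>H Mod ?D\<^esub> (E::int) \<in> {\<one>\<^bsub>H Mod ?D\<^esub>}"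
      by blast
    have ED: "d [^]\<^bsub>H\<^esub> E \<in> ?D" if d: "d \<in> carrier H" for d
    proof -
      have "?D #>\<^bsub>H\<^esub> (d [^]\<^bsub>H\<^esub> E) = ?D"
        using E(2) q.hom_int_pow[OF d, of E] q.hom_closed[OF d] by simp
      then show ?thesis using H.coset_join1 D.subgroup_axioms H.int_pow_closed[OF d] by blast
    qed
    let ?M = "{g \<in> carrier G. (E + 1) dvd \<epsilon> g}"
    have M: "?M \<in> finite_index_normal G"
      using E(1) by (intro integer_hom_finite_index[OF G.is_group \<epsilon>(1)]) simp
    then have sM: "subgroup ?M G" by (rule finite_index_normalD)
    obtain N where N: "N \<in> finite_index_normal H" "\<forall>g. appr N g \<one>\<^bsub>H\<^esub> \<longrightarrow> g \<in> ?M"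
      using appr_separates[OF M] by blast
    let ?W = "{d \<in> carrier H. \<exists>g\<in>?M. appr N g d}"
    have W: "subgroup ?W H"
    proof (rule H.subgroupI)
      show "?W \<subseteq> carrier H" by blast
      show "?W \<noteq> {}" using appr_one[OF N(1)] subgroup.one_closed[OF sM] H.one_closed by blast
      show "inv\<^bsub>H\<^esub> d \<in> ?W" if "d \<in> ?W" for d
        using that appr_inv[OF N(1)] subgroup.m_inv_closed[OF sM] H.inv_closed by blast
      show "d \<otimes>\<^bsub>H\<^esub> d' \<in> ?W" if "d \<in> ?W" "d' \<in> ?W" for d d'
        using that appr_mult[OF N(1)] subgroup.m_closed[OF sM] H.m_closed by blast
    qed
    have "derived_set H (carrier H) \<subseteq> ?W"
    proof
      fix w assume "w \<in> derived_set H (carrier H)"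
      then obtain d d' where d: "d \<in> carrier H" "d' \<in> carrier H"
        "w = d \<otimes>\<^bsub>H\<^esub> d' \<otimes>\<^bsub>H\<^esub> inv\<^bsub>H\<^esub> d \<otimes>\<^bsub>H\<^esub> inv\<^bsub>H\<^esub> d'" by blast
      obtain g g' where g: "appr N g d" "appr N g' d'" using appr_surj[OF N(1)] d by blast
      have gc: "g \<in> carrier G" "g' \<in> carrier G" using appr_closed g by auto
      let ?g = "g \<otimes>\<^bsub>G\<^esub> g' \<otimes>\<^bsub>G\<^esub> inv\<^bsub>G\<^esub> g \<otimes>\<^bsub>G\<^esub> inv\<^bsub>G\<^esub> g'"
      have "\<epsilon> ?g = 0" using gc by simp
      then have "?g \<in> ?M" using gc by simp
      moreover have "appr N ?g w" unfolding d(3) using g by (intro appr_mult[OF N(1)] appr_inv[OF N(1)])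
      ultimately show "w \<in> ?W" using d appr_closed by blast
    qed
    then have DW: "?D \<subseteq> ?W" unfolding derived_def by (rule H.generate_subgroup_incl[OF _ W])
    obtain \<beta> where \<beta>: "appr N T \<beta>" using appr_total[OF N(1) \<epsilon>(2)] by blast
    have "\<beta> [^]\<^bsub>H\<^esub> E \<in> ?W" using ED DW appr_closed[OF \<beta>] by blast
    then obtain g where g: "g \<in> ?M" "appr N g (\<beta> [^]\<^bsub>H\<^esub> E)" by blast
    have "appr N (T [^]\<^bsub>G\<^esub> E \<otimes>\<^bsub>G\<^esub> inv\<^bsub>G\<^esub> g) (\<beta> [^]\<^bsub>H\<^esub> E \<otimes>\<^bsub>H\<^esub> inv\<^bsub>H\<^esub> (\<beta> [^]\<^bsub>H\<^esub> E))"
      by (intro appr_mult[OF N(1)] appr_inv[OF N(1)] appr_int_pow[OF N(1) \<beta>] g(2))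
    then have "T [^]\<^bsub>G\<^esub> E \<otimes>\<^bsub>G\<^esub> inv\<^bsub>G\<^esub> g \<in> ?M" using N(2) appr_closed[OF \<beta>] by simp
    then have "(E + 1) dvd E - \<epsilon> g" using g(1) \<epsilon>(2,3) by (simp add: \<epsilon>.hom_int_pow)
    moreover have "(E + 1) dvd \<epsilon> g" using g(1) by blast
    ultimately have "(E + 1) dvd E" using dvd_add[of "E + 1" "E - \<epsilon> g" "\<epsilon> g"] by simp
    then show ?thesis using E(1) zdvd_imp_le[of "E + 1" E] by simp
  qed
qed

end

section \<open>A group with the finite quotients of a solvable Baumslag--Solitar group\<close>

text \<open>The group \<open>\<Delta>\<close> of the introduction is \<open>H\<close>, with its surjection \<open>\<pi>\<close> onto the integers.\<close>

locale bs_matching = baumslag_solitar n + quotient_matching "BS1 n" H appr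
  for n :: int and H :: "'b monoid" (structure) and appr +
  fixes \<pi> :: "'b \<Rightarrow> int" and t :: 'b
  assumes \<pi>_hom: "\<pi> \<in> hom H integer_group" and t [simp]: "t \<in> carrier H" and \<pi>_t [simp]: "\<pi> t = 1"
    and fg: "finitely_generated_group H" and rf: "residually_finite H"
begin

sublocale \<pi>: group_hom H integer_group \<pi>
  by (intro group_hom.intro group_hom_axioms.intro H.is_group \<pi>_hom) simp

definition K where "K = {d \<in> carrier H. \<pi> d = 0}"
definition layer where "layer j = {d \<in> carrier H. j dvd \<pi> d}"

lemma layer_finite_index: "j > 0 \<Longrightarrow> layer j \<in> finite_index_normal H"
  unfolding layer_def by (rule integer_hom_finite_index[OF H.is_group \<pi>_hom])

lemma K_subgroup: "subgroup K H"
  by (rule H.subgroupI) (auto simp: K_def intro: exI[of _ \<one>])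

lemma K_memD: "k \<in> K \<Longrightarrow> k \<in> carrier H" "k \<in> K \<Longrightarrow> \<pi> k = 0"
  by (simp_all add: K_def)

lemma residual_eq_one:
  assumes "d \<in> carrier H" "\<And>N. N \<in> finite_index_normal H \<Longrightarrow> d \<in> N" shows "d = \<one>"
  using assms rf unfolding residually_finite_def by blast

lemma appr_kernelI:
  assumes N: "N \<in> finite_index_normal H" and "appr N g d" "d \<in> N" shows "appr N g \<one>"
proof -
  have "\<one> \<otimes> inv d \<in> N" using finite_index_H[OF N] assms(3) by simp
  then show ?thesis using appr_coset[OF N assms(2)] by simp
qed

lemma appr_kernelD:
  assumes N: "N \<in> finite_index_normal H" and "appr N g d" "appr N g \<one>" shows "d \<in> N"
  using appr_eqD[OF N assms(3,2)] appr_closed[OF assms(2)] by simp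

text \<open>In a finite quotient the inverse of \<open>T\<close> is a power of \<open>T\<close>, so the denominator of the normal form can be
absorbed.\<close>

lemma appr_form:
  assumes N: "N \<in> finite_index_normal H" and d: "d \<in> carrier H"
  shows "\<exists>(v::nat) (i::int). appr N (T [^]\<^bsub>\<Gamma>\<^esub> v \<otimes>\<^bsub>\<Gamma>\<^esub> A [^]\<^bsub>\<Gamma>\<^esub> i) d"
proof -
  obtain g where g: "appr N g d" using appr_surj[OF N d] by blast
  have gc: "g \<in> carrier \<Gamma>" using appr_closed[OF g] by blast
  obtain p q :: nat and l :: int
    where eq: "g \<otimes>\<^bsub>\<Gamma>\<^esub> T [^]\<^bsub>\<Gamma>\<^esub> q = T [^]\<^bsub>\<Gamma>\<^esub> p \<otimes>\<^bsub>\<Gamma>\<^esub> A [^]\<^bsub>\<Gamma>\<^esub> l"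
    using normal_form[OF gc] by (elim exE) (rule that)
  obtain \<beta> where \<beta>: "appr N T \<beta>" using appr_total[OF N T_closed] by blast
  obtain J where J: "J > (0::nat)" "\<forall>d\<in>carrier H. d [^] J \<in> N"
    using H.finite_index_exponent[OF N] by blast
  have "appr N (T [^]\<^bsub>\<Gamma>\<^esub> J) \<one>"
    using appr_kernelI[OF N appr_nat_pow[OF N \<beta>]] J(2) appr_closed[OF \<beta>] by blast
  from appr_nat_pow[OF N this, of q] have "appr N (T [^]\<^bsub>\<Gamma>\<^esub> (J * q)) \<one>"
    by (simp add: \<Gamma>.nat_pow_pow)
  from appr_shift_source(1)[OF N g this] have "appr N (g \<otimes>\<^bsub>\<Gamma>\<^esub> T [^]\<^bsub>\<Gamma>\<^esub> (J * q)) d" .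
  moreover define r where "r = (J - 1) * q"
  have "J * q = q + r" using J(1) by (cases J) (simp_all add: r_def)
  then have "g \<otimes>\<^bsub>\<Gamma>\<^esub> T [^]\<^bsub>\<Gamma>\<^esub> (J * q) = (g \<otimes>\<^bsub>\<Gamma>\<^esub> T [^]\<^bsub>\<Gamma>\<^esub> q) \<otimes>\<^bsub>\<Gamma>\<^esub> T [^]\<^bsub>\<Gamma>\<^esub> r"
    using gc by (simp add: \<Gamma>.nat_pow_mult \<Gamma>.m_assoc)
  also have "\<dots> = T [^]\<^bsub>\<Gamma>\<^esub> p \<otimes>\<^bsub>\<Gamma>\<^esub> (A [^]\<^bsub>\<Gamma>\<^esub> l \<otimes>\<^bsub>\<Gamma>\<^esub> T [^]\<^bsub>\<Gamma>\<^esub> r)"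
    by (simp add: eq \<Gamma>.m_assoc)
  also have "\<dots> = T [^]\<^bsub>\<Gamma>\<^esub> (p + r) \<otimes>\<^bsub>\<Gamma>\<^esub> A [^]\<^bsub>\<Gamma>\<^esub> (l * n ^ r)"
    by (simp add: \<Gamma>.bs_relation_pow[OF A_closed T_closed bs_relation] \<Gamma>.m_assoc[symmetric] \<Gamma>.nat_pow_mult)
  ultimately show ?thesis by metis
qed

lemma decompose: "d \<in> carrier H \<Longrightarrow> d \<otimes> t [^] (- \<pi> d) \<in> K"
  by (simp add: K_def \<pi>.hom_int_pow)

definition stable where
  "stable L \<longleftrightarrow> subgroup L H \<and> L \<subseteq> K \<and> (\<forall>l\<in>L. inv t \<otimes> l \<otimes> t \<in> L \<and> t \<otimes> l \<otimes> inv t \<in> L)"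

lemma stable_K: "stable K"
  using K_subgroup by (auto simp: stable_def K_def)

lemma stable_conj:
  assumes L: "stable L" and l: "l \<in> L" shows "t [^] (i::int) \<otimes> l \<otimes> inv (t [^] i) \<in> L"
proof -
  have lc: "x \<in> carrier H" if "x \<in> L" for x using L that K_memD(1) by (auto simp: stable_def)
  have gen: "s [^] m \<otimes> l \<otimes> inv (s [^] m) \<in> L"
    if s: "s \<in> carrier H" "\<And>l. l \<in> L \<Longrightarrow> s \<otimes> l \<otimes> inv s \<in> L" for s and m :: nat
  proof (induction m)
    case 0 then show ?case using l lc by simp
  next
    case (Suc m)
    have "s [^] Suc m \<otimes> l \<otimes> inv (s [^] Suc m) = s \<otimes> (s [^] m \<otimes> l \<otimes> inv (s [^] m)) \<otimes> inv s"
      unfolding H.nat_pow_Suc2[OF s(1)] using s(1) lc[OF l] by (simp add: H.m_assoc H.inv_mult_group)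
    then show ?case using s(2)[OF Suc] by simp
  qed
  show ?thesis
  proof (cases i rule: int_cases2)
    case (nonneg m)
    then show ?thesis using gen[of t m] L by (simp add: int_pow_int stable_def)
  next
    case (nonpos m)
    then show ?thesis using gen[of "inv t" m] L
      by (simp add: H.int_pow_neg_int stable_def H.nat_pow_inv)
  qed
qed

text \<open>The semidirect product of \<open>L\<close> with the powers of \<open>t\<close>.\<close>

lemma stable_extend_subgroup:
  assumes L: "stable L" shows "subgroup {l \<otimes> t [^] (i::int) | l i. l \<in> L} H" (is "subgroup ?T H")
proof -
  have s: "subgroup L H" using L by (simp add: stable_def)
  note lc = subgroup.mem_carrier[OF s]
  show ?thesis
  proof (rule H.subgroupI)
    show "?T \<subseteq> carrier H" using lc by auto
    show "?T \<noteq> {}" using subgroup.one_closed[OF s] by blast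
    show "inv x \<in> ?T" if x: "x \<in> ?T" for x
    proof -
      obtain l i where l: "l \<in> L" "x = l \<otimes> t [^] (i::int)" using x by blast
      have "inv x = (t [^] (- i) \<otimes> inv l \<otimes> inv (t [^] (- i))) \<otimes> t [^] (- i)"
        using lc[OF l(1)] by (simp add: l(2) H.inv_mult_group H.int_pow_neg H.m_assoc)
      then show ?thesis using stable_conj[OF L subgroup.m_inv_closed[OF s l(1)]] by blast
    qed
    show "x \<otimes> y \<in> ?T" if xy: "x \<in> ?T" "y \<in> ?T" for x y
    proof -
      obtain l i where l: "l \<in> L" "x = l \<otimes> t [^] (i::int)" using xy by blast
      obtain m j where m: "m \<in> L" "y = m \<otimes> t [^] (j::int)" using xy by blast
      have "inv (t [^] i) \<otimes> (t [^] i \<otimes> t [^] j) = t [^] j" by (simp add: H.m_assoc[symmetric])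
      then have "x \<otimes> y = (l \<otimes> (t [^] i \<otimes> m \<otimes> inv (t [^] i))) \<otimes> t [^] (i + j)"
        using lc[OF l(1)] lc[OF m(1)] by (simp add: l(2) m(2) H.m_assoc H.int_pow_mult)
      then show ?thesis using subgroup.m_closed[OF s l(1) stable_conj[OF L m(1)]] by blast
    qed
  qed
qed

lemma stable_extend_Int_K:
  assumes L: "stable L" and k: "k \<in> K" "k \<in> {l \<otimes> t [^] (i::int) | l i. l \<in> L}" shows "k \<in> L"
proof -
  obtain l i where l: "l \<in> L" "k = l \<otimes> t [^] (i::int)" using k(2) by blast
  have lK: "l \<in> carrier H" "\<pi> l = 0" using l(1) L K_memD by (auto simp: stable_def)
  have "\<pi> k = i" using lK by (simp add: l(2) \<pi>.hom_int_pow)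
  then show ?thesis using l lK K_memD(2)[OF k(1)] by simp
qed

lemma stable_generates:
  assumes "stable L" and "K \<subseteq> L" and "subgroup S H" "L \<subseteq> S" "t \<in> S" shows "carrier H \<subseteq> S"
proof
  fix d assume d: "d \<in> carrier H"
  have "d = (d \<otimes> t [^] (- \<pi> d)) \<otimes> t [^] \<pi> d"
    using d by (simp add: H.m_assoc H.int_pow_neg)
  moreover have "d \<otimes> t [^] (- \<pi> d) \<in> S" using decompose[OF d] assms by blast
  moreover have "t [^] \<pi> d \<in> S" using H.subgroup_int_pow_closed[OF assms(3,5)] .
  ultimately show "d \<in> S" using subgroup.m_closed[OF assms(3)] by metis
qed

text \<open>The components in \<open>K\<close> of generators of \<open>H\<close>, together with their conjugates by powers of \<open>t\<close>, generate \<open>K\<close>.\<close>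

lemma K_finitely_generated:
  obtains F where "finite F" "F \<subseteq> K" "\<forall>L. stable L \<longrightarrow> F \<subseteq> L \<longrightarrow> K \<subseteq> L"
proof -
  obtain S where S: "finite S" "S \<subseteq> carrier H" "generate H S = carrier H"
    using fg unfolding finitely_generated_group_def by blast
  define F where "F = (\<lambda>d. d \<otimes> t [^] (- \<pi> d)) ` S"
  have "K \<subseteq> L" if L: "stable L" "F \<subseteq> L" for L
  proof -
    let ?T = "{l \<otimes> t [^] (i::int) | l i. l \<in> L}"
    have ST: "S \<subseteq> ?T"
    proof
      fix s assume s: "s \<in> S"
      then have "s = (s \<otimes> t [^] (- \<pi> s)) \<otimes> t [^] \<pi> s"
        using S(2) by (simp add: H.m_assoc H.int_pow_neg subset_iff)
      moreover have "s \<otimes> t [^] (- \<pi> s) \<in> L" using s L(2) by (auto simp: F_def)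
      ultimately show "s \<in> ?T" by blast
    qed
    have "carrier H \<subseteq> ?T"
      using H.generate_subgroup_incl[OF ST stable_extend_subgroup[OF L(1)]] unfolding S(3) .
    then show ?thesis using stable_extend_Int_K[OF L(1)] K_memD(1) by blast
  qed
  moreover have "finite F" "F \<subseteq> K" using S decompose by (auto simp: F_def)
  ultimately show ?thesis using that by blast
qed

abbreviation "KG \<equiv> H\<lparr>carrier := K\<rparr>"

lemma KG_comm_groupI:
  assumes "\<And>k k'. k \<in> K \<Longrightarrow> k' \<in> K \<Longrightarrow> k \<otimes> k' = k' \<otimes> k" shows "comm_group KG"
proof -
  interpret KG: group KG by (rule subgroup.subgroup_is_group[OF K_subgroup H.is_group])
  show ?thesis by (rule KG.group_comm_groupI) (simp add: assms)
qed

lemma KG_pow: "k \<in> K \<Longrightarrow> k [^]\<^bsub>KG\<^esub> (i::int) = k [^] i"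
  using H.int_pow_consistent[OF K_subgroup] by simp

lemma KG_subgroup_iff: "subgroup L KG \<longleftrightarrow> subgroup L H \<and> L \<subseteq> K"
proof
  assume "subgroup L KG"
  then show "subgroup L H \<and> L \<subseteq> K"
    using H.incl_subgroup[OF K_subgroup] subgroup.subset by fastforce
next
  assume "subgroup L H \<and> L \<subseteq> K"
  then show "subgroup L KG" using H.subgroup_incl[OF _ K_subgroup] by blast
qed

text \<open>The order of the image of \<open>A\<close> is coprime to \<open>n\<close>, because \<open>A\<close> and \<open>A^n\<close> are conjugate.\<close>

lemma order_of_A:
  assumes N: "N \<in> finite_index_normal H"
  shows "\<exists>m>0. coprime m n \<and> (\<forall>i::int. appr N (A [^]\<^bsub>\<Gamma>\<^esub> i) \<one> \<longleftrightarrow> m dvd i)"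
proof -
  define I where "I = {i::int. appr N (A [^]\<^bsub>\<Gamma>\<^esub> i) \<one>}"
  have I_lin: "u * i + v * j \<in> I" if "i \<in> I" "j \<in> I" for u v i j
  proof -
    have "appr N ((A [^]\<^bsub>\<Gamma>\<^esub> i) [^]\<^bsub>\<Gamma>\<^esub> u \<otimes>\<^bsub>\<Gamma>\<^esub> (A [^]\<^bsub>\<Gamma>\<^esub> j) [^]\<^bsub>\<Gamma>\<^esub> v) (\<one> [^] u \<otimes> \<one> [^] v)"
      using that by (intro appr_mult[OF N] appr_int_pow[OF N]) (simp_all add: I_def)
    then show ?thesis by (simp add: I_def \<Gamma>.int_pow_pow \<Gamma>.int_pow_mult mult.commute)
  qed
  obtain \<alpha> where \<alpha>: "appr N A \<alpha>" using appr_total[OF N A_closed] by blast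
  obtain \<beta> where \<beta>: "appr N T \<beta>" using appr_total[OF N T_closed] by blast
  have \<beta>c: "\<beta> \<in> carrier H" using appr_closed[OF \<beta>] by simp
  obtain J where J: "J > (0::nat)" "\<forall>d\<in>carrier H. d [^] J \<in> N"
    using H.finite_index_exponent[OF N] by blast
  have "appr N (A [^]\<^bsub>\<Gamma>\<^esub> J) \<one>"
    using appr_kernelI[OF N appr_nat_pow[OF N \<alpha>]] J(2) appr_closed[OF \<alpha>] by blast
  then have "int J \<in> I" by (simp add: I_def int_pow_int)
  then have ex: "\<exists>m::nat. m > 0 \<and> int m \<in> I" using J(1) by blast
  define m where "m = int (LEAST m::nat. m > 0 \<and> int m \<in> I)"
  have m: "m > 0" "m \<in> I" using LeastI_ex[OF ex] by (simp_all add: m_def)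
  have m_least: "m \<le> i" if "i > 0" "i \<in> I" for i
    using Least_le[of "\<lambda>m::nat. m > 0 \<and> int m \<in> I" "nat i"] that by (simp add: m_def)
  have dvd: "i \<in> I \<longleftrightarrow> m dvd i" for i
  proof
    assume i: "i \<in> I"
    have "i mod m = 1 * i + (- (i div m)) * m" by (simp add: minus_div_mult_eq_mod[symmetric])
    then have "i mod m \<in> I" using I_lin[OF i m(2)] by metis
    moreover have "i mod m < m" using m(1) by simp
    ultimately have "\<not> i mod m > 0" using m_least by fastforce
    then show "m dvd i" using m(1) by (simp add: dvd_eq_mod_eq_0 order_less_le)
  next
    assume "m dvd i"
    then obtain j where "i = m * j" by (rule dvdE)
    then show "i \<in> I" using I_lin[OF m(2) m(2), of j 0] by (simp add: mult.commute)
  qed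
  have n_cancel: "i \<in> I" if ni: "n * i \<in> I" for i
  proof -
    have "A [^]\<^bsub>\<Gamma>\<^esub> (n * i) = inv\<^bsub>\<Gamma>\<^esub> T \<otimes>\<^bsub>\<Gamma>\<^esub> A [^]\<^bsub>\<Gamma>\<^esub> i \<otimes>\<^bsub>\<Gamma>\<^esub> T"
      by (simp add: \<Gamma>.conj_int_pow bs_relation \<Gamma>.int_pow_pow)
    then have "T \<otimes>\<^bsub>\<Gamma>\<^esub> A [^]\<^bsub>\<Gamma>\<^esub> (n * i) \<otimes>\<^bsub>\<Gamma>\<^esub> inv\<^bsub>\<Gamma>\<^esub> T = (T \<otimes>\<^bsub>\<Gamma>\<^esub> inv\<^bsub>\<Gamma>\<^esub> T) \<otimes>\<^bsub>\<Gamma>\<^esub> A [^]\<^bsub>\<Gamma>\<^esub> i \<otimes>\<^bsub>\<Gamma>\<^esub> (T \<otimes>\<^bsub>\<Gamma>\<^esub> inv\<^bsub>\<Gamma>\<^esub> T)"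
      by (simp only: \<Gamma>.m_assoc \<Gamma>.m_closed \<Gamma>.inv_closed T_closed A_closed \<Gamma>.int_pow_closed)
    moreover have "appr N (T \<otimes>\<^bsub>\<Gamma>\<^esub> A [^]\<^bsub>\<Gamma>\<^esub> (n * i) \<otimes>\<^bsub>\<Gamma>\<^esub> inv\<^bsub>\<Gamma>\<^esub> T) (\<beta> \<otimes> \<one> \<otimes> inv \<beta>)"
      using ni by (intro appr_mult[OF N] appr_inv[OF N] \<beta>) (simp add: I_def)
    ultimately show ?thesis using \<beta>c by (simp add: I_def)
  qed
  have "coprime m n"
  proof (rule coprimeI)
    fix d assume d: "d dvd m" "d dvd n"
    obtain m' where m': "m = d * m'" using d(1) by (rule dvdE)
    obtain n' where "n = d * n'" using d(2) by (rule dvdE)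
    then have "n * m' = m * n'" using m' by simp
    then have "n * m' \<in> I" using dvd by simp
    then have "m dvd m'" using n_cancel dvd by blast
    then have "d * m' dvd 1 * m'" using m' by simp
    moreover have "m' \<noteq> 0" using m(1) m' by auto
    ultimately show "is_unit d" by simp
  qed
  then show ?thesis using m(1) dvd unfolding I_def by blast
qed

text \<open>Conversely, every \<open>m\<close> coprime to \<open>n\<close> divides the order of the image of \<open>A\<close> in some finite quotient of \<open>H\<close>.\<close>

lemma A_powers_separated:
  assumes "m > 0" "coprime m n"
  obtains N where "N \<in> finite_index_normal H" "\<forall>i::int. appr N (A [^]\<^bsub>\<Gamma>\<^esub> i) \<one> \<longrightarrow> m dvd i"
proof -
  obtain M where M: "M \<in> finite_index_normal \<Gamma>" "\<forall>k::int. A [^]\<^bsub>\<Gamma>\<^esub> k \<in> M \<longrightarrow> m dvd k"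
    using cyclic_finite_quotient[OF assms] by blast
  show ?thesis using appr_separates[OF M(1)] M(2) that by blast
qed

end

locale bs_matching_nonabelian = bs_matching +
  assumes n_not_1: "n \<noteq> 1"
begin

text \<open>The image of \<open>A\<close> in the profinite completion of the integers is killed by \<open>n - 1\<close>, and that group is
torsion-free. At finite level one has to start from the modulus \<open>j \<bar>n - 1\<bar>\<close> to conclude modulo \<open>j\<close>.\<close>

lemma A_degree:
  assumes j: "j > 0" and \<alpha>: "appr (layer j) A \<alpha>" shows "j dvd \<pi> \<alpha>"
proof -
  let ?j = "j * \<bar>n - 1\<bar>"
  have j': "?j > 0" using j n_not_1 by simp
  note N = layer_finite_index[OF j']
  obtain \<alpha>' where \<alpha>': "appr (layer ?j) A \<alpha>'" using appr_total[OF N A_closed] by blast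
  obtain \<beta> where \<beta>: "appr (layer ?j) T \<beta>" using appr_total[OF N T_closed] by blast
  have c: "\<alpha>' \<in> carrier H" "\<beta> \<in> carrier H" "\<alpha> \<in> carrier H" using appr_closed \<alpha>' \<beta> \<alpha> by auto
  have "appr (layer ?j) (inv\<^bsub>\<Gamma>\<^esub> T \<otimes>\<^bsub>\<Gamma>\<^esub> A \<otimes>\<^bsub>\<Gamma>\<^esub> T) (inv \<beta> \<otimes> \<alpha>' \<otimes> \<beta>)"
    by (intro appr_mult[OF N] appr_inv[OF N] \<alpha>' \<beta>)
  moreover have "appr (layer ?j) (inv\<^bsub>\<Gamma>\<^esub> T \<otimes>\<^bsub>\<Gamma>\<^esub> A \<otimes>\<^bsub>\<Gamma>\<^esub> T) (\<alpha>' [^] n)"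
    unfolding bs_relation by (rule appr_int_pow[OF N \<alpha>'])
  ultimately have "\<alpha>' [^] n \<otimes> inv (inv \<beta> \<otimes> \<alpha>' \<otimes> \<beta>) \<in> layer ?j" by (rule appr_eqD[OF N])
  then have "?j dvd n * \<pi> \<alpha>' - \<pi> \<alpha>'" using c by (simp add: layer_def \<pi>.hom_int_pow mult.commute)
  also have "n * \<pi> \<alpha>' - \<pi> \<alpha>' = \<pi> \<alpha>' * (n - 1)" by (simp add: algebra_simps)
  finally have "j * \<bar>n - 1\<bar> dvd \<pi> \<alpha>' * (n - 1)" .
  then have "\<bar>j * (n - 1)\<bar> dvd \<pi> \<alpha>' * (n - 1)" using j by (simp add: abs_mult)
  then have "j dvd \<pi> \<alpha>'" using n_not_1 by simp
  moreover have "layer ?j \<subseteq> layer j" by (auto simp: layer_def intro: dvd_mult_left)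
  from appr_mono[OF N layer_finite_index[OF j] this \<alpha>'] have "appr (layer j) A \<alpha>'" .
  from appr_eqD[OF layer_finite_index[OF j] this \<alpha>] have "j dvd \<pi> \<alpha> - \<pi> \<alpha>'"
    using c by (simp add: layer_def)
  ultimately show ?thesis using dvd_add[of j "\<pi> \<alpha> - \<pi> \<alpha>'" "\<pi> \<alpha>'"] by simp
qed

text \<open>For an exponent \<open>J\<close> of \<open>H/N\<close>, the degree of a representative that is also good modulo \<open>layer J\<close> is a multiple
of \<open>J\<close>; multiplication by a power of \<open>t^J\<close>, an element of \<open>N\<close>, corrects it to zero.\<close>

lemma A_matched_in_K:
  assumes N: "N \<in> finite_index_normal H" shows "\<exists>\<alpha>\<in>K. appr N A \<alpha>"
proof -
  obtain J where J: "J > (0::nat)" "\<forall>d\<in>carrier H. d [^] J \<in> N"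
    using H.finite_index_exponent[OF N] by blast
  have J': "int J > 0" using J(1) by simp
  note N' = H.finite_index_normal_Int[OF N layer_finite_index[OF J']]
  obtain \<alpha> where \<alpha>: "appr (N \<inter> layer (int J)) A \<alpha>" using appr_total[OF N' A_closed] by blast
  note \<alpha>' = appr_IntD[OF N layer_finite_index[OF J'] \<alpha>]
  have \<alpha>c: "\<alpha> \<in> carrier H" using appr_closed[OF \<alpha>] by simp
  obtain i where i: "\<pi> \<alpha> = int J * i" using A_degree[OF J' \<alpha>'(2)] by (rule dvdE)
  have "(t [^] J) [^] (- i) = t [^] (int J * (- i))"
    by (simp only: H.int_pow_pow[OF t, symmetric] int_pow_int)
  then have z: "t [^] (int J * (- i)) \<in> N"
    using finite_index_H(7)[OF N, of "t [^] J" "- i"] J(2) t by metis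
  have "appr N A (t [^] (int J * (- i)) \<otimes> \<alpha>)" by (rule appr_shift[OF N \<alpha>'(1) z])
  moreover have "t [^] (int J * (- i)) \<otimes> \<alpha> \<in> K" using \<alpha>c i by (simp add: K_def \<pi>.hom_int_pow)
  ultimately show ?thesis by blast
qed

text \<open>Let \<open>J\<close> be an exponent of \<open>H/N\<close>. The degree of a representative of \<open>T\<close> is a unit modulo \<open>J\<close>, because some
\<open>T^v' A^i'\<close> represents \<open>t\<close>. So if \<open>T^v A^i\<close> represents an element of degree zero, then \<open>J\<close> divides \<open>v\<close> and \<open>T^v\<close>
is trivial modulo \<open>N\<close>.\<close>

lemma K_matched_by_A:
  assumes N: "N \<in> finite_index_normal H" and k: "k \<in> K" shows "\<exists>i::int. appr N (A [^]\<^bsub>\<Gamma>\<^esub> i) k"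
proof -
  obtain J where J: "J > (0::nat)" "\<forall>d\<in>carrier H. d [^] J \<in> N"
    using H.finite_index_exponent[OF N] by blast
  have J': "int J > 0" using J(1) by simp
  note lay = layer_finite_index[OF J']
  note N' = H.finite_index_normal_Int[OF N lay]
  have kc: "k \<in> carrier H" "\<pi> k = 0" using K_memD[OF k] by auto
  obtain v i where vi: "appr (N \<inter> layer (int J)) (T [^]\<^bsub>\<Gamma>\<^esub> (v::nat) \<otimes>\<^bsub>\<Gamma>\<^esub> A [^]\<^bsub>\<Gamma>\<^esub> (i::int)) k"
    using appr_form[OF N' kc(1)] by blast
  obtain v' i' where vi': "appr (N \<inter> layer (int J)) (T [^]\<^bsub>\<Gamma>\<^esub> (v'::nat) \<otimes>\<^bsub>\<Gamma>\<^esub> A [^]\<^bsub>\<Gamma>\<^esub> (i'::int)) t"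
    using appr_form[OF N' t] by blast
  obtain \<alpha> where \<alpha>: "\<alpha> \<in> K" "appr (N \<inter> layer (int J)) A \<alpha>" using A_matched_in_K[OF N'] by blast
  obtain \<beta> where \<beta>: "appr (N \<inter> layer (int J)) T \<beta>" using appr_total[OF N' T_closed] by blast
  have c: "\<alpha> \<in> carrier H" "\<pi> \<alpha> = 0" "\<beta> \<in> carrier H" using K_memD[OF \<alpha>(1)] appr_closed[OF \<beta>] by auto
  have ap: "appr (layer (int J)) (T [^]\<^bsub>\<Gamma>\<^esub> (v::nat) \<otimes>\<^bsub>\<Gamma>\<^esub> A [^]\<^bsub>\<Gamma>\<^esub> (i::int)) (\<beta> [^] v \<otimes> \<alpha> [^] i)" for v i
    using appr_IntD(2)[OF N lay] \<alpha>(2) \<beta> by (intro appr_mult[OF lay] appr_nat_pow[OF lay] appr_int_pow[OF lay])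
  have J1: "int J dvd \<pi> d - int v * \<pi> \<beta>"
    if "d \<in> carrier H" "appr (N \<inter> layer (int J)) (T [^]\<^bsub>\<Gamma>\<^esub> (v::nat) \<otimes>\<^bsub>\<Gamma>\<^esub> A [^]\<^bsub>\<Gamma>\<^esub> (i::int)) d" for d v i
  proof -
    have "d \<otimes> inv (\<beta> [^] v \<otimes> \<alpha> [^] i) \<in> layer (int J)"
      using appr_eqD[OF lay ap appr_IntD(2)[OF N lay that(2)]] .
    then show ?thesis
      using that(1) c by (simp add: layer_def \<pi>.hom_int_pow \<pi>.hom_nat_pow)
  qed
  have "int J dvd int v * \<pi> \<beta>" using J1[OF kc(1) vi] kc(2) by simp
  moreover have "int J dvd 1 - int v' * \<pi> \<beta>" using J1[OF t vi'] by simp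
  ultimately have "int J dvd int v' * (int v * \<pi> \<beta>) + int v * (1 - int v' * \<pi> \<beta>)"
    by (rule dvd_add[OF dvd_mult dvd_mult])
  also have "int v' * (int v * \<pi> \<beta>) + int v * (1 - int v' * \<pi> \<beta>) = int v" by (simp add: algebra_simps)
  finally obtain w where w: "v = J * w" by (auto elim: dvdE)
  have "\<beta> [^] v \<in> N"
    using finite_index_H(8)[OF N, of "\<beta> [^] J" w] J(2) c(3) by (simp add: w H.nat_pow_pow)
  then have "appr N (T [^]\<^bsub>\<Gamma>\<^esub> v) \<one>"
    using appr_kernelI[OF N appr_nat_pow[OF N appr_IntD(1)[OF N lay \<beta>]]] by blast
  from appr_inv[OF N this] have "appr N (inv\<^bsub>\<Gamma>\<^esub> (T [^]\<^bsub>\<Gamma>\<^esub> v)) \<one>" by simp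
  from appr_shift_source(2)[OF N appr_IntD(1)[OF N lay vi] this]
  have "appr N (A [^]\<^bsub>\<Gamma>\<^esub> i) k" by (simp add: \<Gamma>.m_assoc[symmetric])
  then show ?thesis by blast
qed

lemma K_commutes:
  assumes k: "k \<in> K" "k' \<in> K" shows "k \<otimes> k' = k' \<otimes> k"
proof -
  have c: "k \<in> carrier H" "k' \<in> carrier H" using k K_memD by auto
  have "(k \<otimes> k') \<otimes> inv (k' \<otimes> k) = \<one>"
  proof (rule residual_eq_one)
    fix N assume N: "N \<in> finite_index_normal H"
    obtain i where i: "appr N (A [^]\<^bsub>\<Gamma>\<^esub> (i::int)) k" using K_matched_by_A[OF N k(1)] by blast
    obtain i' where i': "appr N (A [^]\<^bsub>\<Gamma>\<^esub> (i'::int)) k'" using K_matched_by_A[OF N k(2)] by blast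
    have "appr N (A [^]\<^bsub>\<Gamma>\<^esub> (i + i')) (k \<otimes> k')" "appr N (A [^]\<^bsub>\<Gamma>\<^esub> (i + i')) (k' \<otimes> k)"
      using appr_mult[OF N i i'] appr_mult[OF N i' i] by (simp_all add: \<Gamma>.int_pow_mult[symmetric] add.commute)
    then show "(k \<otimes> k') \<otimes> inv (k' \<otimes> k) \<in> N" using appr_eqD[OF N] by blast
  qed (use c in simp)
  then show ?thesis using H.div_eq_one_iff c by simp
qed

text \<open>If \<open>k\<close> of prime order \<open>q\<close> is not in \<open>N\<close>, then \<open>q\<close> divides the order \<open>m\<close> of \<open>A\<close> modulo \<open>N\<close> and is therefore
coprime to \<open>n\<close>. In a finer quotient in which the order of \<open>A\<close> is divisible by \<open>q m\<close>, the relation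
\<open>k^q = 1\<close> forces \<open>k\<close> to be matched by a power of \<open>A^m\<close>, which is trivial modulo \<open>N\<close>.\<close>

lemma K_prime_torsion_free:
  assumes k: "k \<in> K" and q: "Factorial_Ring.prime (q::int)" and kq: "k [^] q = \<one>" shows "k = \<one>"
proof (rule residual_eq_one)
  show kc: "k \<in> carrier H" using K_memD[OF k] by simp
  fix N assume N: "N \<in> finite_index_normal H"
  show "k \<in> N"
  proof (rule ccontr)
    assume "k \<notin> N"
    obtain i where i: "appr N (A [^]\<^bsub>\<Gamma>\<^esub> (i::int)) k" using K_matched_by_A[OF N k] by blast
    obtain m where m: "m > 0" "coprime m n" "\<forall>i::int. appr N (A [^]\<^bsub>\<Gamma>\<^esub> i) \<one> \<longleftrightarrow> m dvd i"
      using order_of_A[OF N] by blast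
    have ni: "\<not> m dvd i" using m(3) appr_kernelD[OF N i] \<open>k \<notin> N\<close> by blast
    have "appr N ((A [^]\<^bsub>\<Gamma>\<^esub> i) [^]\<^bsub>\<Gamma>\<^esub> q) (k [^] q)" by (rule appr_int_pow[OF N i])
    then have "m dvd i * q" using m(3) by (simp add: kq \<Gamma>.int_pow_pow)
    then have "\<not> coprime q m" using ni by (metis coprime_commute coprime_dvd_mult_left_iff)
    then have qm: "q dvd m" using q prime_imp_coprime by blast
    have q0: "q > 0" using q by (rule prime_gt_0_int)
    have "coprime (q * m) n" using m(2) qm by (meson coprime_divisors coprime_mult_left_iff dvd_refl)
    moreover have "q * m > 0" using q0 m(1) by simp
    ultimately obtain N1 where N1: "N1 \<in> finite_index_normal H"
      "\<forall>i::int. appr N1 (A [^]\<^bsub>\<Gamma>\<^esub> i) \<one> \<longrightarrow> q * m dvd i"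
      using A_powers_separated by blast
    note N2 = H.finite_index_normal_Int[OF N N1(1)]
    obtain j where j: "appr (N \<inter> N1) (A [^]\<^bsub>\<Gamma>\<^esub> (j::int)) k" using K_matched_by_A[OF N2 k] by blast
    note j' = appr_IntD[OF N N1(1) j]
    have "appr N1 ((A [^]\<^bsub>\<Gamma>\<^esub> j) [^]\<^bsub>\<Gamma>\<^esub> q) (k [^] q)" by (rule appr_int_pow[OF N1(1) j'(2)])
    then have "q * m dvd j * q" using N1(2) by (simp add: kq \<Gamma>.int_pow_pow)
    then have "m dvd j" using q0 by (simp add: mult.commute)
    then have "appr N (A [^]\<^bsub>\<Gamma>\<^esub> j) \<one>" using m(3) by blast
    then show False using appr_kernelD[OF N j'(1)] \<open>k \<notin> N\<close> by blast
  qed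
qed

lemma K_torsion_free:
  assumes k: "k \<in> K" and m: "m \<noteq> (0::int)" and km: "k [^] m = \<one>" shows "k = \<one>"
proof -
  have kc: "k \<in> carrier H" using K_memD[OF k] by simp
  have "y = \<one>" if "y \<in> K" "y [^] int m = \<one>" "m > 0" for m :: nat and y
    using that
  proof (induction m arbitrary: y rule: less_induct)
    case (less m)
    have yc: "y \<in> carrier H" using K_memD less.prems(1) by blast
    show ?case
    proof (cases "m = 1")
      case True then show ?thesis using less.prems yc by simp
    next
      case False
      then obtain q where q: "Factorial_Ring.prime q" "q dvd m" using prime_factor_nat by blast
      then obtain m' where m': "m = q * m'" by (auto elim: dvdE)
      have m'0: "0 < m'" "m' < m" using less.prems(3) m' prime_gt_1_nat[OF q(1)] by auto
      have "(y [^] int m') [^] int q = \<one>"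
        using less.prems(2) yc by (simp add: H.int_pow_pow m' mult.commute)
      moreover have "y [^] int m' \<in> K" using H.subgroup_int_pow_closed[OF K_subgroup less.prems(1)] .
      moreover have "Factorial_Ring.prime (int q)" using q(1) by simp
      ultimately have "y [^] int m' = \<one>" using K_prime_torsion_free by blast
      then show ?thesis using less.IH[OF m'0(2) less.prems(1)] m'0(1) by blast
    qed
  qed
  note pos = this
  show ?thesis
  proof (cases "m > 0")
    case True
    then show ?thesis using pos[OF k, of "nat m"] km by simp
  next
    case False
    then have "k [^] (- m) = \<one>" using km kc by (simp add: H.int_pow_neg)
    then show ?thesis using pos[OF k, of "nat (- m)"] m False by simp
  qed
qed

text \<open>The subgroup of \<open>H\<close> generated by \<open>L\<close> and \<open>t\<close> has finite index and meets \<open>K\<close> in \<open>L\<close>. A normal subgroup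
\<open>N\<close> of finite index inside it makes \<open>K/L\<close> a quotient of the image of \<open>K\<close> in \<open>H/N\<close>, which is
generated by the image of \<open>A\<close>.\<close>

lemma stable_quotient_cyclic:
  assumes L: "stable L" and R: "finite R" "R \<subseteq> K" "\<forall>y\<in>K. \<exists>r\<in>R. \<exists>l\<in>L. y = r \<otimes> l"
  shows "\<exists>e\<in>K. \<exists>m>0. coprime m n \<and> e [^] (m::int) \<in> L \<and> (\<forall>y\<in>K. \<exists>i::int. \<exists>l\<in>L. y = e [^] i \<otimes> l)"
proof -
  let ?T = "{l \<otimes> t [^] (i::int) | l i. l \<in> L}"
  have LK: "L \<subseteq> K" and sL: "subgroup L H" using L by (auto simp: stable_def)
  note sT = stable_extend_subgroup[OF L]
  have L_T: "l \<in> ?T" if "l \<in> L" for l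
  proof -
    have "l = l \<otimes> t [^] (0::int)" using subgroup.mem_carrier[OF sL that] by simp
    then show ?thesis using that by blast
  qed
  have t_T: "t [^] i \<in> ?T" for i :: int
  proof -
    have "t [^] i = \<one> \<otimes> t [^] i" by simp
    then show ?thesis using subgroup.one_closed[OF sL] by blast
  qed
  have "\<exists>s\<in>?T. \<exists>r\<in>R. g = s \<otimes> r" if g: "g \<in> carrier H" for g
  proof -
    let ?k = "t [^] (- \<pi> g) \<otimes> g"
    have "?k \<in> K" using g by (simp add: K_def \<pi>.hom_int_pow)
    from bspec[OF R(3) this] obtain r l where rl: "r \<in> R" "l \<in> L" "?k = r \<otimes> l" by blast
    have c: "r \<in> carrier H" "l \<in> carrier H" using rl(1,2) R(2) LK K_memD(1) by blast+
    have "g = t [^] \<pi> g \<otimes> ?k" using g by (simp add: H.m_assoc[symmetric] H.int_pow_mult[symmetric])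
    also have "?k = l \<otimes> r" using rl K_commutes R(2) LK by (metis subsetD)
    finally have "g = (t [^] \<pi> g \<otimes> l) \<otimes> r" using c by (simp add: H.m_assoc)
    moreover have "t [^] \<pi> g \<otimes> l \<in> ?T" by (rule subgroup.m_closed[OF sT t_T L_T[OF rl(2)]])
    ultimately show ?thesis using rl(1) by blast
  qed
  moreover have "R \<subseteq> carrier H" using R(2) K_memD(1) by blast
  ultimately obtain N where N: "N \<in> finite_index_normal H" "N \<subseteq> ?T"
    using H.normal_core_finite_index[OF sT R(1)] by blast
  have NL: "k \<in> L" if "k \<in> N" "k \<in> K" for k
    using stable_extend_Int_K[OF L that(2)] N(2) that(1) by blast
  obtain e where e: "e \<in> K" "appr N A e" using A_matched_in_K[OF N(1)] by blast
  have ec: "e \<in> carrier H" using K_memD e(1) by blast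
  obtain m where m: "m > 0" "coprime m n" "\<forall>i::int. appr N (A [^]\<^bsub>\<Gamma>\<^esub> i) \<one> \<longleftrightarrow> m dvd i"
    using order_of_A[OF N(1)] by blast
  have eK: "e [^] i \<in> K" for i :: int using H.subgroup_int_pow_closed[OF K_subgroup e(1)] .
  have "appr N (A [^]\<^bsub>\<Gamma>\<^esub> m) \<one>" using m(3) by simp
  from NL[OF appr_kernelD[OF N(1) appr_int_pow[OF N(1) e(2)] this] eK]
  have "e [^] m \<in> L" .
  moreover have "\<exists>i::int. \<exists>l\<in>L. y = e [^] i \<otimes> l" if y: "y \<in> K" for y
  proof -
    have yc: "y \<in> carrier H" using K_memD y by blast
    obtain i where i: "appr N (A [^]\<^bsub>\<Gamma>\<^esub> (i::int)) y" using K_matched_by_A[OF N(1) y] by blast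
    have "y \<otimes> inv (e [^] i) \<in> N" by (rule appr_eqD[OF N(1) appr_int_pow[OF N(1) e(2)] i])
    moreover have yK: "y \<otimes> inv (e [^] i) \<in> K"
      by (rule subgroup.m_closed[OF K_subgroup y subgroup.m_inv_closed[OF K_subgroup eK]])
    ultimately have "y \<otimes> inv (e [^] i) \<in> L" by (rule NL)
    moreover have "y = e [^] i \<otimes> (y \<otimes> inv (e [^] i))"
      unfolding K_commutes[OF eK yK] using yc ec by (simp add: H.m_assoc)
    ultimately show ?thesis by blast
  qed
  ultimately show ?thesis using e(1) m(1,2) by blast
qed

text \<open>Conjugation by a match \<open>T^v A^i\<close> of \<open>t\<close> raises \<open>A\<close> to the power \<open>n^v\<close>, whereas conjugation by \<open>t\<close> acts on \<open>K\<close>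
with slope \<open>a/b\<close>. Degrees modulo \<open>J\<close> show that \<open>v\<close> is invertible, with the degree of a representative of
\<open>T\<close> as its inverse.\<close>

lemma slope_congruence:
  assumes slope: "\<And>k. k \<in> K \<Longrightarrow> (inv t \<otimes> k \<otimes> t) [^] (b::int) = k [^] (a::int)"
    and m: "m > 0" "coprime m n" and J: "J > 0"
  shows "\<exists>(u::int) (v::nat). J dvd u * int v - 1 \<and> m dvd a - b * n ^ v"
proof -
  obtain N where N: "N \<in> finite_index_normal H" "\<forall>i::int. appr N (A [^]\<^bsub>\<Gamma>\<^esub> i) \<one> \<longrightarrow> m dvd i"
    using A_powers_separated[OF m] by blast
  note lay = layer_finite_index[OF J]
  note N' = H.finite_index_normal_Int[OF N(1) lay]
  obtain v i where vi: "appr (N \<inter> layer J) (T [^]\<^bsub>\<Gamma>\<^esub> (v::nat) \<otimes>\<^bsub>\<Gamma>\<^esub> A [^]\<^bsub>\<Gamma>\<^esub> (i::int)) t"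
    using appr_form[OF N' t] by blast
  obtain \<alpha> where \<alpha>: "\<alpha> \<in> K" "appr (N \<inter> layer J) A \<alpha>" using A_matched_in_K[OF N'] by blast
  obtain \<beta> where \<beta>: "appr (N \<inter> layer J) T \<beta>" using appr_total[OF N' T_closed] by blast
  have c: "\<alpha> \<in> carrier H" "\<pi> \<alpha> = 0" "\<beta> \<in> carrier H" using K_memD[OF \<alpha>(1)] appr_closed[OF \<beta>] by auto
  have "appr (layer J) (T [^]\<^bsub>\<Gamma>\<^esub> v \<otimes>\<^bsub>\<Gamma>\<^esub> A [^]\<^bsub>\<Gamma>\<^esub> i) (\<beta> [^] v \<otimes> \<alpha> [^] i)"
    using appr_IntD(2)[OF N(1) lay] \<alpha>(2) \<beta> by (intro appr_mult[OF lay] appr_nat_pow[OF lay] appr_int_pow[OF lay])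
  from appr_eqD[OF lay this appr_IntD(2)[OF N(1) lay vi]]
  have "J dvd 1 - int v * \<pi> \<beta>"
    using c by (simp add: layer_def \<pi>.hom_int_pow \<pi>.hom_nat_pow)
  then have J1: "J dvd \<pi> \<beta> * int v - 1"
    using dvd_minus_iff[of J "1 - int v * \<pi> \<beta>"] by (simp add: mult.commute)
  let ?g = "T [^]\<^bsub>\<Gamma>\<^esub> v \<otimes>\<^bsub>\<Gamma>\<^esub> A [^]\<^bsub>\<Gamma>\<^esub> i"
  have "A \<otimes>\<^bsub>\<Gamma>\<^esub> ?g = ?g \<otimes>\<^bsub>\<Gamma>\<^esub> A [^]\<^bsub>\<Gamma>\<^esub> (n ^ v)"
  proof -
    have "A \<otimes>\<^bsub>\<Gamma>\<^esub> T [^]\<^bsub>\<Gamma>\<^esub> v = T [^]\<^bsub>\<Gamma>\<^esub> v \<otimes>\<^bsub>\<Gamma>\<^esub> A [^]\<^bsub>\<Gamma>\<^esub> (n ^ v)"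
      using \<Gamma>.bs_relation_pow[OF A_closed T_closed bs_relation, of 1 v] by simp
    then have "A \<otimes>\<^bsub>\<Gamma>\<^esub> ?g = T [^]\<^bsub>\<Gamma>\<^esub> v \<otimes>\<^bsub>\<Gamma>\<^esub> (A [^]\<^bsub>\<Gamma>\<^esub> (n ^ v) \<otimes>\<^bsub>\<Gamma>\<^esub> A [^]\<^bsub>\<Gamma>\<^esub> i)"
      by (simp add: \<Gamma>.m_assoc[symmetric])
    also have "\<dots> = ?g \<otimes>\<^bsub>\<Gamma>\<^esub> A [^]\<^bsub>\<Gamma>\<^esub> (n ^ v)"
      by (simp add: \<Gamma>.m_assoc \<Gamma>.int_pow_mult[symmetric] add.commute)
    finally show ?thesis .
  qed
  then have conj: "inv\<^bsub>\<Gamma>\<^esub> ?g \<otimes>\<^bsub>\<Gamma>\<^esub> A \<otimes>\<^bsub>\<Gamma>\<^esub> ?g = A [^]\<^bsub>\<Gamma>\<^esub> (n ^ v)"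
    by (simp add: \<Gamma>.m_assoc[of "inv\<^bsub>\<Gamma>\<^esub> ?g" A ?g]) (simp add: \<Gamma>.m_assoc[of "inv\<^bsub>\<Gamma>\<^esub> ?g" ?g, symmetric])
  note \<alpha>N = appr_IntD(1)[OF N(1) lay \<alpha>(2)]
  note gN = appr_IntD(1)[OF N(1) lay vi]
  have "appr N (inv\<^bsub>\<Gamma>\<^esub> ?g \<otimes>\<^bsub>\<Gamma>\<^esub> A \<otimes>\<^bsub>\<Gamma>\<^esub> ?g) (inv t \<otimes> \<alpha> \<otimes> t)"
    by (intro appr_mult[OF N(1)] appr_inv[OF N(1)] \<alpha>N gN)
  from appr_int_pow[OF N(1) this[unfolded conj], of b]
  have "appr N (A [^]\<^bsub>\<Gamma>\<^esub> (n ^ v * b)) (\<alpha> [^] a)"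
    by (simp add: slope[OF \<alpha>(1)] \<Gamma>.int_pow_pow)
  from appr_mult[OF N(1) appr_int_pow[OF N(1) \<alpha>N, of a] appr_inv[OF N(1) this]]
  have "appr N (A [^]\<^bsub>\<Gamma>\<^esub> (a - n ^ v * b)) \<one>"
    using c(1) by (simp add: \<Gamma>.int_pow_diff)
  then have "m dvd a - n ^ v * b" using N(2) by blast
  then have "m dvd a - b * n ^ v" by (simp add: mult.commute)
  then show ?thesis using J1 by blast
qed

lemma KG_comm_group: "comm_group KG"
  using K_commutes by (rule KG_comm_groupI)

definition \<sigma> where "\<sigma> k = inv t \<otimes> k \<otimes> t"
definition \<tau> where "\<tau> k = t \<otimes> k \<otimes> inv t"

lemma \<sigma>\<tau>_K: "k \<in> K \<Longrightarrow> \<sigma> k \<in> K" "k \<in> K \<Longrightarrow> \<tau> k \<in> K"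
  using stable_K by (simp_all add: stable_def \<sigma>_def \<tau>_def)

lemma inv_cancel:
  assumes "z \<in> carrier H" shows "t \<otimes> (inv t \<otimes> z) = z" "inv t \<otimes> (t \<otimes> z) = z"
  using assms by (simp_all add: H.m_assoc[symmetric])

lemma KG_automorphism: "abelian_automorphism KG \<sigma> \<tau>"
proof -
  have "\<sigma> \<in> hom KG KG" "\<tau> \<in> hom KG KG"
    using \<sigma>\<tau>_K K_memD(1)
    by (auto intro!: homI simp: \<sigma>_def \<tau>_def H.m_assoc inv_cancel)
  moreover have "\<sigma> (\<tau> k) = k" "\<tau> (\<sigma> k) = k" if "k \<in> K" for k
    using K_memD(1)[OF that] by (simp_all add: \<sigma>_def \<tau>_def H.m_assoc inv_cancel)
  ultimately show ?thesis
    using KG_comm_group by (intro abelian_automorphism.intro abelian_automorphism_axioms.intro) simp_all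
qed

lemma stable_iff_invariant: "stable L \<longleftrightarrow> abelian_automorphism.invariant_subgroup KG \<sigma> \<tau> L"
  unfolding abelian_automorphism.invariant_subgroup_def[OF KG_automorphism] KG_subgroup_iff stable_def
    \<sigma>_def \<tau>_def by blast

text \<open>The stable subgroups of \<open>K\<close> are its submodules for conjugation by \<open>t\<close>.\<close>

lemma KG_cyclic_quotients:
  obtains F where "cyclic_quotients KG \<sigma> \<tau> F"
proof -
  obtain F where F: "finite F" "F \<subseteq> K" "\<forall>L. stable L \<longrightarrow> F \<subseteq> L \<longrightarrow> K \<subseteq> L"
    by (rule K_finitely_generated)
  have "cyclic_quotients KG \<sigma> \<tau> F"
  proof (intro cyclic_quotients.intro KG_automorphism cyclic_quotients_axioms.intro)
    show "finite F" by (rule F(1))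
    show "F \<subseteq> carrier KG" using F(2) by simp
    show "carrier KG \<subseteq> L" if "abelian_automorphism.invariant_subgroup KG \<sigma> \<tau> L" "F \<subseteq> L" for L
      using F(3) that by (simp add: stable_iff_invariant)
    show "\<exists>e\<in>carrier KG. \<forall>y\<in>carrier KG. \<exists>i::int. \<exists>l\<in>L. y = e [^]\<^bsub>KG\<^esub> i \<otimes>\<^bsub>KG\<^esub> l"
      if L: "abelian_automorphism.invariant_subgroup KG \<sigma> \<tau> L" "finitely_many_cosets KG L" for L
    proof -
      have sL: "stable L" using L(1) by (simp add: stable_iff_invariant)
      obtain R where R: "finite R" "R \<subseteq> K" "\<forall>y\<in>K. \<exists>r\<in>R. \<exists>l\<in>L. y = r \<otimes> l"
        using L(2) unfolding finitely_many_cosets_def by (elim exE conjE) (rule that, simp_all)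
      from stable_quotient_cyclic[OF sL R] obtain e where
        e: "e \<in> K" "\<forall>y\<in>K. \<exists>i::int. \<exists>l\<in>L. y = e [^] i \<otimes> l" by (elim bexE exE conjE) (rule that)
      show ?thesis
        by (rule bexI[of _ e]) (use e in \<open>simp_all add: KG_pow\<close>)
    qed
  qed
  then show ?thesis using that by blast
qed

lemma K_structure:
  assumes "K \<noteq> {\<one>}"
  shows "\<exists>x a b. x \<in> K \<and> x \<noteq> \<one> \<and> a \<noteq> 0 \<and> b \<noteq> 0 \<and> coprime a (b::int) \<and>
    (\<forall>y\<in>K. \<sigma> y [^] b = y [^] a) \<and> (\<forall>L. stable L \<longrightarrow> x \<in> L \<longrightarrow> K \<subseteq> L) \<and>
    (\<forall>y\<in>K. \<exists>j i. y [^] ((a * b) ^ j) = x [^] (i::int))"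
proof -
  obtain F where "cyclic_quotients KG \<sigma> \<tau> F" by (rule KG_cyclic_quotients)
  then interpret KG: cyclic_quotients KG \<sigma> \<tau> F .
  have "\<exists>x a b. x \<in> carrier KG \<and> x \<noteq> \<one>\<^bsub>KG\<^esub> \<and> a \<noteq> 0 \<and> b \<noteq> 0 \<and> coprime a (b::int) \<and>
    (\<forall>y\<in>carrier KG. \<sigma> y [^]\<^bsub>KG\<^esub> b = y [^]\<^bsub>KG\<^esub> a) \<and>
    (\<forall>L. KG.invariant_subgroup L \<longrightarrow> x \<in> L \<longrightarrow> carrier KG \<subseteq> L) \<and>
    (\<forall>y\<in>carrier KG. \<exists>j i. y [^]\<^bsub>KG\<^esub> ((a * b) ^ j) = x [^]\<^bsub>KG\<^esub> (i::int))"
  proof (rule KG.torsion_free_structure)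
    show "y = \<one>\<^bsub>KG\<^esub>" if "y \<in> carrier KG" "m \<noteq> (0::int)" "y [^]\<^bsub>KG\<^esub> m = \<one>\<^bsub>KG\<^esub>" for y m
      using K_torsion_free[of y m] that by (simp add: KG_pow)
    show "carrier KG \<noteq> {\<one>\<^bsub>KG\<^esub>}" using assms by simp
  qed
  then obtain x a b where x: "x \<in> K" "x \<noteq> \<one>" "a \<noteq> 0" "b \<noteq> 0" "coprime a (b::int)"
    "\<forall>y\<in>K. \<sigma> y [^]\<^bsub>KG\<^esub> b = y [^]\<^bsub>KG\<^esub> a"
    "\<forall>L. KG.invariant_subgroup L \<longrightarrow> x \<in> L \<longrightarrow> K \<subseteq> L"
    "\<forall>y\<in>K. \<exists>j i. y [^]\<^bsub>KG\<^esub> ((a * b) ^ j) = x [^]\<^bsub>KG\<^esub> (i::int)"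
    by (elim exE conjE) (rule that, simp_all)
  show ?thesis
    using x by (intro exI[of _ x] exI[of _ a] exI[of _ b])
      (simp add: KG_pow \<sigma>\<tau>_K stable_iff_invariant)
qed

text \<open>The image of \<open>A\<close> can have order divisible by \<open>\<bar>n\<bar> + 1\<close>, so it does not come from a trivial group.\<close>

lemma K_nontrivial:
  assumes "n \<noteq> 0" shows "K \<noteq> {\<one>}"
proof
  assume K: "K = {\<one>}"
  have "coprime (\<bar>n\<bar> + 1) n"
  proof (rule coprimeI)
    fix d assume "d dvd \<bar>n\<bar> + 1" "d dvd n"
    then show "is_unit d" using dvd_diff[of d "\<bar>n\<bar> + 1" "\<bar>n\<bar>"] by simp
  qed
  moreover have "\<bar>n\<bar> + 1 > 0" by simp
  ultimately obtain N where N: "N \<in> finite_index_normal H"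
    "\<forall>i::int. appr N (A [^]\<^bsub>\<Gamma>\<^esub> i) \<one> \<longrightarrow> \<bar>n\<bar> + 1 dvd i"
    using A_powers_separated by blast
  have "appr N A \<one>" using A_matched_in_K[OF N(1)] K by simp
  then have "appr N (A [^]\<^bsub>\<Gamma>\<^esub> (1::int)) \<one>" by simp
  then have "\<bar>n\<bar> + 1 dvd 1" using N(2) by blast
  then show False using assms by auto
qed

text \<open>Suppose \<open>r\<close> is coprime to \<open>c\<close>. Then the quotient of \<open>K\<close> by the \<open>r\<close>-th powers is finite and generated by an
element \<open>e\<close> whose order is coprime to \<open>n\<close>, hence to its divisor \<open>r\<close>. So the quotient is trivial and \<open>x\<close> is
an \<open>r\<close>-th power, contrary to the fact that \<open>K\<close> is spanned by \<open>x\<close> over the integers with \<open>c\<close> inverted.\<close>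

lemma denominators:
  assumes x: "x \<in> K" "x \<noteq> \<one>" and r: "r > 1" "r dvd n"
    and roots: "\<And>y. y \<in> K \<Longrightarrow> \<exists>j i. y [^] (c ^ j) = x [^] (i::int)"
  shows "\<not> coprime r c"
proof
  assume cop: "coprime r c"
  interpret KG: abelian_automorphism KG \<sigma> \<tau> by (rule KG_automorphism)
  let ?L = "{v [^]\<^bsub>KG\<^esub> r | v. v \<in> carrier KG}"
  have gen: "\<exists>m. coprime m r \<and> y [^]\<^bsub>KG\<^esub> (m::int) \<in> generate KG {x}" if y: "y \<in> carrier KG" for y
  proof -
    have yK: "y \<in> K" using y by simp
    obtain j i where ji: "y [^] (c ^ j) = x [^] (i::int)" using roots[OF yK] by (elim exE) (rule that)
    have "x [^]\<^bsub>KG\<^esub> i \<in> generate KG {x}"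
      using x(1) KG.generate_pow[of x] by auto
    then have "y [^]\<^bsub>KG\<^esub> (c ^ j) \<in> generate KG {x}" using ji y x(1) by (simp add: KG_pow)
    moreover have "coprime (c ^ j) r" using cop by (simp add: coprime_commute)
    ultimately show ?thesis by blast
  qed
  have "finitely_many_cosets KG ?L"
  proof (rule KG.powers_finitely_many_cosets)
    show "finite {x}" "{x} \<subseteq> carrier KG" "r > 0" using x(1) r(1) by simp_all
  qed (rule gen)
  then obtain R where R: "finite R" "R \<subseteq> K" "\<forall>y\<in>K. \<exists>z\<in>R. \<exists>l\<in>?L. y = z \<otimes> l"
    unfolding finitely_many_cosets_def by (elim exE conjE) (rule that, simp_all)
  have L: "stable ?L" unfolding stable_iff_invariant by (rule KG.powers_invariant)
  from stable_quotient_cyclic[OF L R] obtain e m where em: "e \<in> K" "coprime m n" "e [^] (m::int) \<in> ?L"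
    "\<forall>y\<in>K. \<exists>i::int. \<exists>l\<in>?L. y = e [^] i \<otimes> l" by (elim bexE exE conjE) (rule that)
  have sL: "subgroup ?L KG" by (rule KG.invariant_subgroupD(1)[OF KG.powers_invariant])
  have "coprime m r" using em(2) r(2) by (rule coprime_divisors[OF dvd_refl, rotated])
  then obtain u w where uw: "u * m + w * r = 1" using bezout_int[of m r] by (metis coprime_iff_gcd_eq_1)
  have "e [^]\<^bsub>KG\<^esub> m \<in> ?L" using em(1,3) by (simp add: KG_pow)
  then have 1: "(e [^]\<^bsub>KG\<^esub> m) [^]\<^bsub>KG\<^esub> u \<in> ?L" by (rule KG.subgroup_int_pow_closed[OF sL])
  have "e [^]\<^bsub>KG\<^esub> r \<in> ?L" using em(1) by auto
  then have 2: "(e [^]\<^bsub>KG\<^esub> r) [^]\<^bsub>KG\<^esub> w \<in> ?L" by (rule KG.subgroup_int_pow_closed[OF sL])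
  have "(e [^]\<^bsub>KG\<^esub> m) [^]\<^bsub>KG\<^esub> u \<otimes>\<^bsub>KG\<^esub> (e [^]\<^bsub>KG\<^esub> r) [^]\<^bsub>KG\<^esub> w = e [^]\<^bsub>KG\<^esub> (u * m + w * r)"
    using em(1) KG.int_pow_pow[of e m u] KG.int_pow_pow[of e r w] KG.int_pow_mult[of e "u * m" "w * r"]
    by (simp add: mult.commute)
  also have "\<dots> = e" using em(1) uw KG.int_pow_1[of e] by simp
  finally have eL: "e \<in> ?L" using subgroup.m_closed[OF sL 1 2] by metis
  obtain i l where il: "l \<in> ?L" "x = e [^]\<^bsub>KG\<^esub> (i::int) \<otimes>\<^bsub>KG\<^esub> l"
    using bspec[OF em(4) x(1)] em(1) by (auto simp: KG_pow)
  have "e [^]\<^bsub>KG\<^esub> i \<otimes>\<^bsub>KG\<^esub> l \<in> ?L"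
    by (rule subgroup.m_closed[OF sL KG.subgroup_int_pow_closed[OF sL eL] il(1)])
  then have "x \<in> ?L" unfolding il(2)[symmetric] .
  then obtain v where "v \<in> carrier KG" "x = v [^]\<^bsub>KG\<^esub> r" by blast
  then have v: "v \<in> K" "x = v [^] r" by (simp_all add: KG_pow)
  have c: "v \<in> carrier H" "x \<in> carrier H" using v(1) x(1) K_memD by auto
  obtain j i where ji: "v [^] (c ^ j) = x [^] (i::int)" using roots[OF v(1)] by (elim exE) (rule that)
  have "x [^] (c ^ j) = (v [^] (c ^ j)) [^] r" using c v(2) by (simp add: H.int_pow_pow mult.commute)
  also have "\<dots> = x [^] (i * r)" using c by (simp add: ji H.int_pow_pow)
  finally have "x [^] (c ^ j - i * r) = \<one>" using c by (simp add: H.int_pow_diff)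
  then have "c ^ j - i * r = 0" using K_torsion_free[OF x(1)] x(2) by blast
  then have "r dvd c ^ j" by simp
  moreover have "coprime r (c ^ j)" using cop by simp
  ultimately have "is_unit r" by (rule coprime_common_divisor[OF _ dvd_refl, rotated])
  then show False using r(1) by simp
qed

end

section \<open>Determination of the slope\<close>

lemma exists_power_cong_one:
  assumes "m > 0" "coprime n (m::int)" shows "\<exists>J>0. [n ^ J = 1] (mod m)"
proof (cases "m = 1")
  case True
  then have "[n ^ 1 = 1] (mod m)" by (simp add: cong_def)
  then show ?thesis by (intro exI[of _ 1]) simp
next
  case False
  interpret residues m "residue_ring m" using False assms(1) by unfold_locales simp_all
  have "[n ^ totient (nat m) = 1] (mod m)" by (rule euler_theorem[OF assms(2)])
  moreover have "totient (nat m) > 0" using assms(1) by simp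
  ultimately show ?thesis by blast
qed

text \<open>The congruences say that \<open>a/b\<close> and \<open>n\<close> generate the same group of units modulo each \<open>m\<close> coprime to \<open>n\<close>.
So \<open>m\<close> divides \<open>n^k - 1\<close> if and only if it divides \<open>a^k - b^k\<close>; the condition on common factors
ensures that every divisor of \<open>a^k - b^k\<close> is coprime to \<open>n\<close>. From \<open>\<bar>n - 1\<bar> = \<bar>a - b\<bar>\<close> and
\<open>\<bar>n^2 - 1\<bar> = \<bar>a^2 - b^2\<bar>\<close> one gets \<open>\<bar>n + 1\<bar> = \<bar>a + b\<bar>\<close>.\<close>

lemma slope_determined:
  fixes a b n :: int
  assumes n: "n \<noteq> 1" and ab: "coprime a b"
    and cong: "\<And>m J. m > 0 \<Longrightarrow> coprime m n \<Longrightarrow> J > 0 \<Longrightarrow>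
      \<exists>(u::int) (v::nat). J dvd u * int v - 1 \<and> m dvd a - b * n ^ v"
    and den: "\<And>r. r > 1 \<Longrightarrow> r dvd n \<Longrightarrow> \<not> coprime r (a * b)"
  shows "a = n \<and> b = 1 \<or> a = - n \<and> b = - 1 \<or> a = 1 \<and> b = n \<or> a = - 1 \<and> b = - n"
proof -
  have 1: "m dvd a ^ k - b ^ k" if m: "m > 0" "m dvd n ^ k - 1" and k: "k > 0" for m :: int and k :: nat
  proof -
    have nk: "[n ^ k = 1] (mod m)" using m(2) by (simp add: cong_iff_dvd_diff)
    have "coprime m n"
    proof (rule coprimeI)
      fix d assume d: "d dvd m" "d dvd n"
      have "d dvd n ^ k" by (rule dvd_trans[OF d(2) dvd_power[OF disjI1[OF k]]])
      moreover have "d dvd n ^ k - 1" using d(1) m(2) by (rule dvd_trans)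
      ultimately have "d dvd n ^ k - (n ^ k - 1)" by (rule dvd_diff)
      then show "is_unit d" by simp
    qed
    then obtain v :: nat where "m dvd a - b * n ^ v" using cong[OF m(1) _ zero_less_one] by blast
    then have "[a = b * n ^ v] (mod m)" by (simp add: cong_iff_dvd_diff)
    then have "[a ^ k = (b * n ^ v) ^ k] (mod m)" by (rule cong_pow)
    also have "(b * n ^ v) ^ k = b ^ k * (n ^ k) ^ v"
      by (simp add: power_mult_distrib power_mult[symmetric] mult.commute)
    also have "[b ^ k * (n ^ k) ^ v = b ^ k * 1 ^ v] (mod m)"
      by (intro cong_mult cong_refl cong_pow nk)
    finally show ?thesis by (simp add: cong_iff_dvd_diff)
  qed
  have 2: "m dvd n ^ k - 1" if m: "m > 0" "m dvd a ^ k - b ^ k" and k: "k > 0" for m :: int and k :: nat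
  proof -
    have abk: "coprime a (b ^ k)" "coprime (a ^ k) b" using ab by simp_all
    have ma: "coprime m a"
    proof (rule coprimeI)
      fix d assume d: "d dvd m" "d dvd a"
      have "d dvd a ^ k - b ^ k" using d(1) m(2) by (rule dvd_trans)
      moreover have "d dvd a ^ k" by (rule dvd_trans[OF d(2) dvd_power[OF disjI1[OF k]]])
      ultimately have "d dvd a ^ k - (a ^ k - b ^ k)" by (rule dvd_diff[rotated])
      then have "d dvd b ^ k" by simp
      then show "is_unit d" using coprime_common_divisor[OF abk(1) d(2)] by simp
    qed
    have mb: "coprime m b"
    proof (rule coprimeI)
      fix d assume d: "d dvd m" "d dvd b"
      have "d dvd a ^ k - b ^ k" using d(1) m(2) by (rule dvd_trans)
      moreover have "d dvd b ^ k" by (rule dvd_trans[OF d(2) dvd_power[OF disjI1[OF k]]])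
      ultimately have "d dvd (a ^ k - b ^ k) + b ^ k" by (rule dvd_add)
      then have "d dvd a ^ k" by simp
      then show "is_unit d" using coprime_common_divisor[OF abk(2)] d(2) by blast
    qed
    have mn: "coprime m n"
    proof (rule ccontr)
      assume "\<not> coprime m n"
      then have "gcd m n \<noteq> 1" by (simp add: coprime_iff_gcd_eq_1)
      moreover have "gcd m n > 0" using m(1) by simp
      ultimately have "gcd m n > 1" by linarith
      then have "\<not> coprime (gcd m n) (a * b)" by (rule den) simp
      moreover have "coprime m (a * b)" using ma mb by simp
      ultimately show False using coprime_divisors[of "gcd m n" m "a * b" "a * b"] by simp
    qed
    obtain J0 where J0: "J0 > 0" "[n ^ J0 = 1] (mod m)"
      using exists_power_cong_one[OF m(1)] mn coprime_commute by blast
    define J where "J = int J0"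
    have J: "J > 0" using J0(1) by (simp add: J_def)
    obtain u :: int and v :: nat where uv: "J dvd u * int v - 1" "m dvd a - b * n ^ v"
      using cong[OF m(1) mn J] by blast
    have "[a = b * n ^ v] (mod m)" using uv(2) by (simp add: cong_iff_dvd_diff)
    then have "[a ^ k = (b * n ^ v) ^ k] (mod m)" by (rule cong_pow)
    then have "[a ^ k = b ^ k * n ^ (v * k)] (mod m)" by (simp add: power_mult_distrib power_mult)
    moreover have "[a ^ k = b ^ k] (mod m)" using m(2) by (simp add: cong_iff_dvd_diff)
    ultimately have "[b ^ k * n ^ (v * k) = b ^ k * 1] (mod m)"
      using cong_trans cong_sym by (metis mult.right_neutral)
    moreover have "coprime (b ^ k) m" using mb by (simp add: coprime_commute)
    ultimately have nvk: "[n ^ (v * k) = 1] (mod m)" using cong_mult_lcancel by blast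
    define u' where "u' = nat (u mod J)"
    have u': "int u' = u mod J" using J by (simp add: u'_def)
    have "J dvd u - u mod J" by (simp add: minus_mod_eq_mult_div)
    then have "J dvd (u * int v - 1) - (u - u mod J) * int v"
      by (rule dvd_diff[OF uv(1) dvd_mult2])
    then have "J dvd int u' * int v - 1" by (simp add: u' algebra_simps)
    then obtain w where w: "int u' * int v - 1 = J * w" by (rule dvdE)
    \<comment> \<open>adding one period \<open>J\<close> keeps the exponents natural when \<open>u' v = 0\<close>, that is when \<open>J = 1\<close>\<close>
    have w0: "w + 1 \<ge> 0"
    proof (rule ccontr)
      assume "\<not> w + 1 \<ge> 0"
      then have "J * w \<le> J * (- 2)" using J by (intro mult_left_mono) simp_all
      then have "J * w \<le> - 2" using J by simp
      moreover have "int u' * int v \<ge> 0" by simp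
      ultimately show False using w by linarith
    qed
    have "int (u' * v + J0) = int (1 + J0 * nat (w + 1))"
      using w w0 by (simp add: J_def algebra_simps)
    then have e: "u' * v + J0 = 1 + J0 * nat (w + 1)" by (simp only: of_nat_eq_iff)
    have "[n ^ k * (n ^ J0) ^ (nat (w + 1) * k) = n ^ k * 1 ^ (nat (w + 1) * k)] (mod m)"
      by (intro cong_mult cong_refl cong_pow J0(2))
    then have "[n ^ k = n ^ k * (n ^ J0) ^ (nat (w + 1) * k)] (mod m)" by (simp add: cong_sym)
    also have "n ^ k * (n ^ J0) ^ (nat (w + 1) * k) = n ^ ((1 + J0 * nat (w + 1)) * k)"
      by (simp add: power_mult[symmetric] power_add[symmetric] algebra_simps)
    also have "\<dots> = (n ^ (v * k)) ^ u' * (n ^ J0) ^ k"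
      unfolding e[symmetric] by (simp add: power_mult[symmetric] power_add[symmetric] algebra_simps)
    also have "[(n ^ (v * k)) ^ u' * (n ^ J0) ^ k = 1 ^ u' * 1 ^ k] (mod m)"
      by (intro cong_mult cong_pow nvk J0(2))
    finally show ?thesis by (simp add: cong_iff_dvd_diff)
  qed
  have dvdI: "x dvd y" if "\<And>m. m > 0 \<Longrightarrow> m dvd x \<Longrightarrow> m dvd y" for x y :: int
  proof (cases "x = 0")
    case True
    have "\<bar>y\<bar> + 1 dvd y" using that[of "\<bar>y\<bar> + 1"] True by simp
    then have "y = 0" using zdvd_imp_le[of "\<bar>y\<bar> + 1" "\<bar>y\<bar>"] by fastforce
    then show ?thesis by simp
  next
    case False
    then show ?thesis using that[of "\<bar>x\<bar>"] by simp
  qed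
  have eq: "\<bar>n ^ k - 1\<bar> = \<bar>a ^ k - b ^ k\<bar>" if k: "k > 0" for k :: nat
    by (rule zdvd_antisym_abs; rule dvdI) (use 1[OF _ _ k] 2[OF _ _ k] in blast)+
  have "\<bar>n - 1\<bar> = \<bar>a - b\<bar>" using eq[of 1] by simp
  moreover have "\<bar>n - 1\<bar> * \<bar>n + 1\<bar> = \<bar>a - b\<bar> * \<bar>a + b\<bar>"
    using eq[of 2] by (simp add: abs_mult[symmetric] power2_eq_square algebra_simps)
  ultimately have "\<bar>n + 1\<bar> = \<bar>a + b\<bar>" using n by auto
  with \<open>\<bar>n - 1\<bar> = \<bar>a - b\<bar>\<close> show ?thesis by arith
qed

section \<open>Reconstruction of the group\<close>

context bs_matching_nonabelian
begin

text \<open>In the second case the inverse of \<open>t\<close> plays the role of the generator \<open>T\<close>.\<close>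

lemma isomorphic_from_generator:
  assumes x: "x \<in> K" "\<And>L. stable L \<Longrightarrow> x \<in> L \<Longrightarrow> K \<subseteq> L" and "n \<noteq> 0 \<Longrightarrow> x \<noteq> \<one>"
    and rel: "\<sigma> x = x [^] n \<or> \<tau> x = x [^] n"
  shows "\<Gamma> \<cong> H"
proof -
  have xc: "x \<in> carrier H" "\<pi> x = 0" using K_memD[OF x(1)] by auto
  have gen: "carrier H \<subseteq> S" if S: "subgroup S H" "x \<in> S" "t \<in> S" for S
  proof -
    have "stable (S \<inter> K)"
      using H.subgroups_Inter_pair[OF S(1) K_subgroup] \<sigma>\<tau>_K S subgroup.m_closed[OF S(1)]
        subgroup.m_inv_closed[OF S(1)]
      by (simp add: stable_def \<sigma>_def \<tau>_def)
    then have "K \<subseteq> S \<inter> K" using x S(2) by blast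
    then show ?thesis using stable_generates[OF stable_K _ S(1) _ S(3)] by blast
  qed
  have free: "k = 0" if "n \<noteq> 0" "x [^] k = \<one>" for k :: int
    using K_torsion_free[OF x(1) _ that(2)] assms(3)[OF that(1)] by blast
  from rel show ?thesis
  proof
    assume \<sigma>x: "\<sigma> x = x [^] n"
    show ?thesis
    proof (rule isomorphic_if_presented[OF H.is_group xc(1) t _ \<pi>_hom xc(2)])
      show "inv t \<otimes> x \<otimes> t = x [^] n" using \<sigma>x by (simp only: \<sigma>_def)
      show "\<pi> t \<noteq> 0" by simp
      show "carrier H \<subseteq> S" if "subgroup S H" "x \<in> S" "t \<in> S" for S by (rule gen[OF that])
      show "k = 0" if "n \<noteq> 0" "x [^] k = \<one>" for k :: int by (rule free[OF that])
    qed
  next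
    assume \<tau>x: "\<tau> x = x [^] n"
    show ?thesis
    proof (rule isomorphic_if_presented[OF H.is_group xc(1) H.inv_closed[OF t] _ \<pi>_hom xc(2)])
      show "inv (inv t) \<otimes> x \<otimes> inv t = x [^] n" using \<tau>x by (simp only: \<tau>_def H.inv_inv[OF t])
      show "\<pi> (inv t) \<noteq> 0" by simp
      show "carrier H \<subseteq> S" if "subgroup S H" "x \<in> S" "inv t \<in> S" for S
        using gen[OF that(1,2)] subgroup.m_inv_closed[OF that(1,3)] by (simp only: H.inv_inv[OF t])
      show "k = 0" if "n \<noteq> 0" "x [^] k = \<one>" for k :: int by (rule free[OF that])
    qed
  qed
qed

text \<open>For \<open>n = 0\<close> the element \<open>A\<close> is trivial, so \<open>K\<close> is trivial by residual finiteness. Otherwise the four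
solutions of \<open>slope_determined\<close> are the reduced fractions equal to \<open>n\<close> or \<open>1/n\<close>.\<close>

theorem isomorphic: "\<Gamma> \<cong> H"
proof (cases "n = 0")
  case True
  have "k = \<one>" if k: "k \<in> K" for k
  proof (rule residual_eq_one)
    show kc: "k \<in> carrier H" using K_memD k by blast
    fix N assume N: "N \<in> finite_index_normal H"
    obtain i where "appr N (A [^]\<^bsub>\<Gamma>\<^esub> (i::int)) k" using K_matched_by_A[OF N k] by blast
    then show "k \<in> N" using appr_one_iff[OF N kc] A_trivial[OF True] by simp
  qed
  then have K: "K = {\<one>}" using subgroup.one_closed[OF K_subgroup] by blast
  show ?thesis
    by (rule isomorphic_from_generator[of \<one>]) (simp_all add: K True \<sigma>_def)
next
  case False
  obtain x a b where x: "x \<in> K" "x \<noteq> \<one>" "a \<noteq> 0" "b \<noteq> 0" "coprime a (b::int)"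
    "\<forall>y\<in>K. \<sigma> y [^] b = y [^] a" "\<forall>L. stable L \<longrightarrow> x \<in> L \<longrightarrow> K \<subseteq> L"
    "\<forall>y\<in>K. \<exists>j i. y [^] ((a * b) ^ j) = x [^] (i::int)"
    using K_structure[OF K_nontrivial[OF False]] by (elim exE conjE) (rule that)
  have xc: "x \<in> carrier H" using K_memD x(1) by blast
  have slope: "(inv t \<otimes> k \<otimes> t) [^] b = k [^] a" if "k \<in> K" for k
    using x(6) that by (simp add: \<sigma>_def)
  have "a = n \<and> b = 1 \<or> a = - n \<and> b = - 1 \<or> a = 1 \<and> b = n \<or> a = - 1 \<and> b = - n"
  proof (rule slope_determined[OF n_not_1 x(5)])
    show "\<exists>(u::int) (v::nat). J dvd u * int v - 1 \<and> m dvd a - b * n ^ v"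
      if "m > 0" "coprime m n" "J > 0" for m J
      by (rule slope_congruence[OF slope that])
    show "\<not> coprime r (a * b)" if "r > 1" "r dvd n" for r
      by (rule denominators[OF x(1,2) that bspec[OF x(8)]])
  qed
  have \<sigma>x: "\<sigma> x \<in> carrier H" "\<sigma> x [^] b = x [^] a" using x(1,6) \<sigma>\<tau>_K K_memD(1) by blast+
  have \<tau>x: "\<tau> x \<in> carrier H" "x [^] b = \<tau> x [^] a"
  proof -
    show "\<tau> x \<in> carrier H" using x(1) \<sigma>\<tau>_K K_memD(1) by blast
    have "\<sigma> (\<tau> x) = x" using xc by (simp add: \<sigma>_def \<tau>_def H.m_assoc inv_cancel)
    then show "x [^] b = \<tau> x [^] a" using x(6) \<sigma>\<tau>_K(2)[OF x(1)] by metis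
  qed
  consider "a = n" "b = 1" | "a = - n" "b = - 1" | "a = 1" "b = n" | "a = - 1" "b = - n"
    using \<open>a = n \<and> b = 1 \<or> a = - n \<and> b = - 1 \<or> a = 1 \<and> b = n \<or> a = - 1 \<and> b = - n\<close> by blast
  then have "\<sigma> x = x [^] n \<or> \<tau> x = x [^] n"
  proof cases
    case 1
    then show ?thesis using \<sigma>x by simp
  next
    case 2
    then have "inv (\<sigma> x) = inv (x [^] n)" using \<sigma>x xc H.int_pow_neg[OF \<sigma>x(1), of 1] by (simp add: H.int_pow_neg)
    then show ?thesis using \<sigma>x(1) xc H.inv_inv by (metis H.int_pow_closed)
  next
    case 3
    then show ?thesis using \<tau>x by simp
  next
    case 4
    then have "inv (\<tau> x) = inv (x [^] n)" using \<tau>x xc H.int_pow_neg[OF \<tau>x(1), of 1] by (simp add: H.int_pow_neg)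
    then show ?thesis using \<tau>x(1) xc H.inv_inv by (metis H.int_pow_closed)
  qed
  then show ?thesis using isomorphic_from_generator[OF x(1)] x(2,7) by blast
qed

end

section \<open>The free abelian group of rank two\<close>

context bs_matching
begin

lemma degree_homs:
  assumes "n = 1"
  obtains \<epsilon> \<delta> where "\<epsilon> \<in> hom \<Gamma> integer_group" "\<epsilon> A = 0" "\<epsilon> T = 1"
    "\<delta> \<in> hom \<Gamma> integer_group" "\<delta> A = 1" "\<delta> T = 0"
proof -
  have "\<exists>h\<in>hom \<Gamma> integer_group. h A = 1 \<and> h T = 0"
    by (rule hom_exists) (simp_all add: assms)
  then obtain \<delta> where \<delta>: "\<delta> \<in> hom \<Gamma> integer_group" "\<delta> A = 1" "\<delta> T = 0" by blast
  obtain \<epsilon> where "\<epsilon> \<in> hom \<Gamma> integer_group" "\<epsilon> A = 0" "\<epsilon> T = 1" by (rule degree_hom)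
  then show ?thesis using \<delta> by (rule that)
qed

text \<open>For \<open>n = 1\<close> the exponents of both generators are homomorphisms to the integers.\<close>

lemma exponents_separated:
  assumes n: "n = 1" and m: "m > 0"
  obtains N where "N \<in> finite_index_normal H"
    "\<forall>p q r::int. appr N ((T [^]\<^bsub>\<Gamma>\<^esub> p \<otimes>\<^bsub>\<Gamma>\<^esub> A [^]\<^bsub>\<Gamma>\<^esub> q) [^]\<^bsub>\<Gamma>\<^esub> r) \<one> \<longrightarrow> m dvd p * r \<and> m dvd q * r"
proof -
  obtain \<epsilon> \<delta> where \<epsilon>: "\<epsilon> \<in> hom \<Gamma> integer_group" "\<epsilon> A = 0" "\<epsilon> T = 1"
    and \<delta>: "\<delta> \<in> hom \<Gamma> integer_group" "\<delta> A = 1" "\<delta> T = 0" by (rule degree_homs[OF n])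
  interpret \<epsilon>: group_hom \<Gamma> integer_group \<epsilon>
    by (intro group_hom.intro group_hom_axioms.intro \<epsilon>(1)) simp_all
  interpret \<delta>: group_hom \<Gamma> integer_group \<delta>
    by (intro group_hom.intro group_hom_axioms.intro \<delta>(1)) simp_all
  have M: "{g \<in> carrier \<Gamma>. m dvd \<epsilon> g} \<inter> {g \<in> carrier \<Gamma>. m dvd \<delta> g} \<in> finite_index_normal \<Gamma>"
    by (intro \<Gamma>.finite_index_normal_Int integer_hom_finite_index[OF \<Gamma>.is_group] \<epsilon>(1) \<delta>(1) m)
  obtain N where N: "N \<in> finite_index_normal H"
    "\<forall>g. appr N g \<one> \<longrightarrow> g \<in> {g \<in> carrier \<Gamma>. m dvd \<epsilon> g} \<inter> {g \<in> carrier \<Gamma>. m dvd \<delta> g}"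
    using appr_separates[OF M] by blast
  have "m dvd p * r \<and> m dvd q * r"
    if "appr N ((T [^]\<^bsub>\<Gamma>\<^esub> p \<otimes>\<^bsub>\<Gamma>\<^esub> A [^]\<^bsub>\<Gamma>\<^esub> q) [^]\<^bsub>\<Gamma>\<^esub> r) \<one>" for p q r :: int
    using N(2) that by (auto simp: \<epsilon>.hom_int_pow \<delta>.hom_int_pow \<epsilon>(2,3) \<delta>(2,3) mult.commute)
  then show ?thesis using that N(1) by blast
qed

lemma H_commutes:
  assumes n: "n = 1" and d: "d \<in> carrier H" "d' \<in> carrier H" shows "d \<otimes> d' = d' \<otimes> d"
proof -
  have TA: "(T [^]\<^bsub>\<Gamma>\<^esub> v \<otimes>\<^bsub>\<Gamma>\<^esub> A [^]\<^bsub>\<Gamma>\<^esub> i) \<otimes>\<^bsub>\<Gamma>\<^esub> (T [^]\<^bsub>\<Gamma>\<^esub> v' \<otimes>\<^bsub>\<Gamma>\<^esub> A [^]\<^bsub>\<Gamma>\<^esub> i')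
      = T [^]\<^bsub>\<Gamma>\<^esub> (v + v') \<otimes>\<^bsub>\<Gamma>\<^esub> A [^]\<^bsub>\<Gamma>\<^esub> (i + i')" for v v' :: nat and i i' :: int
  proof -
    have "A [^]\<^bsub>\<Gamma>\<^esub> i \<otimes>\<^bsub>\<Gamma>\<^esub> T [^]\<^bsub>\<Gamma>\<^esub> v' = T [^]\<^bsub>\<Gamma>\<^esub> v' \<otimes>\<^bsub>\<Gamma>\<^esub> A [^]\<^bsub>\<Gamma>\<^esub> (i * n ^ v')"
      by (rule \<Gamma>.bs_relation_pow[OF A_closed T_closed bs_relation])
    also have "i * n ^ v' = i" using n by simp
    finally have comm: "A [^]\<^bsub>\<Gamma>\<^esub> i \<otimes>\<^bsub>\<Gamma>\<^esub> T [^]\<^bsub>\<Gamma>\<^esub> v' = T [^]\<^bsub>\<Gamma>\<^esub> v' \<otimes>\<^bsub>\<Gamma>\<^esub> A [^]\<^bsub>\<Gamma>\<^esub> i" .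
    have "(T [^]\<^bsub>\<Gamma>\<^esub> v \<otimes>\<^bsub>\<Gamma>\<^esub> A [^]\<^bsub>\<Gamma>\<^esub> i) \<otimes>\<^bsub>\<Gamma>\<^esub> (T [^]\<^bsub>\<Gamma>\<^esub> v' \<otimes>\<^bsub>\<Gamma>\<^esub> A [^]\<^bsub>\<Gamma>\<^esub> i')
      = T [^]\<^bsub>\<Gamma>\<^esub> v \<otimes>\<^bsub>\<Gamma>\<^esub> (A [^]\<^bsub>\<Gamma>\<^esub> i \<otimes>\<^bsub>\<Gamma>\<^esub> T [^]\<^bsub>\<Gamma>\<^esub> v') \<otimes>\<^bsub>\<Gamma>\<^esub> A [^]\<^bsub>\<Gamma>\<^esub> i'"
      by (simp add: \<Gamma>.m_assoc)
    also have "\<dots> = (T [^]\<^bsub>\<Gamma>\<^esub> v \<otimes>\<^bsub>\<Gamma>\<^esub> T [^]\<^bsub>\<Gamma>\<^esub> v') \<otimes>\<^bsub>\<Gamma>\<^esub> (A [^]\<^bsub>\<Gamma>\<^esub> i \<otimes>\<^bsub>\<Gamma>\<^esub> A [^]\<^bsub>\<Gamma>\<^esub> i')"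
      unfolding comm by (simp add: \<Gamma>.m_assoc)
    also have "\<dots> = T [^]\<^bsub>\<Gamma>\<^esub> (v + v') \<otimes>\<^bsub>\<Gamma>\<^esub> A [^]\<^bsub>\<Gamma>\<^esub> (i + i')"
      by (simp add: \<Gamma>.nat_pow_mult \<Gamma>.int_pow_mult)
    finally show ?thesis .
  qed
  have "(d \<otimes> d') \<otimes> inv (d' \<otimes> d) = \<one>"
  proof (rule residual_eq_one)
    fix N assume N: "N \<in> finite_index_normal H"
    obtain v i where vi: "appr N (T [^]\<^bsub>\<Gamma>\<^esub> (v::nat) \<otimes>\<^bsub>\<Gamma>\<^esub> A [^]\<^bsub>\<Gamma>\<^esub> (i::int)) d"
      using appr_form[OF N d(1)] by blast
    obtain v' i' where vi': "appr N (T [^]\<^bsub>\<Gamma>\<^esub> (v'::nat) \<otimes>\<^bsub>\<Gamma>\<^esub> A [^]\<^bsub>\<Gamma>\<^esub> (i'::int)) d'"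
      using appr_form[OF N d(2)] by blast
    show "(d \<otimes> d') \<otimes> inv (d' \<otimes> d) \<in> N"
      using appr_eqD[OF N appr_mult[OF N vi' vi]] appr_mult[OF N vi vi'] unfolding TA
      by (simp add: add.commute)
  qed (use d in simp)
  then show ?thesis using H.div_eq_one_iff d by simp
qed

text \<open>As for \<open>K_prime_torsion_free\<close>, with \<open>J\<close> an exponent of \<open>H/N\<close>: in a quotient in which \<open>\<bar>m\<bar> J\<close> divides the exponents of trivial elements,
\<open>y^m = 1\<close> forces \<open>y\<close> to be a product of \<open>J\<close>-th powers modulo \<open>N\<close>.\<close>

lemma H_torsion_free:
  assumes n: "n = 1" and y: "y \<in> carrier H" and m: "m \<noteq> (0::int)" and ym: "y [^] m = \<one>" shows "y = \<one>"
proof (rule residual_eq_one[OF y])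
  fix N assume N: "N \<in> finite_index_normal H"
  obtain J where J: "J > (0::nat)" "\<forall>d\<in>carrier H. d [^] J \<in> N"
    using H.finite_index_exponent[OF N] by blast
  have pos: "\<bar>m\<bar> * int J > 0" using m J(1) by simp
  obtain N1 where N1: "N1 \<in> finite_index_normal H"
    "\<forall>p q r::int. appr N1 ((T [^]\<^bsub>\<Gamma>\<^esub> p \<otimes>\<^bsub>\<Gamma>\<^esub> A [^]\<^bsub>\<Gamma>\<^esub> q) [^]\<^bsub>\<Gamma>\<^esub> r) \<one> \<longrightarrow>
      \<bar>m\<bar> * int J dvd p * r \<and> \<bar>m\<bar> * int J dvd q * r"
    by (rule exponents_separated[OF n pos])
  obtain v i where vi: "appr (N \<inter> N1) (T [^]\<^bsub>\<Gamma>\<^esub> (v::nat) \<otimes>\<^bsub>\<Gamma>\<^esub> A [^]\<^bsub>\<Gamma>\<^esub> (i::int)) y"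
    using appr_form[OF H.finite_index_normal_Int[OF N N1(1)] y] by blast
  note vi' = appr_IntD[OF N N1(1) vi]
  have "appr N1 ((T [^]\<^bsub>\<Gamma>\<^esub> int v \<otimes>\<^bsub>\<Gamma>\<^esub> A [^]\<^bsub>\<Gamma>\<^esub> i) [^]\<^bsub>\<Gamma>\<^esub> m) \<one>"
    using appr_int_pow[OF N1(1) vi'(2), of m] by (simp add: ym int_pow_int)
  then have "\<bar>m\<bar> * int J dvd int v * m" "\<bar>m\<bar> * int J dvd i * m" using N1(2) by blast+
  moreover have "int J dvd z" if "\<bar>m\<bar> * int J dvd z * m" for z
  proof -
    have "\<bar>m * int J\<bar> dvd m * z" using that by (simp add: abs_mult mult.commute)
    then have "m * int J dvd m * z" by (simp only: abs_dvd_iff)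
    then show ?thesis using m by simp
  qed
  ultimately have dv: "int J dvd int v" "int J dvd i" by blast+
  obtain \<alpha> where \<alpha>: "appr N A \<alpha>" using appr_total[OF N A_closed] by blast
  obtain \<beta> where \<beta>: "appr N T \<beta>" using appr_total[OF N T_closed] by blast
  have c: "\<alpha> \<in> carrier H" "\<beta> \<in> carrier H" using appr_closed \<alpha> \<beta> by auto
  have Jpow: "d [^] z \<in> N" if d: "d \<in> carrier H" and z: "int J dvd z" for d z
  proof -
    obtain w where "z = int J * w" using z by (rule dvdE)
    then have "d [^] z = (d [^] J) [^] w" using H.int_pow_pow[OF d, of "int J" w] by (simp add: int_pow_int)
    then show ?thesis using finite_index_H(7)[OF N] J(2) d by simp
  qed
  have "\<beta> [^] int v \<otimes> \<alpha> [^] i \<in> N" by (intro finite_index_H(5)[OF N] Jpow c dv)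
  moreover have "appr N (T [^]\<^bsub>\<Gamma>\<^esub> v \<otimes>\<^bsub>\<Gamma>\<^esub> A [^]\<^bsub>\<Gamma>\<^esub> i) (\<beta> [^] int v \<otimes> \<alpha> [^] i)"
    unfolding int_pow_int by (intro appr_mult[OF N] appr_nat_pow[OF N] appr_int_pow[OF N] \<alpha> \<beta>)
  ultimately have "appr N (T [^]\<^bsub>\<Gamma>\<^esub> v \<otimes>\<^bsub>\<Gamma>\<^esub> A [^]\<^bsub>\<Gamma>\<^esub> i) \<one>" using appr_kernelI[OF N] by blast
  then show "y \<in> N" by (rule appr_kernelD[OF N vi'(1)])
qed

text \<open>Modulo squares \<open>H\<close> is generated by representatives \<open>\<alpha>\<close>, \<open>\<beta>\<close> of \<open>A\<close>, \<open>T\<close>, and the element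
\<open>e = \<alpha>^(\<pi> \<beta>) \<beta>^(- \<pi> \<alpha>)\<close> of \<open>K\<close> generates \<open>K\<close> modulo squares. Indeed, for \<open>k\<close> in \<open>K\<close> both \<open>k^(\<pi> \<alpha>)\<close> and
\<open>k^(\<pi> \<beta>)\<close> are a square times a power of \<open>e\<close>, and writing \<open>t\<close> in terms of \<open>\<alpha>\<close> and \<open>\<beta>\<close> expresses \<open>1\<close> as a
combination of \<open>\<pi> \<alpha>\<close>, \<open>\<pi> \<beta>\<close> and an even number.\<close>

lemma K_modulo_squares:
  assumes n: "n = 1"
  shows "\<exists>e\<in>K. \<forall>k\<in>K. \<exists>c::int. \<exists>w\<in>K. k = e [^] c \<otimes> w [^] (2::int)"
proof -
  interpret HC: comm_group H by (rule H.group_comm_groupI) (rule H_commutes[OF n])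
  let ?Q = "{w [^] (2::int) | w. w \<in> carrier H}"
  have Q: "subgroup ?Q H"
  proof (rule H.subgroupI)
    show "?Q \<noteq> {}" using H.one_closed by blast
    show "inv x \<in> ?Q" if "x \<in> ?Q" for x
    proof -
      obtain u where "u \<in> carrier H" "x = u [^] (2::int)" using \<open>x \<in> ?Q\<close> by blast
      then have "inv u \<in> carrier H" "inv x = inv u [^] (2::int)" by (simp_all add: H.int_pow_inv)
      then show ?thesis by blast
    qed
    show "x \<otimes> y \<in> ?Q" if "x \<in> ?Q" "y \<in> ?Q" for x y
    proof -
      obtain u v where "u \<in> carrier H" "v \<in> carrier H" "x = u [^] (2::int)" "y = v [^] (2::int)"
        using \<open>x \<in> ?Q\<close> \<open>y \<in> ?Q\<close> by blast
      then have "u \<otimes> v \<in> carrier H" "x \<otimes> y = (u \<otimes> v) [^] (2::int)" by (simp_all add: HC.int_pow_distrib)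
      then show ?thesis by blast
    qed
  qed auto
  obtain S where S: "finite S" "S \<subseteq> carrier H" "generate H S = carrier H"
    using fg unfolding finitely_generated_group_def by blast
  have "finitely_many_cosets H ?Q"
  proof (rule HC.finitely_many_cosets_bounded_exponent[OF Q S(1,2), of 2])
    show "carrier H \<subseteq> generate H (S \<union> ?Q)"
      unfolding S(3)[symmetric] by (rule H.mono_generate) blast
  qed auto
  then obtain R where R: "finite R" "R \<subseteq> carrier H" "\<forall>y\<in>carrier H. \<exists>r\<in>R. \<exists>l\<in>?Q. y = r \<otimes> l"
    unfolding finitely_many_cosets_def by (elim exE conjE) (rule that)
  have "\<exists>s\<in>?Q. \<exists>r\<in>R. g = s \<otimes> r" if g: "g \<in> carrier H" for g
  proof -
    from bspec[OF R(3) g] obtain r l where rl: "r \<in> R" "l \<in> ?Q" "g = r \<otimes> l" by blast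
    have "g = l \<otimes> r"
      unfolding rl(3) using rl(1,2) R(2) by (intro H_commutes[OF n]) auto
    then show ?thesis using rl(1,2) by blast
  qed
  then have "\<exists>N\<in>finite_index_normal H. N \<subseteq> ?Q" by (rule H.normal_core_finite_index[OF Q R(1,2)])
  then obtain N where N: "N \<in> finite_index_normal H" "N \<subseteq> ?Q" by (elim bexE) (rule that)
  obtain \<alpha> where \<alpha>: "appr N A \<alpha>" using appr_total[OF N(1) A_closed] by blast
  obtain \<beta> where \<beta>: "appr N T \<beta>" using appr_total[OF N(1) T_closed] by blast
  have c: "\<alpha> \<in> carrier H" "\<beta> \<in> carrier H" using appr_closed \<alpha> \<beta> by auto
  have form: "\<exists>z\<in>carrier H. \<exists>v i::int. d = z [^] (2::int) \<otimes> (\<beta> [^] v \<otimes> \<alpha> [^] i) \<and>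
      \<pi> d = 2 * \<pi> z + (v * \<pi> \<beta> + i * \<pi> \<alpha>)" if d: "d \<in> carrier H" for d
  proof -
    obtain v i where vi: "appr N (T [^]\<^bsub>\<Gamma>\<^esub> (v::nat) \<otimes>\<^bsub>\<Gamma>\<^esub> A [^]\<^bsub>\<Gamma>\<^esub> (i::int)) d"
      using appr_form[OF N(1) d] by blast
    have "appr N (T [^]\<^bsub>\<Gamma>\<^esub> v \<otimes>\<^bsub>\<Gamma>\<^esub> A [^]\<^bsub>\<Gamma>\<^esub> i) (\<beta> [^] int v \<otimes> \<alpha> [^] i)"
      unfolding int_pow_int by (intro appr_mult[OF N(1)] appr_nat_pow[OF N(1)] appr_int_pow[OF N(1)] \<alpha> \<beta>)
    from appr_eqD[OF N(1) this vi] have "d \<otimes> inv (\<beta> [^] int v \<otimes> \<alpha> [^] i) \<in> ?Q" using N(2) by blast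
    then obtain z where z: "z \<in> carrier H" "d \<otimes> inv (\<beta> [^] int v \<otimes> \<alpha> [^] i) = z [^] (2::int)" by blast
    have "\<beta> [^] int v \<otimes> \<alpha> [^] i \<in> carrier H" using c by simp
    with d have "d \<otimes> inv (\<beta> [^] int v \<otimes> \<alpha> [^] i) \<otimes> (\<beta> [^] int v \<otimes> \<alpha> [^] i) = d"
      by (simp only: H.m_assoc H.inv_closed H.l_inv H.r_one)
    then have eq: "d = z [^] (2::int) \<otimes> (\<beta> [^] int v \<otimes> \<alpha> [^] i)" unfolding z(2) by (rule HOL.sym)
    have "\<pi> (z [^] (2::int) \<otimes> (\<beta> [^] int v \<otimes> \<alpha> [^] i)) = 2 * \<pi> z + (int v * \<pi> \<beta> + i * \<pi> \<alpha>)"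
      using z(1) c by (simp add: \<pi>.hom_int_pow)
    then have "\<pi> d = 2 * \<pi> z + (int v * \<pi> \<beta> + i * \<pi> \<alpha>)" unfolding eq[symmetric] .
    then show ?thesis using eq by (intro bexI[OF _ z(1)] exI[of _ "int v"] exI[of _ i] conjI)
  qed
  define a where "a = \<pi> \<alpha>"
  define b where "b = \<pi> \<beta>"
  define e where "e = \<alpha> [^] b \<otimes> \<beta> [^] (- a)"
  have e: "e \<in> carrier H" "\<pi> e = 0" using c by (simp_all add: e_def a_def b_def \<pi>.hom_int_pow)
  obtain z0 v0 i0 where t0: "2 * \<pi> z0 + (v0 * b + i0 * a) = 1"
    using form[OF t] unfolding a_def b_def by auto
  have "\<exists>c::int. \<exists>w\<in>K. k = e [^] c \<otimes> w [^] (2::int)" if k: "k \<in> K" for k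
  proof -
    have kc: "k \<in> carrier H" "\<pi> k = 0" using K_memD[OF k] by auto
    obtain z v i where z: "z \<in> carrier H" and kz: "k = z [^] (2::int) \<otimes> (\<beta> [^] v \<otimes> \<alpha> [^] i)"
      and deg: "2 * \<pi> z + (v * b + i * a) = 0"
      using form[OF kc(1)] kc(2) unfolding a_def b_def by auto
    define p where "p = \<pi> z"
    define W1 where "W1 = z [^] a \<otimes> \<alpha> [^] (- p)"
    define W2 where "W2 = z [^] b \<otimes> \<beta> [^] (- p)"
    have W: "W1 \<in> carrier H" "W2 \<in> carrier H" using z c by (simp_all add: W1_def W2_def)
    have ka: "k [^] a = W1 [^] (2::int) \<otimes> e [^] (- v)"
    proof -
      have "i * a = - p * 2 + b * (- v)" using deg by (simp add: p_def algebra_simps)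
      then have "\<alpha> [^] (i * a) = \<alpha> [^] (- p * 2) \<otimes> \<alpha> [^] (b * (- v))"
        using c(1) by (simp only: H.int_pow_mult)
      moreover have "k [^] a = z [^] (2 * a) \<otimes> (\<beta> [^] (v * a) \<otimes> \<alpha> [^] (i * a))"
        using z c by (simp add: kz HC.int_pow_distrib H.int_pow_pow)
      moreover have "W1 [^] (2::int) \<otimes> e [^] (- v)
          = (z [^] (a * 2) \<otimes> \<alpha> [^] (- p * 2)) \<otimes> (\<alpha> [^] (b * (- v)) \<otimes> \<beta> [^] (- a * (- v)))"
        using z c by (simp only: W1_def e_def HC.int_pow_distrib H.int_pow_pow H.int_pow_closed)
      ultimately show ?thesis
        using z c by (simp add: HC.m_ac mult.commute)
    qed
    have kb: "k [^] b = W2 [^] (2::int) \<otimes> e [^] i"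
    proof -
      have "v * b = - p * 2 + - a * i" using deg by (simp add: p_def algebra_simps)
      then have "\<beta> [^] (v * b) = \<beta> [^] (- p * 2) \<otimes> \<beta> [^] (- a * i)"
        using c(2) by (simp only: H.int_pow_mult)
      moreover have "k [^] b = z [^] (2 * b) \<otimes> (\<beta> [^] (v * b) \<otimes> \<alpha> [^] (i * b))"
        using z c by (simp add: kz HC.int_pow_distrib H.int_pow_pow)
      moreover have "W2 [^] (2::int) \<otimes> e [^] i
          = (z [^] (b * 2) \<otimes> \<beta> [^] (- p * 2)) \<otimes> (\<alpha> [^] (b * i) \<otimes> \<beta> [^] (- a * i))"
        using z c by (simp only: W2_def e_def HC.int_pow_distrib H.int_pow_pow H.int_pow_closed)
      ultimately show ?thesis
        using z c by (simp add: HC.m_ac mult.commute)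
    qed
    define w where "w = k [^] \<pi> z0 \<otimes> (W2 [^] v0 \<otimes> W1 [^] i0)"
    have wc: "w \<in> carrier H" using kc W by (simp add: w_def)
    have "k = k [^] (2 * \<pi> z0 + (v0 * b + i0 * a))" using kc(1) by (simp add: t0)
    also have "\<dots> = (k [^] \<pi> z0) [^] (2::int) \<otimes> ((k [^] b) [^] v0 \<otimes> (k [^] a) [^] i0)"
      using kc(1) by (simp add: H.int_pow_mult H.int_pow_pow mult.commute)
    also have "\<dots> = (e [^] (i * v0) \<otimes> e [^] (- v * i0)) \<otimes> w [^] (2::int)"
      using kc(1) W e(1)
      by (simp add: ka kb w_def HC.int_pow_distrib H.int_pow_pow HC.m_ac mult.commute)
    also have "\<dots> = e [^] (i * v0 + - v * i0) \<otimes> w [^] (2::int)"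
      using e(1) by (simp only: H.int_pow_mult)
    finally have kw: "k = e [^] (i * v0 + - v * i0) \<otimes> w [^] (2::int)" .
    have "\<pi> (e [^] (i * v0 + - v * i0) \<otimes> w [^] (2::int)) = 2 * \<pi> w"
      using e wc by (simp add: \<pi>.hom_int_pow)
    then have "\<pi> w = 0" using kw kc(2) by simp
    then have "w \<in> K" using wc by (simp add: K_def)
    then show ?thesis using kw by blast
  qed
  moreover have "e \<in> K" using e by (simp add: K_def)
  ultimately show ?thesis by blast
qed

text \<open>If \<open>K\<close> is trivial, then a combination \<open>T^p A^q\<close> matched with an element of degree zero is trivial in \<open>H/N\<close>,
and for a suitable \<open>N\<close> this makes \<open>p\<close> and \<open>q\<close> even. But the degrees of two representatives admit a
relation with coprime coefficients.\<close>

lemma K_nontrivial_abelian: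
  assumes n: "n = 1" shows "K \<noteq> {\<one>}"
proof
  assume K: "K = {\<one>}"
  have "(2::int) > 0" by simp
  from exponents_separated[OF n this] obtain N where N: "N \<in> finite_index_normal H"
    "\<forall>p q r::int. appr N ((T [^]\<^bsub>\<Gamma>\<^esub> p \<otimes>\<^bsub>\<Gamma>\<^esub> A [^]\<^bsub>\<Gamma>\<^esub> q) [^]\<^bsub>\<Gamma>\<^esub> r) \<one> \<longrightarrow> 2 dvd p * r \<and> 2 dvd q * r"
    by metis
  obtain \<alpha> where \<alpha>: "appr N A \<alpha>" using appr_total[OF N(1) A_closed] by blast
  obtain \<beta> where \<beta>: "appr N T \<beta>" using appr_total[OF N(1) T_closed] by blast
  have c: "\<alpha> \<in> carrier H" "\<beta> \<in> carrier H" using appr_closed \<alpha> \<beta> by auto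
  have even: "2 dvd p \<and> 2 dvd q" if "p * \<pi> \<beta> + q * \<pi> \<alpha> = 0" for p q :: int
  proof -
    have "\<beta> [^] p \<otimes> \<alpha> [^] q \<in> K" using c that by (simp add: K_def \<pi>.hom_int_pow)
    then have one: "\<beta> [^] p \<otimes> \<alpha> [^] q = \<one>" using K by simp
    have "appr N (T [^]\<^bsub>\<Gamma>\<^esub> p \<otimes>\<^bsub>\<Gamma>\<^esub> A [^]\<^bsub>\<Gamma>\<^esub> q) (\<beta> [^] p \<otimes> \<alpha> [^] q)"
      by (intro appr_mult[OF N(1)] appr_int_pow[OF N(1)] \<alpha> \<beta>)
    then have "appr N ((T [^]\<^bsub>\<Gamma>\<^esub> p \<otimes>\<^bsub>\<Gamma>\<^esub> A [^]\<^bsub>\<Gamma>\<^esub> q) [^]\<^bsub>\<Gamma>\<^esub> (1::int)) \<one>" unfolding one by simp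
    then have "2 dvd p * 1 \<and> 2 dvd q * 1" using N(2) by blast
    then show ?thesis by simp
  qed
  define g where "g = gcd (\<pi> \<alpha>) (\<pi> \<beta>)"
  show False
  proof (cases "g = 0")
    case True
    then have "1 * \<pi> \<beta> + 1 * \<pi> \<alpha> = 0" by (simp add: g_def)
    from even[OF this] show False by simp
  next
    case False
    have cop: "coprime (\<pi> \<alpha> div g) (\<pi> \<beta> div g)" using False by (simp add: g_def div_gcd_coprime)
    have "\<pi> \<alpha> = g * (\<pi> \<alpha> div g)" "\<pi> \<beta> = g * (\<pi> \<beta> div g)" by (simp_all add: g_def)
    then have "(\<pi> \<alpha> div g) * \<pi> \<beta> + (- (\<pi> \<beta> div g)) * \<pi> \<alpha> = 0" by (metis add.right_inverse mult.commute mult.left_commute mult_minus_left)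
    from even[OF this] have "2 dvd \<pi> \<alpha> div g" "2 dvd \<pi> \<beta> div g" by simp_all
    then show False using coprime_common_divisor[OF cop, of 2] by simp
  qed
qed

text \<open>By \<open>nakayama_rank\<close> with \<open>q = 2\<close> the finitely generated torsion-free group \<open>K\<close> has rank one, so it is
infinite cyclic; the isomorphism sends \<open>A\<close> to its generator and \<open>T\<close> to \<open>t\<close>.\<close>

theorem isomorphic_abelian:
  assumes n: "n = 1" shows "\<Gamma> \<cong> H"
proof -
  interpret KG: comm_group KG
    by (rule KG_comm_groupI) (blast intro: H_commutes[OF n] K_memD)
  have stableI: "stable L" if L: "subgroup L KG" for L
  proof -
    have L': "subgroup L H" "L \<subseteq> K" using L by (simp_all add: KG_subgroup_iff)
    have "inv t \<otimes> l \<otimes> t = l \<and> t \<otimes> l \<otimes> inv t = l" if "l \<in> L" for l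
    proof -
      have lc: "l \<in> carrier H" using L'(2) that K_memD by blast
      then show ?thesis using H_commutes[OF n lc t] H_commutes[OF n lc H.inv_closed[OF t]]
        by (simp add: H.m_assoc) (simp add: H.m_assoc[symmetric])
    qed
    then show ?thesis using L' by (simp add: stable_def)
  qed
  obtain F where F: "finite F" "F \<subseteq> K" "\<forall>L. stable L \<longrightarrow> F \<subseteq> L \<longrightarrow> K \<subseteq> L"
    by (rule K_finitely_generated)
  have F': "F \<subseteq> carrier KG" using F(2) by simp
  obtain e where e: "e \<in> K" "\<forall>k\<in>K. \<exists>c::int. \<exists>w\<in>K. k = e [^] c \<otimes> w [^] (2::int)"
    using K_modulo_squares[OF n] by (elim bexE) (rule that)
  have ek: "e \<in> carrier KG" using e(1) by simp
  let ?B = "generate KG {e}"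
  have B: "subgroup ?B KG" by (rule KG.generate_is_subgroup) (use e(1) in simp)
  have rank: "\<exists>m i. m \<noteq> (0::int) \<and> y [^]\<^bsub>KG\<^esub> m = e [^]\<^bsub>KG\<^esub> (i::int)" if y: "y \<in> carrier KG" for y
  proof -
    have "\<exists>m. coprime m 2 \<and> y [^]\<^bsub>KG\<^esub> (m::int) \<in> ?B"
    proof (rule KG.nakayama_rank[OF _ F(1) F' B _ _ y])
      show "\<exists>i::int. \<exists>v\<in>carrier KG. y = e [^]\<^bsub>KG\<^esub> i \<otimes>\<^bsub>KG\<^esub> v [^]\<^bsub>KG\<^esub> (2::int)" if "y \<in> carrier KG" for y
        using e that by (simp add: KG_pow)
      show "e \<in> ?B" by (rule generate.incl) simp
      have sub: "?B \<union> F \<subseteq> carrier KG" using KG.generate_incl[of "{e}"] ek F' by simp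
      note sg = KG.generate_is_subgroup[OF sub]
      have "F \<subseteq> generate KG (?B \<union> F)" by (auto intro: generate.incl)
      then have all: "K \<subseteq> generate KG (?B \<union> F)" using F(3) stableI[OF sg] by blast
      show "\<exists>m. coprime m 2 \<and> y [^]\<^bsub>KG\<^esub> (m::int) \<in> generate KG (?B \<union> F)" if "y \<in> carrier KG" for y
        using all that KG.int_pow_1[OF that] by (intro exI[of _ 1]) auto
    qed
    then obtain m where m: "coprime m 2" "y [^]\<^bsub>KG\<^esub> (m::int) \<in> ?B" by blast
    have "m \<noteq> 0" using m(1) by auto
    moreover have "\<exists>i::int. y [^]\<^bsub>KG\<^esub> m = e [^]\<^bsub>KG\<^esub> i" using m(2) KG.generate_pow[OF ek] by auto
    ultimately show ?thesis by blast
  qed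
  have "\<exists>x\<in>carrier KG. \<forall>y\<in>F. \<exists>i::int. y = x [^]\<^bsub>KG\<^esub> i"
  proof (rule KG.fg_rank_one_cyclic[OF _ ek rank F(1) F'])
    show "y = \<one>\<^bsub>KG\<^esub>" if "y \<in> carrier KG" "m \<noteq> (0::int)" "y [^]\<^bsub>KG\<^esub> m = \<one>\<^bsub>KG\<^esub>" for y m
      using H_torsion_free[OF n _ that(2), of y] that K_memD by (simp add: KG_pow)
  qed
  then obtain x where x: "x \<in> carrier KG" "\<forall>y\<in>F. \<exists>i::int. y = x [^]\<^bsub>KG\<^esub> i" by (elim bexE) (rule that)
  have xK: "x \<in> K" using x(1) by simp
  have xc: "x \<in> carrier H" "\<pi> x = 0" using K_memD[OF xK] by auto
  have span: "K \<subseteq> L" if L: "subgroup L KG" "x \<in> L" for L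
  proof -
    have "F \<subseteq> L"
    proof
      fix y assume "y \<in> F"
      then obtain i :: int where "y = x [^]\<^bsub>KG\<^esub> i" using x(2) by blast
      then show "y \<in> L" using KG.subgroup_int_pow_closed[OF L] by simp
    qed
    then show ?thesis using F(3) stableI[OF L(1)] by blast
  qed
  have x1: "x \<noteq> \<one>"
  proof
    assume "x = \<one>"
    then have "K \<subseteq> {\<one>}" using span[OF KG.triv_subgroup] by simp
    then show False using K_nontrivial_abelian[OF n] xK by blast
  qed
  show ?thesis
  proof (rule isomorphic_if_presented[OF H.is_group xc(1) t _ \<pi>_hom xc(2)])
    have "inv t \<otimes> x \<otimes> t = x"
      using H_commutes[OF n xc(1) t] xc(1) by (simp add: H.m_assoc) (simp add: H.m_assoc[symmetric])
    then show "inv t \<otimes> x \<otimes> t = x [^] n" using n xc(1) by simp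
    show "\<pi> t \<noteq> 0" by simp
    show "carrier H \<subseteq> S" if S: "subgroup S H" "x \<in> S" "t \<in> S" for S
    proof -
      have "subgroup (S \<inter> K) KG"
        using H.subgroups_Inter_pair[OF S(1) K_subgroup] by (simp add: KG_subgroup_iff)
      then have "K \<subseteq> S \<inter> K" using span S(2) xK by blast
      then show ?thesis using stable_generates[OF stable_K _ S(1) _ S(3)] by blast
    qed
    show "k = 0" if "x [^] k = \<one>" for k :: int
      using H_torsion_free[OF n xc(1) _ that] x1 by blast
  qed
qed

end

section \<open>Profinite rigidity\<close>

theorem theoremA:
  fixes n :: int
  shows "profinitely_rigid TYPE('b) (BS1 n)"
proof -
  interpret baumslag_solitar n .
  have "\<Gamma> \<cong> \<Delta>"
    if fg: "finitely_generated_group \<Delta>" and rf: "residually_finite \<Delta>"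
      and iso: "profinitely_isomorphic \<Gamma> \<Delta>" for \<Delta> :: "'b monoid"
  proof -
    interpret \<Delta>: group \<Delta> using rf by (simp add: residually_finite_def)
    obtain appr where "quotient_matching \<Gamma> \<Delta> appr"
      using profinitely_isomorphic_matching[OF \<Gamma>.is_group \<Delta>.is_group iso] by blast
    then interpret quotient_matching \<Gamma> \<Delta> appr .
    obtain \<epsilon> where \<epsilon>: "\<epsilon> \<in> hom \<Gamma> integer_group" "\<epsilon> A = 0" "\<epsilon> T = 1" by (rule degree_hom)
    obtain \<pi> t where \<pi>: "\<pi> \<in> hom \<Delta> integer_group" "t \<in> carrier \<Delta>" "\<pi> t = 1"
      using integer_hom_transfer[OF \<epsilon>(1) T_closed \<epsilon>(3) fg] by (elim bexE) (rule that)
    interpret bs_matching n \<Delta> appr \<pi> t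
      by unfold_locales (fact \<pi> fg rf)+
    show ?thesis
    proof (cases "n = 1")
      case True
      then show ?thesis by (rule isomorphic_abelian)
    next
      case False
      then interpret bs_matching_nonabelian n \<Delta> appr \<pi> t by unfold_locales
      show ?thesis by (rule isomorphic)
    qed
  qed
  moreover have "profinitely_isomorphic \<Gamma> \<Delta>"
    if rf: "residually_finite \<Delta>" and iso: "\<Gamma> \<cong> \<Delta>" for \<Delta> :: "'b monoid"
  proof -
    have "group \<Delta>" using rf unfolding residually_finite_def by (rule conjunct1)
    then show ?thesis by (rule iso_imp_profinitely_isomorphic[OF \<Gamma>.is_group _ iso])
  qed
  ultimately show ?thesis
    using finitely_generated residually_finite unfolding profinitely_rigid_def by blast
qed

end
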